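(* Suppose that the sequence $(a_i)_{i\ge1}$ is bounded and that $\mathsf H(\mathbf a)=\sum_{i\ge1}\frac{a_i^2}{A_i}<\infty$. Then almost surely there exists a probability measure $\mu$ on $\mathcal T$ such that $$\mu_n\to\mu\quad\text{weakly as } n\to\infty .$$ Furthermore, conditionally on $\mu$, the point $X=\lim_{n\to\infty}X_n$ is distributed according to $\mu$ almost surely, and there is the following dichotomy: \begin{itemize} \item if $\sum_i a_i=\infty$ then $\mu$ is almost surely supported by the leaves of $\mathcal T$; \item if $\sum_i a_i<\infty$ then $\mu$ is almost surely supported by the skeleton of $\mathcal T$ and coincides with the normalized length measure of $\mathcal T$. \end{itemize}
   Context: Let $\mathbf a=(a_i)_{i\ge 1}$ be a deterministic sequence of positive real numbers and $A_i=a_1+\dots+a_i$. The random trees $(\mathcal T_n)_{n\ge1}$ are built recursively: $\mathcal T_1$ is a closed segment of length $a_1$ rooted at one of its ends $\rho$; given $\mathcal T_1,\dots,\mathcal T_n$, the tree $\mathcal T_{n+1}$ is obtained by gluing one end of a new closed segment of length $a_{n+1}$ at a point of $\mathcal T_n$ chosen according to the normalized length measure $\mu_n$ of $\mathcal T_n$ (a probability measure). Concretely, $\mathcal T_1=\{(x,0,0,\dots):x\in[0,a_1]\}\subset\ell^1(\mathbb R)$ and $\mathcal T_{n+1}=\mathcal T_n\cup\{(u_1,\dots,u_n,x,0,0,\dots):x\in[0,a_{n+1}]\}$ where $(u_1,\dots,u_n,0,\dots)$ is the chosen point of $\mathcal T_n$. The tree $\mathcal T$ is the closure in $\ell^1(\mathbb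 R)$ (completion) of $\bigcup_n\mathcal T_n$, and the measures $\mu_n$ are viewed as random probability measures on $\ell^1(\mathbb R)$. The tree is built jointly with a sequence of points $X_n\in\mathcal T_n$ as follows. Let $(U_i,V_i)_{i\ge1}$ be i.i.d. uniform variables on $(0,1)$ (all independent). $X_1$ is the point of $\mathcal T_1$ at distance $a_1V_1$ from the root. Given $(\mathcal T_n,X_n)$: if $U_{n+1}\le a_{n+1}/A_{n+1}$, the segment of length $a_{n+1}$ is glued at $X_n$ to get $\mathcal T_{n+1}$, and $X_{n+1}$ is the point of this segment at distance $a_{n+1}V_{n+1}$ from $X_n$; if $U_{n+1}>a_{n+1}/A_{n+1}$, the segment of length $a_{n+1}$ is glued at a point chosen uniformly on $\mathcal T_n$, independently of $X_n$, and $X_{n+1}=X_n$. (Then $(\mathcal T_n)$ has the law of the sequence of random trees started from a segment of length $a_1$ and obtained by recursively gluing, for each $n\ge1$, one end of a new segment of length $a_{n+1}$ at a point of $\mathcal T_n$ chosen according to $\mu_n$ given $\mathcal T_1,\dots,\mathcal T_n$; $X_n$ has conditional law $\mu_n$ given $\mathcal T_n$, and when $\mathsf H(\mathbf a)<\infty$ the sequence $(X_n)$ converges a.s. in $\mathcal T$.) A leaf of $\mathcal T$ is a point $x$ such that $\mathcal T\setminus\{x\}$ stays connected; the skeleton is the complement of the set of leaves. "Supported by $S$" means that $\mu$ gives full mass to $S$. *)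

theory Defs
  imports "HOL-Probability.Probability"
begin

section \<open>The Banach space of absolutely summable real sequences\<close>

typedef ell1 = "{f :: nat \<Rightarrow> real. summable (\<lambda>i. \<bar>f i\<bar>)}"
  morphisms coord Abs_ell1
  by (rule exI[of _ "\<lambda>_. 0"]) simp

setup_lifting type_definition_ell1

lemma summable_coord: "summable (\<lambda>i. \<bar>coord x i\<bar>)"
  using coord[of x] by simp

lemma ell1_eqI: "(\<And>i. coord x i = coord y i) \<Longrightarrow> x = y"
  by (simp add: coord_inject[symmetric] fun_eq_iff)

instantiation ell1 :: real_vector
begin

lift_definition zero_ell1 :: ell1 is "\<lambda>_. 0" by simp

lift_definition plus_ell1 :: "ell1 \<Rightarrow> ell1 \<Rightarrow> ell1" is "\<lambda>f g i. f i + g i"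
proof -
  fix f g :: "nat \<Rightarrow> real"
  assume "summable (\<lambda>i. \<bar>f i\<bar>)" "summable (\<lambda>i. \<bar>g i\<bar>)"
  from summable_add[OF this] show "summable (\<lambda>i. \<bar>f i + g i\<bar>)"
    by (rule summable_comparison_test'[where N = 0]) simp
qed

lift_definition uminus_ell1 :: "ell1 \<Rightarrow> ell1" is "\<lambda>f i. - f i"
  by simp

definition minus_ell1 :: "ell1 \<Rightarrow> ell1 \<Rightarrow> ell1" where
  "x - y = x + - (y :: ell1)"

lift_definition scaleR_ell1 :: "real \<Rightarrow> ell1 \<Rightarrow> ell1" is "\<lambda>c f i. c * f i"
  by (simp add: abs_mult summable_mult)

instance
  by standard (unfold minus_ell1_def, (transfer, simp add: algebra_simps)+)

end

lemma coord_zero [simp]: "coord 0 i = 0"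
  by (simp add: zero_ell1.rep_eq)

lemma coord_add [simp]: "coord (x + y) i = coord x i + coord y i"
  by (simp add: plus_ell1.rep_eq)

lemma coord_uminus [simp]: "coord (- x) i = - coord x i"
  by (simp add: uminus_ell1.rep_eq)

lemma coord_diff [simp]: "coord (x - y) i = coord x i - coord y i"
  unfolding minus_ell1_def coord_add coord_uminus by simp

lemma coord_scaleR [simp]: "coord (c *\<^sub>R x) i = c * coord x i"
  by (simp add: scaleR_ell1.rep_eq)

instantiation ell1 :: real_normed_vector
begin

definition norm_ell1 :: "ell1 \<Rightarrow> real" where
  "norm_ell1 x = (\<Sum>i. \<bar>coord x i\<bar>)"

definition dist_ell1 :: "ell1 \<Rightarrow> ell1 \<Rightarrow> real" where
  "dist_ell1 x y = norm (x - y)"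

definition sgn_ell1 :: "ell1 \<Rightarrow> ell1" where
  "sgn_ell1 x = x /\<^sub>R norm x"

definition uniformity_ell1 :: "(ell1 \<times> ell1) filter" where
  "uniformity_ell1 = (INF e\<in>{0<..}. principal {(x, y). dist x y < e})"

definition open_ell1 :: "ell1 set \<Rightarrow> bool" where
  "open_ell1 S = (\<forall>x\<in>S. \<forall>\<^sub>F (x', y) in uniformity. x' = x \<longrightarrow> y \<in> S)"

instance
proof
  fix x y :: ell1 and c :: real
  show "(norm x = 0) = (x = 0)"
    using suminf_eq_zero_iff[OF summable_coord[of x]]
    by (auto simp: norm_ell1_def intro: ell1_eqI)
  show "norm (x + y) \<le> norm x + norm y"
    unfolding norm_ell1_def suminf_add[OF summable_coord summable_coord]
    by (rule suminf_le[OF _ summable_coord summable_add[OF summable_coord summable_coord]])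
      (simp add: abs_triangle_ineq)
  show "norm (c *\<^sub>R x) = \<bar>c\<bar> * norm x"
    unfolding norm_ell1_def coord_scaleR abs_mult
    by (rule suminf_mult[OF summable_coord])
qed (simp_all add: dist_ell1_def sgn_ell1_def uniformity_ell1_def open_ell1_def)

end

lemma abs_coord_le_norm: "\<bar>coord x i\<bar> \<le> norm x"
  using sum_le_suminf[OF summable_coord, of "{i}" x] by (simp add: norm_ell1_def)

instance ell1 :: banach
proof
  fix X :: "nat \<Rightarrow> ell1"
  assume X: "Cauchy X"
  have "Cauchy (\<lambda>n. coord (X n) i)" for i
  proof (rule metric_CauchyI)
    fix e :: real
    assume "e > 0"
    then obtain N where N: "\<And>m n. m \<ge> N \<Longrightarrow> n \<ge> N \<Longrightarrow> dist (X m) (X n) < e"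
      using metric_CauchyD[OF X] by blast
    show "\<exists>N. \<forall>m\<ge>N. \<forall>n\<ge>N. dist (coord (X m) i) (coord (X n) i) < e"
    proof (intro exI[of _ N] allI impI)
      fix m n
      assume "m \<ge> N" "n \<ge> N"
      then show "dist (coord (X m) i) (coord (X n) i) < e"
        using N[of m n] abs_coord_le_norm[of "X m - X n" i] by (simp add: dist_norm)
    qed
  qed
  then have "\<forall>i. \<exists>l. (\<lambda>n. coord (X n) i) \<longlonglongrightarrow> l"
    by (simp add: Cauchy_convergent_iff convergent_def)
  then obtain l where l: "\<And>i. (\<lambda>n. coord (X n) i) \<longlonglongrightarrow> l i"
    by metis
  have bnd: "\<exists>N. \<forall>n\<ge>N. \<forall>k. (\<Sum>i<k. \<bar>coord (X n) i - l i\<bar>) \<le> e" if e: "e > 0" for e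
  proof -
    obtain N where N: "\<And>m n. m \<ge> N \<Longrightarrow> n \<ge> N \<Longrightarrow> dist (X m) (X n) < e"
      using metric_CauchyD[OF X e] by blast
    have "(\<Sum>i<k. \<bar>coord (X n) i - l i\<bar>) \<le> e" if n: "n \<ge> N" for n k
    proof (rule LIMSEQ_le_const2)
      show "(\<lambda>m. \<Sum>i<k. \<bar>coord (X n) i - coord (X m) i\<bar>) \<longlonglongrightarrow> (\<Sum>i<k. \<bar>coord (X n) i - l i\<bar>)"
        by (intro tendsto_intros l)
      have "(\<Sum>i<k. \<bar>coord (X n) i - coord (X m) i\<bar>) \<le> e" if m: "m \<ge> N" for m
      proof -
        have "(\<Sum>i<k. \<bar>coord (X n - X m) i\<bar>) \<le> norm (X n - X m)"
          unfolding norm_ell1_def by (rule sum_le_suminf[OF summable_coord]) auto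
        with N[OF n m] show ?thesis by (simp add: dist_norm)
      qed
      then show "\<exists>N. \<forall>m\<ge>N. (\<Sum>i<k. \<bar>coord (X n) i - coord (X m) i\<bar>) \<le> e" by blast
    qed
    then show ?thesis by blast
  qed
  have summ: "\<exists>N. \<forall>n\<ge>N. summable (\<lambda>i. \<bar>coord (X n) i - l i\<bar>) \<and> (\<Sum>i. \<bar>coord (X n) i - l i\<bar>) \<le> e"
    if "e > 0" for e
  proof -
    from bnd[OF that] obtain N where N: "\<And>n k. n \<ge> N \<Longrightarrow> (\<Sum>i<k. \<bar>coord (X n) i - l i\<bar>) \<le> e"
      by blast
    have *: "summable (\<lambda>i. \<bar>coord (X n) i - l i\<bar>)" if "n \<ge> N" for n
      by (rule summableI_nonneg_bounded[OF _ N[OF that]]) simp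
    then show ?thesis
      using suminf_le_const[OF * N] by blast
  qed
  obtain n where n: "summable (\<lambda>i. \<bar>coord (X n) i - l i\<bar>)"
    using summ[of 1] by auto
  have "summable (\<lambda>i. \<bar>l i\<bar>)"
    by (rule summable_comparison_test'[OF summable_add[OF n summable_coord[of "X n"]], where N = 0])
      (simp add: abs_if)
  then have L: "coord (Abs_ell1 l) = l"
    by (simp add: Abs_ell1_inverse)
  have "X \<longlonglongrightarrow> Abs_ell1 l"
  proof (rule metric_LIMSEQ_I)
    fix e :: real
    assume e: "e > 0"
    obtain N where N: "\<And>n. n \<ge> N \<Longrightarrow> (\<Sum>i. \<bar>coord (X n) i - l i\<bar>) \<le> e / 2"
      using summ[of "e / 2"] e by auto
    have "dist (X n) (Abs_ell1 l) < e" if "n \<ge> N" for n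
      using N[OF that] e by (simp add: dist_norm norm_ell1_def L)
    then show "\<exists>N. \<forall>n\<ge>N. dist (X n) (Abs_ell1 l) < e" by blast
  qed
  then show "convergent X" by (auto simp: convergent_def)
qed

lemma ell1_separable: "\<exists>D :: ell1 set. countable D \<and> (\<forall>x. \<forall>e>0. \<exists>d\<in>D. dist x d < e)"
proof -
  define h :: "rat list \<Rightarrow> nat \<Rightarrow> real"
    where "h = (\<lambda>qs i. if i < length qs then of_rat (qs ! i) else 0)"
  have h: "coord (Abs_ell1 (h qs)) = h qs" for qs
  proof (rule Abs_ell1_inverse)
    have "summable (\<lambda>i. \<bar>h qs i\<bar>)"
      by (rule summable_finite[of "{..<length qs}"]) (auto simp: h_def)
    then show "h qs \<in> {f. summable (\<lambda>i. \<bar>f i\<bar>)}" by simp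
  qed
  have "\<exists>qs. dist x (Abs_ell1 (h qs)) < e" if e: "e > 0" for x e
  proof -
    obtain N where N: "norm (\<Sum>i. \<bar>coord x (i + N)\<bar>) < e / 2"
      using suminf_exist_split[OF _ summable_coord[of x], of "e / 2"] e by auto
    have "\<exists>q. \<bar>coord x i - of_rat q\<bar> < e / (2 * (N + 1))" for i
    proof -
      have "coord x i - e / (2 * (N + 1)) < coord x i + e / (2 * (N + 1))"
        using e by simp
      from of_rat_dense[OF this] show ?thesis by (auto simp: abs_less_iff algebra_simps)
    qed
    then obtain q where q: "\<And>i. \<bar>coord x i - of_rat (q i)\<bar> < e / (2 * (N + 1))"
      by metis
    define qs where "qs = map q [0..<N]"
    let ?f = "\<lambda>i. \<bar>coord (x - Abs_ell1 (h qs)) i\<bar>"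
    have "norm (x - Abs_ell1 (h qs)) = (\<Sum>i. ?f (i + N)) + (\<Sum>i<N. ?f i)"
      unfolding norm_ell1_def by (rule suminf_split_initial_segment[OF summable_coord])
    also have "(\<Sum>i. ?f (i + N)) = (\<Sum>i. \<bar>coord x (i + N)\<bar>)"
      by (simp add: h) (simp add: h_def qs_def)
    also have "\<dots> < e / 2" using N by simp
    also have "(\<Sum>i<N. ?f i) \<le> (\<Sum>i<N. e / (2 * (N + 1)))"
    proof (rule sum_mono)
      fix i
      assume "i \<in> {..<N}"
      then have "?f i = \<bar>coord x i - of_rat (q i)\<bar>"
        unfolding coord_diff h by (simp add: h_def qs_def)
      with q[of i] show "?f i \<le> e / (2 * (N + 1))" by simp
    qed
    also have "\<dots> \<le> e / 2" using e by (simp add: field_simps)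
    finally show ?thesis by (auto simp: dist_norm)
  qed
  then show ?thesis
    by (intro exI[of _ "range (\<lambda>qs. Abs_ell1 (h qs))"]) auto
qed

instance ell1 :: second_countable_topology
proof
  obtain D :: "ell1 set" where D: "countable D" "\<And>x e. e > 0 \<Longrightarrow> \<exists>d\<in>D. dist x d < e"
    using ell1_separable by blast
  define B where "B = (\<lambda>(d, n). ball d (inverse (real (Suc n)))) ` (D \<times> UNIV)"
  have "topological_basis B"
  proof (rule topological_basisI)
    fix S and x :: ell1
    assume "open S" "x \<in> S"
    then obtain e where e: "e > 0" "ball x e \<subseteq> S" by (meson openE)
    obtain n where n: "inverse (real (Suc n)) < e / 2"
      using reals_Archimedean[of "e / 2"] e by auto
    obtain d where d: "d \<in> D" "dist x d < inverse (real (Suc n))"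
      using D(2)[of "inverse (real (Suc n))" x] by auto
    have "ball d (inverse (real (Suc n))) \<subseteq> ball x e"
    proof
      fix y
      assume "y \<in> ball d (inverse (real (Suc n)))"
      then show "y \<in> ball x e"
        using dist_triangle[of x y d] d n by (simp only: mem_ball)
    qed
    then show "\<exists>B'\<in>B. x \<in> B' \<and> B' \<subseteq> S"
      using d e unfolding B_def
      by (intro bexI[of _ "ball d (inverse (real (Suc n)))"]) (auto simp: dist_commute)
  qed (auto simp: B_def)
  moreover have "countable B" unfolding B_def using D(1) by auto
  ultimately show "\<exists>B :: ell1 set set. countable B \<and> open = generate_topology B"
    by (auto dest: topological_basis_imp_subbasis)
qed

instance ell1 :: polish_space ..

lift_definition axis_vec :: "nat \<Rightarrow> ell1" is "\<lambda>n i. if i = n then 1 else 0"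
  by (rule summable_finite[of "{n}" for n]) auto


section \<open>Trees glued from segments\<close>

text \<open>
  The lengths \<open>a\<close> are indexed from \<open>1\<close> (the value \<open>a 0\<close> is never used), while coordinates in
  \<open>ell1\<close> are indexed from \<open>0\<close>; so the segment of length \<open>a (Suc n)\<close> points in the direction
  \<open>axis_vec n\<close>.  It is glued at the point \<open>g n\<close> of the tree with \<open>n\<close> segments. The tree with \<open>0\<close>
  segments is the root \<open>0\<close>, and \<open>g 0 = 0\<close>.
\<close>

definition total_length :: "(nat \<Rightarrow> real) \<Rightarrow> nat \<Rightarrow> real" where
  "total_length a n = (\<Sum>i=1..n. a i)"

primrec finite_tree :: "(nat \<Rightarrow> real) \<Rightarrow> (nat \<Rightarrow> ell1) \<Rightarrow> nat \<Rightarrow> ell1 set" where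
  "finite_tree a g 0 = {0}"
| "finite_tree a g (Suc n) = finite_tree a g n \<union> {g n + x *\<^sub>R axis_vec n | x. x \<in> {0..a (Suc n)}}"

definition limit_tree :: "(nat \<Rightarrow> real) \<Rightarrow> (nat \<Rightarrow> ell1) \<Rightarrow> ell1 set" where
  "limit_tree a g = closure (\<Union>n\<in>{1..}. finite_tree a g n)"

text \<open>
  The length measure carried by the segments in directions \<open>I\<close>: the sum over \<open>i \<in> I\<close> of the images
  of Lebesgue measure on \<open>[0, a (Suc i)]\<close> under \<open>x \<mapsto> g i + x *\<^sub>R axis_vec i\<close>.  Distinct segments
  meet in at most one point.  As usual for real trees, the length measure of the completed tree
  (\<open>I = UNIV\<close>) does not charge the points added by the completion.
\<close>

definition length_measure :: "(nat \<Rightarrow> real) \<Rightarrow> (nat \<Rightarrow> ell1) \<Rightarrow> nat set \<Rightarrow> ell1 measure" where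
  "length_measure a g I =
     distr (restrict_space (count_space I \<Otimes>\<^sub>M lborel) (SIGMA i:I. {0..a (Suc i)})) borel
       (\<lambda>(i, x). g i + x *\<^sub>R axis_vec i)"

lemma emeasure_length_measure:
  assumes B: "B \<in> sets borel"
  shows "emeasure (length_measure a g I) B =
    (\<integral>\<^sup>+i. emeasure lborel {x \<in> {0..a (Suc i)}. g i + x *\<^sub>R axis_vec i \<in> B} \<partial>count_space I)"
proof -
  let ?P = "count_space I \<Otimes>\<^sub>M (lborel :: real measure)"
  let ?S = "SIGMA i:I. {0..a (Suc i)}"
  let ?f = "\<lambda>(i, x). g i + x *\<^sub>R axis_vec i"
  interpret lborel: sigma_finite_measure "lborel :: real measure" by (rule sigma_finite_lborel)
  have f: "?f \<in> ?P \<rightarrow>\<^sub>M borel"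
    by (rule measurable_pair_measure_countable1) auto
  have "?S = (\<Union>i\<in>I. {i} \<times> {0..a (Suc i)})" by auto
  then have S: "?S \<in> sets ?P" by (auto intro!: sets.countable_UN'' pair_measureI)
  then have SS: "?S \<inter> space ?P \<in> sets ?P" by (metis sets.Int sets.top)
  have fB: "?f -` B \<inter> ?S \<in> sets ?P"
  proof -
    have "?f -` B \<inter> ?S = (?f -` B \<inter> space ?P) \<inter> ?S" by (auto simp: space_pair_measure)
    then show ?thesis using measurable_sets[OF f B] S by auto
  qed
  have fR: "?f \<in> restrict_space ?P ?S \<rightarrow>\<^sub>M borel"
    using f by (rule measurable_restrict_space1)
  have sp: "space (restrict_space ?P ?S) = ?S"
    by (auto simp: space_restrict_space space_pair_measure)
  have "emeasure (length_measure a g I) B = emeasure (restrict_space ?P ?S) (?f -` B \<inter> ?S)"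
    unfolding length_measure_def by (subst emeasure_distr[OF fR B]) (simp only: sp)
  also have "\<dots> = emeasure ?P (?f -` B \<inter> ?S)"
    by (rule emeasure_restrict_space[OF SS]) auto
  also have "\<dots> = (\<integral>\<^sup>+i. emeasure lborel (Pair i -` (?f -` B \<inter> ?S)) \<partial>count_space I)"
    by (rule lborel.emeasure_pair_measure_alt[OF fB])
  also have "\<dots> = (\<integral>\<^sup>+i. emeasure lborel {x \<in> {0..a (Suc i)}. g i + x *\<^sub>R axis_vec i \<in> B} \<partial>count_space I)"
    by (rule nn_integral_cong, rule arg_cong[where f = "emeasure lborel"]) auto
  finally show ?thesis .
qed

definition normalized_length :: "(nat \<Rightarrow> real) \<Rightarrow> (nat \<Rightarrow> ell1) \<Rightarrow> nat set \<Rightarrow> ell1 measure" where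
  "normalized_length a g I = uniform_measure (length_measure a g I) UNIV"

definition leaves :: "'a::topological_space set \<Rightarrow> 'a set" where
  "leaves S = {x \<in> S. connected (S - {x})}"

definition skeleton :: "'a::topological_space set \<Rightarrow> 'a set" where
  "skeleton S = S - leaves S"


section \<open>Weak convergence\<close>

definition converges_weakly :: "(nat \<Rightarrow> 'a::topological_space measure) \<Rightarrow> 'a measure \<Rightarrow> bool" where
  "converges_weakly N L \<longleftrightarrow>
     (\<forall>f :: 'a \<Rightarrow> real. continuous_on UNIV f \<and> bounded (range f) \<longrightarrow>
        (\<lambda>n. \<integral>x. f x \<partial>N n) \<longlonglongrightarrow> (\<integral>x. f x \<partial>L))"


section \<open>The random construction\<close>

primrec marked_point ::
  "(nat \<Rightarrow> real) \<Rightarrow> (nat \<Rightarrow> 'w \<Rightarrow> real) \<Rightarrow> (nat \<Rightarrow> 'w \<Rightarrow> real) \<Rightarrow> nat \<Rightarrow> 'w \<Rightarrow> ell1" where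
  "marked_point a U V 0 \<omega> = 0"
| "marked_point a U V (Suc n) \<omega> =
     (if n = 0 \<or> U (Suc n) \<omega> \<le> a (Suc n) / total_length a (Suc n)
      then marked_point a U V n \<omega> + (a (Suc n) * V (Suc n) \<omega>) *\<^sub>R axis_vec n
      else marked_point a U V n \<omega>)"

text \<open>
  The \<open>\<sigma>\<close>-algebra generated by all the \<open>U i\<close> and \<open>V i\<close> together with the first \<open>n\<close> gluing points.
\<close>

definition gluing_history ::
  "'w measure \<Rightarrow> (nat \<Rightarrow> 'w \<Rightarrow> real) \<Rightarrow> (nat \<Rightarrow> 'w \<Rightarrow> real) \<Rightarrow> (nat \<Rightarrow> 'w \<Rightarrow> ell1) \<Rightarrow> nat \<Rightarrow> 'w measure" where
  "gluing_history M U V g n =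
     vimage_algebra (space M)
       (\<lambda>\<omega>. (\<lambda>i\<in>{1..}. U i \<omega>, \<lambda>i\<in>{1..}. V i \<omega>, \<lambda>k\<in>{..<n}. g k \<omega>))
       (PiM {1..} (\<lambda>_. borel) \<Otimes>\<^sub>M PiM {1..} (\<lambda>_. borel) \<Otimes>\<^sub>M PiM {..<n} (\<lambda>_. borel))"

text \<open>
  The randomness used for the uniform gluing points is independent of the variables \<open>U i\<close>, \<open>V i\<close>;
  hence the conditioning in \<open>glue_uniform\<close> is on all of these (and on the earlier gluing points),
  not only on \<open>U 1, V 1, \<dots>, U n, V n\<close>.
\<close>

locale segment_gluing = prob_space M
  for M :: "'w measure" +
  fixes a :: "nat \<Rightarrow> real"
    and U V :: "nat \<Rightarrow> 'w \<Rightarrow> real"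
    and g :: "nat \<Rightarrow> 'w \<Rightarrow> ell1"
  assumes length_pos: "i \<ge> 1 \<Longrightarrow> a i > 0"
    and indep: "indep_vars (\<lambda>_. borel) (\<lambda>(b, i). if b then U i else V i) (UNIV \<times> {1..})"
    and U_uniform: "i \<ge> 1 \<Longrightarrow> distr M borel (U i) = uniform_measure lborel {0<..<1}"
    and V_uniform: "i \<ge> 1 \<Longrightarrow> distr M borel (V i) = uniform_measure lborel {0<..<1}"
    and glue_measurable: "random_variable borel (g n)"
    and glue_root: "\<omega> \<in> space M \<Longrightarrow> g 0 \<omega> = 0"
    and glue_marked: "n \<ge> 1 \<Longrightarrow> \<omega> \<in> space M \<Longrightarrow> U (Suc n) \<omega> \<le> a (Suc n) / total_length a (Suc n) \<Longrightarrow>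
        g n \<omega> = marked_point a U V n \<omega>"
    and glue_uniform: "n \<ge> 1 \<Longrightarrow> B \<in> sets borel \<Longrightarrow>
        AE \<omega> in M. U (Suc n) \<omega> > a (Suc n) / total_length a (Suc n) \<longrightarrow>
          real_cond_exp M (gluing_history M U V g n) (\<lambda>\<omega>. indicator B (g n \<omega>)) \<omega> =
          measure (normalized_length a (\<lambda>k. g k \<omega>) {..<n}) B"

end

theory Submission
  imports Defs
begin

text \<open>
  Let \<open>\<mu>\<^sub>n\<close> be the normalized length measure of the tree with \<open>n\<close> segments, \<open>X\<^sub>n\<close> its marked point and
  \<open>A n\<close> its total length, with limit \<open>A \<infinity>\<close>.  Everything rests on one fact: given the gluing points of the first \<open>n\<close> segments, both \<open>X\<^sub>n\<close> and
  the next gluing point \<open>g n\<close> have law \<open>\<mu>\<^sub>n\<close> (\<open>marked_cond_law\<close>, \<open>gluing_cond_law\<close>).  The two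
  statements are proved by one induction.  With \<open>p n = a (n+1) / A (n+1)\<close>, the measure \<open>\<mu>\<^sub>n\<^sub>+\<^sub>1\<close> is the
  mixture of \<open>\<mu>\<^sub>n\<close>, with weight \<open>1 - p n\<close>, and of the uniform law on the new segment, with weight
  \<open>p n\<close>; the marked point jumps to a uniform point of the new segment exactly with probability
  \<open>p n\<close>, and the pair of variables deciding this is independent of all that was built before
  (\<open>indep_hist_tail\<close>).

  \<^emph>\<open>Convergence.\<close>  For a bounded function \<open>f\<close> with Lipschitz constant \<open>L\<close>, the difference of the
  integrals of \<open>f\<close> against \<open>\<mu>\<^sub>n\<^sub>+\<^sub>1\<close> and \<open>\<mu>\<^sub>n\<close> is \<open>p n * (f (g n) - \<integral>f d\<mu>\<^sub>n)\<close> plus an error of at most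
  \<open>L * a (n+1)\<^sup>2 / A (n+1)\<close>.  The errors are absolutely summable.  The main terms are bounded
  martingale differences, and their squares are summable because \<open>p n\<^sup>2 \<le> (a (n+1)\<^sup>2 / A (n+1)) / a 1\<close>;
  so the integrals converge almost surely (\<open>AE_integrals_converge\<close>).  The expected displacement of
  the marked point in one step is at most \<open>a (n+1)\<^sup>2 / A (n+1)\<close>, so \<open>X\<^sub>n\<close> converges to some \<open>X\<close>.  The
  measure \<open>\<mu>\<close> is \<^emph>\<open>defined\<close> as a regular conditional law of \<open>X\<close> given all gluing points.  Testing
  against events that depend on finitely many gluing points, where \<open>f (X\<^sub>m)\<close> and \<open>\<integral>f d\<mu>\<^sub>m\<close> have the
  same integral for all large \<open>m\<close>, identifies the limit of \<open>\<integral>f d\<mu>\<^sub>n\<close> as \<open>\<integral>f d\<mu>\<close>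
  (\<open>AE_integrals_tendsto\<close>).  Countably many functions \<open>f\<close> determine weak convergence
  (\<open>countable_convergence_determining\<close>), so \<open>\<mu>\<^sub>n\<close> converges weakly to \<open>\<mu>\<close> almost surely; and \<open>X\<close> has
  conditional law \<open>\<mu>\<close> given \<open>\<mu>\<close> since \<open>\<mu>\<close> is a function of the gluing points.

  \<^emph>\<open>Dichotomy.\<close>  If the total length is infinite, the probability that the marked point stays put
  between steps \<open>n\<close> and \<open>m\<close> is the telescoping product \<open>A n / A m\<close>, which tends to \<open>0\<close>.  So \<open>X\<close>,
  and with it \<open>\<mu>\<close>-almost every point, has infinitely many nonzero coordinates.  Such a point lies in
  no finite tree, and removing it leaves a set between the connected union of the finite trees and
  the closure of this union; hence it is a leaf (\<open>infinite_support_imp_leaf\<close>).  If the total length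
  is finite, \<open>\<mu>\<^sub>n\<close> is at most \<open>A \<infinity> / A n\<close> times the normalized length measure \<open>\<nu>\<close> of the whole tree,
  so the weak limit is at most \<open>\<nu>\<close> and therefore equal to it (\<open>weak_limit_eq_normalized_length\<close>).
  Almost every point for \<open>\<nu>\<close> is interior to a segment and is not a gluing point, and the coordinate
  of that segment separates the tree there (\<open>branch_interior_in_skeleton\<close>).
\<close>

section \<open>Conditional laws\<close>

text \<open>
  \<open>\<kappa>\<close> is a regular conditional law of \<open>Y\<close> given \<open>F\<close>.  The defining property is stated in integrated
  form, without conditional expectations: then there are no exceptional sets depending on \<open>B\<close>, and
  conditional laws can be chained by computing with nonnegative integrals.
\<close>

definition cond_law ::
  "'w measure \<Rightarrow> 'w measure \<Rightarrow> ('w \<Rightarrow> 'b) \<Rightarrow> 'b measure \<Rightarrow> ('w \<Rightarrow> 'b measure) \<Rightarrow> bool" where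
  "cond_law M F Y N \<kappa> \<longleftrightarrow>
     subalgebra M F \<and> Y \<in> M \<rightarrow>\<^sub>M N \<and> \<kappa> \<in> F \<rightarrow>\<^sub>M prob_algebra N \<and>
     (\<forall>A\<in>sets F. \<forall>B\<in>sets N.
        emeasure M {\<omega>\<in>A. Y \<omega> \<in> B} = (\<integral>\<^sup>+\<omega>. indicator A \<omega> * emeasure (\<kappa> \<omega>) B \<partial>M))"

lemma measurable_subalgebra_ident: "subalgebra M F \<Longrightarrow> (\<lambda>\<omega>. \<omega>) \<in> M \<rightarrow>\<^sub>M F"
  by (rule measurable_from_subalg[OF _ measurable_ident_sets[OF refl]])

text \<open>
  The definition says that the law of the pair \<open>(\<omega>, Y \<omega>)\<close> and the mixture of the laws
  \<open>\<delta>\<^sub>\<omega> \<otimes> \<kappa> \<omega>\<close> agree on rectangles, and rectangles determine a finite measure on the product.  This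
  is what allows integrands in which \<open>\<omega>\<close> and \<open>Y \<omega>\<close> are not separated.
\<close>

lemma cond_law_joint:
  assumes M: "prob_space M" and cl: "cond_law M F Y N \<kappa>"
  shows "distr M (F \<Otimes>\<^sub>M N) (\<lambda>\<omega>. (\<omega>, Y \<omega>)) =
         bind (restr_to_subalg M F) (\<lambda>\<omega>. distr (\<kappa> \<omega>) (F \<Otimes>\<^sub>M N) (Pair \<omega>))" (is "?P = ?Q")
    and "(\<lambda>\<omega>. distr (\<kappa> \<omega>) (F \<Otimes>\<^sub>M N) (Pair \<omega>)) \<in> restr_to_subalg M F \<rightarrow>\<^sub>M prob_algebra (F \<Otimes>\<^sub>M N)"
proof -
  interpret prob_space M by fact
  from cl have sub: "subalgebra M F" and Y: "Y \<in> M \<rightarrow>\<^sub>M N" and \<kappa>: "\<kappa> \<in> F \<rightarrow>\<^sub>M prob_algebra N"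
    and eq: "\<And>A B. A \<in> sets F \<Longrightarrow> B \<in> sets N \<Longrightarrow>
        emeasure M {\<omega>\<in>A. Y \<omega> \<in> B} = (\<integral>\<^sup>+\<omega>. indicator A \<omega> * emeasure (\<kappa> \<omega>) B \<partial>M)"
    by (auto simp: cond_law_def)
  have spF: "space F = space M" using sub by (simp add: subalgebra_def)
  let ?R = "restr_to_subalg M F"
  have sR: "sets ?R = sets F" by (rule sets_restr_to_subalg[OF sub])
  have R: "?R \<in> space (prob_algebra F)"
    using prob_space_restr_to_subalg[OF sub] sR by (auto simp: space_prob_algebra prob_space_axioms)
  have \<kappa>': "(\<lambda>\<omega>. distr (\<kappa> \<omega>) (F \<Otimes>\<^sub>M N) (Pair \<omega>)) \<in> F \<rightarrow>\<^sub>M prob_algebra (F \<Otimes>\<^sub>M N)"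
    by (rule measurable_distr_prob_space2[where f = Pair, OF \<kappa>]) simp
  then show m: "(\<lambda>\<omega>. distr (\<kappa> \<omega>) (F \<Otimes>\<^sub>M N) (Pair \<omega>)) \<in> ?R \<rightarrow>\<^sub>M prob_algebra (F \<Otimes>\<^sub>M N)"
    using sR by (simp cong: measurable_cong_sets)
  have Pm: "(\<lambda>\<omega>. (\<omega>, Y \<omega>)) \<in> M \<rightarrow>\<^sub>M F \<Otimes>\<^sub>M N"
    by (intro measurable_Pair measurable_subalgebra_ident sub Y)
  let ?E = "{a \<times> b | a b. a \<in> sets F \<and> b \<in> sets N}"
  have P1: "emeasure ?P (a \<times> b) = emeasure M {\<omega>\<in>a. Y \<omega> \<in> b}" if "a \<in> sets F" "b \<in> sets N" for a b
  proof -
    have "a \<subseteq> space M" using that spF sets.sets_into_space by metis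
    then have "(\<lambda>\<omega>. (\<omega>, Y \<omega>)) -` (a \<times> b) \<inter> space M = {\<omega>\<in>a. Y \<omega> \<in> b}" by auto
    then show ?thesis using that by (subst emeasure_distr[OF Pm]) auto
  qed
  have sN: "sets (\<kappa> \<omega>) = sets N" if "\<omega> \<in> space M" for \<omega>
    using measurable_space[OF \<kappa>, of \<omega>] that spF by (auto simp: space_prob_algebra)
  have Q1: "emeasure ?Q (a \<times> b) = emeasure M {\<omega>\<in>a. Y \<omega> \<in> b}" if ab: "a \<in> sets F" "b \<in> sets N" for a b
  proof -
    have "emeasure ?Q (a \<times> b) = (\<integral>\<^sup>+\<omega>. emeasure (distr (\<kappa> \<omega>) (F \<Otimes>\<^sub>M N) (Pair \<omega>)) (a \<times> b) \<partial>?R)"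
      by (rule emeasure_bind_prob_algebra[OF R \<kappa>']) (use that in auto)
    also have "\<dots> = (\<integral>\<^sup>+\<omega>. indicator a \<omega> * emeasure (\<kappa> \<omega>) b \<partial>?R)"
    proof (rule nn_integral_cong)
      fix \<omega> assume "\<omega> \<in> space ?R"
      then have w: "\<omega> \<in> space M" by (simp add: space_restr_to_subalg)
      note s = sN[OF w]
      have sp: "space (\<kappa> \<omega>) = space N" using s by (rule sets_eq_imp_space_eq)
      have "Pair \<omega> \<in> \<kappa> \<omega> \<rightarrow>\<^sub>M F \<Otimes>\<^sub>M N"
        using w spF s by (simp cong: measurable_cong_sets)
      then have "emeasure (distr (\<kappa> \<omega>) (F \<Otimes>\<^sub>M N) (Pair \<omega>)) (a \<times> b) = emeasure (\<kappa> \<omega>) (Pair \<omega> -` (a \<times> b) \<inter> space N)"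
        using ab by (subst emeasure_distr) (auto simp: sp)
      also have "Pair \<omega> -` (a \<times> b) \<inter> space N = (if \<omega> \<in> a then b else {})"
        using sets.sets_into_space[OF ab(2)] by auto
      finally show "emeasure (distr (\<kappa> \<omega>) (F \<Otimes>\<^sub>M N) (Pair \<omega>)) (a \<times> b) = indicator a \<omega> * emeasure (\<kappa> \<omega>) b"
        by auto
    qed
    also have "\<dots> = (\<integral>\<^sup>+\<omega>. indicator a \<omega> * emeasure (\<kappa> \<omega>) b \<partial>M)"
    proof (rule nn_integral_subalgebra2[OF sub])
      have "(\<lambda>\<omega>. emeasure (\<kappa> \<omega>) b) \<in> borel_measurable F"
        by (rule measurable_compose[OF measurable_prob_algebraD[OF \<kappa>] measurable_emeasure_subprob_algebra[OF ab(2)]])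
      then show "(\<lambda>\<omega>. indicator a \<omega> * emeasure (\<kappa> \<omega>) b) \<in> borel_measurable F"
        using ab(1) by simp
    qed
    finally show ?thesis using eq[OF ab] by simp
  qed
  show "?P = ?Q"
  proof (rule measure_eqI_generator_eq[where E = ?E and \<Omega> = "space F \<times> space N" and A = "\<lambda>_. space F \<times> space N"])
    show "Int_stable ?E" by (rule Int_stable_pair_measure_generator)
    show "?E \<subseteq> Pow (space F \<times> space N)" by (rule pair_measure_closed)
    show "emeasure ?P X = emeasure ?Q X" if "X \<in> ?E" for X
      using that P1 Q1 by auto
    show "sets ?P = sigma_sets (space F \<times> space N) ?E" by (simp add: sets_pair_measure)
    have "sets ?Q = sets (F \<Otimes>\<^sub>M N)"
      using sets_bind'[OF R \<kappa>'] .
    then show "sets ?Q = sigma_sets (space F \<times> space N) ?E" by (simp add: sets_pair_measure)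
    show "emeasure ?P (space F \<times> space N) \<noteq> \<infinity>"
      by (subst P1) (auto simp: emeasure_eq_measure)
  qed (use sets.top in blast)+
qed

lemma cond_law_nn_integral:
  assumes M: "prob_space M" and cl: "cond_law M F Y N \<kappa>"
    and h: "(\<lambda>(\<omega>, y). h \<omega> y) \<in> borel_measurable (F \<Otimes>\<^sub>M N)"
  shows "(\<integral>\<^sup>+\<omega>. h \<omega> (Y \<omega>) \<partial>M) = (\<integral>\<^sup>+\<omega>. (\<integral>\<^sup>+y. h \<omega> y \<partial>\<kappa> \<omega>) \<partial>M)"
proof -
  from cl have sub: "subalgebra M F" and Y: "Y \<in> M \<rightarrow>\<^sub>M N" and \<kappa>: "\<kappa> \<in> F \<rightarrow>\<^sub>M prob_algebra N"
    by (auto simp: cond_law_def)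
  let ?R = "restr_to_subalg M F"
  let ?k = "\<lambda>\<omega>. distr (\<kappa> \<omega>) (F \<Otimes>\<^sub>M N) (Pair \<omega>)"
  have spF: "space F = space M" using sub by (simp add: subalgebra_def)
  have Pm: "(\<lambda>\<omega>. (\<omega>, Y \<omega>)) \<in> M \<rightarrow>\<^sub>M F \<Otimes>\<^sub>M N"
    by (intro measurable_Pair measurable_subalgebra_ident sub Y)
  have m: "(\<lambda>\<omega>. \<integral>\<^sup>+y. h \<omega> y \<partial>\<kappa> \<omega>) \<in> borel_measurable F"
    by (rule nn_integral_measurable_subprob_algebra2[OF h measurable_prob_algebraD[OF \<kappa>]])
  have "(\<integral>\<^sup>+\<omega>. h \<omega> (Y \<omega>) \<partial>M) = (\<integral>\<^sup>+z. (\<lambda>(\<omega>, y). h \<omega> y) z \<partial>distr M (F \<Otimes>\<^sub>M N) (\<lambda>\<omega>. (\<omega>, Y \<omega>)))"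
    by (subst nn_integral_distr) (use Pm h in simp_all)
  also have "\<dots> = (\<integral>\<^sup>+\<omega>. \<integral>\<^sup>+z. (\<lambda>(\<omega>, y). h \<omega> y) z \<partial>?k \<omega> \<partial>?R)"
    unfolding cond_law_joint(1)[OF M cl]
    by (rule nn_integral_bind[OF h measurable_prob_algebraD[OF cond_law_joint(2)[OF M cl]]])
  also have "\<dots> = (\<integral>\<^sup>+\<omega>. \<integral>\<^sup>+y. h \<omega> y \<partial>\<kappa> \<omega> \<partial>?R)"
  proof (rule nn_integral_cong)
    fix \<omega> assume "\<omega> \<in> space ?R"
    then have w: "\<omega> \<in> space F" by (simp add: space_restr_to_subalg spF)
    have "sets (\<kappa> \<omega>) = sets N" using measurable_space[OF \<kappa> w] by (auto simp: space_prob_algebra)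
    then have "Pair \<omega> \<in> \<kappa> \<omega> \<rightarrow>\<^sub>M F \<Otimes>\<^sub>M N" using w by (simp cong: measurable_cong_sets)
    then show "(\<integral>\<^sup>+z. (\<lambda>(\<omega>, y). h \<omega> y) z \<partial>?k \<omega>) = (\<integral>\<^sup>+y. h \<omega> y \<partial>\<kappa> \<omega>)"
      by (subst nn_integral_distr) (use h in simp_all)
  qed
  also have "\<dots> = (\<integral>\<^sup>+\<omega>. (\<integral>\<^sup>+y. h \<omega> y \<partial>\<kappa> \<omega>) \<partial>M)"
    by (rule nn_integral_subalgebra2[OF sub m])
  finally show "(\<integral>\<^sup>+\<omega>. h \<omega> (Y \<omega>) \<partial>M) = (\<integral>\<^sup>+\<omega>. (\<integral>\<^sup>+y. h \<omega> y \<partial>\<kappa> \<omega>) \<partial>M)" .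
qed

lemma cond_law_integral:
  fixes h :: "'w \<Rightarrow> 'b \<Rightarrow> real"
  assumes M: "prob_space M" and cl: "cond_law M F Y N \<kappa>"
    and h: "(\<lambda>(\<omega>, y). h \<omega> y) \<in> borel_measurable (F \<Otimes>\<^sub>M N)"
    and bd: "\<And>\<omega> y. \<bar>h \<omega> y\<bar> \<le> C"
  shows "(\<integral>\<omega>. h \<omega> (Y \<omega>) \<partial>M) = (\<integral>\<omega>. (\<integral>y. h \<omega> y \<partial>\<kappa> \<omega>) \<partial>M)"
proof -
  interpret prob_space M by fact
  from cl have sub: "subalgebra M F" and Y: "Y \<in> M \<rightarrow>\<^sub>M N" and \<kappa>: "\<kappa> \<in> F \<rightarrow>\<^sub>M prob_algebra N"
    by (auto simp: cond_law_def)
  let ?R = "restr_to_subalg M F"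
  let ?k = "\<lambda>\<omega>. distr (\<kappa> \<omega>) (F \<Otimes>\<^sub>M N) (Pair \<omega>)"
  have spF: "space F = space M" using sub by (simp add: subalgebra_def)
  have Pm: "(\<lambda>\<omega>. (\<omega>, Y \<omega>)) \<in> M \<rightarrow>\<^sub>M F \<Otimes>\<^sub>M N"
    by (intro measurable_Pair measurable_subalgebra_ident sub Y)
  have k: "(\<integral>z. (\<lambda>(\<omega>, y). h \<omega> y) z \<partial>?k \<omega>) = (\<integral>y. h \<omega> y \<partial>\<kappa> \<omega>)" if w: "\<omega> \<in> space F" for \<omega>
  proof -
    have "sets (\<kappa> \<omega>) = sets N" using measurable_space[OF \<kappa> w] by (auto simp: space_prob_algebra)
    then have "Pair \<omega> \<in> \<kappa> \<omega> \<rightarrow>\<^sub>M F \<Otimes>\<^sub>M N" using w by (simp cong: measurable_cong_sets)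
    then show ?thesis
      by (subst integral_distr) (use h in simp_all)
  qed
  have m: "(\<lambda>\<omega>. \<integral>y. h \<omega> y \<partial>\<kappa> \<omega>) \<in> borel_measurable F"
  proof (rule measurable_cong[THEN iffD1])
    show "(\<lambda>\<omega>. \<integral>z. (\<lambda>(\<omega>, y). h \<omega> y) z \<partial>?k \<omega>) \<in> borel_measurable F"
      by (rule measurable_compose[OF measurable_prob_algebraD[OF measurable_distr_prob_space2[where f = Pair, OF \<kappa>]]
            integral_measurable_subprob_algebra[OF h]]) simp
  qed (rule k)
  have "(\<integral>\<omega>. h \<omega> (Y \<omega>) \<partial>M) = (\<integral>z. (\<lambda>(\<omega>, y). h \<omega> y) z \<partial>distr M (F \<Otimes>\<^sub>M N) (\<lambda>\<omega>. (\<omega>, Y \<omega>)))"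
    by (subst integral_distr[OF Pm]) (use h in simp_all)
  also have "\<dots> = (\<integral>\<omega>. \<integral>z. (\<lambda>(\<omega>, y). h \<omega> y) z \<partial>?k \<omega> \<partial>?R)"
    unfolding cond_law_joint(1)[OF M cl]
  proof (rule integral_bind[OF h, of C])
    show "?k \<in> ?R \<rightarrow>\<^sub>M subprob_algebra (F \<Otimes>\<^sub>M N)"
      by (rule measurable_prob_algebraD[OF cond_law_joint(2)[OF M cl]])
    show "finite_measure ?R"
      by (rule finite_measure_restr_to_subalg[OF sub]) (rule finite_measure_axioms)
    show "AE \<omega> in ?R. emeasure (?k \<omega>) (space (?k \<omega>)) \<le> ennreal 1"
    proof (rule AE_I2)
      fix \<omega> assume "\<omega> \<in> space ?R"
      from measurable_space[OF cond_law_joint(2)[OF M cl] this] have "prob_space (?k \<omega>)"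
        by (simp add: space_prob_algebra)
      then show "emeasure (?k \<omega>) (space (?k \<omega>)) \<le> ennreal 1"
        by (simp only: prob_space.emeasure_space_1) simp
    qed
  qed (use bd not_empty in \<open>auto simp: space_restr_to_subalg\<close>)
  also have "\<dots> = (\<integral>\<omega>. \<integral>y. h \<omega> y \<partial>\<kappa> \<omega> \<partial>?R)"
    by (rule Bochner_Integration.integral_cong) (use k in \<open>auto simp: space_restr_to_subalg spF\<close>)
  also have "\<dots> = (\<integral>\<omega>. (\<integral>y. h \<omega> y \<partial>\<kappa> \<omega>) \<partial>M)"
    by (rule integral_subalgebra2[OF sub m])
  finally show "(\<integral>\<omega>. h \<omega> (Y \<omega>) \<partial>M) = (\<integral>\<omega>. (\<integral>y. h \<omega> y \<partial>\<kappa> \<omega>) \<partial>M)" .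
qed

text \<open>
  For fixed \<open>B\<close> both sides are finite measures in \<open>A\<close>, so a generating system closed under
  intersections is enough.
\<close>

lemma cond_lawI_generator:
  assumes M: "prob_space M" and sub: "subalgebra M F" and Y: "Y \<in> M \<rightarrow>\<^sub>M N" and \<kappa>: "\<kappa> \<in> F \<rightarrow>\<^sub>M prob_algebra N"
    and gen: "sets F = sigma_sets (space M) E" "Int_stable E" "E \<subseteq> Pow (space M)" "space M \<in> E"
    and eq: "\<And>A B. A \<in> E \<Longrightarrow> B \<in> sets N \<Longrightarrow>
        emeasure M {\<omega>\<in>A. Y \<omega> \<in> B} = (\<integral>\<^sup>+\<omega>. indicator A \<omega> * emeasure (\<kappa> \<omega>) B \<partial>M)"
  shows "cond_law M F Y N \<kappa>"
proof -
  interpret prob_space M by fact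
  have "emeasure M {\<omega>\<in>A. Y \<omega> \<in> B} = (\<integral>\<^sup>+\<omega>. indicator A \<omega> * emeasure (\<kappa> \<omega>) B \<partial>M)"
    if A: "A \<in> sets F" and B: "B \<in> sets N" for A B
  proof -
    have kF: "(\<lambda>\<omega>. emeasure (\<kappa> \<omega>) B) \<in> borel_measurable F"
      by (rule measurable_compose[OF measurable_prob_algebraD[OF \<kappa>] measurable_emeasure_subprob_algebra[OF B]])
    have kM: "(\<lambda>\<omega>. emeasure (\<kappa> \<omega>) B) \<in> borel_measurable M" by (rule measurable_from_subalg[OF sub kF])
    let ?b = "Y -` B \<inter> space M"
    have b[measurable]: "?b \<in> sets M" by (rule measurable_sets[OF Y B])
    define P where "P = restr_to_subalg (density M (indicator ?b)) F"
    define Q where "Q = restr_to_subalg (density M (\<lambda>\<omega>. emeasure (\<kappa> \<omega>) B)) F"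
    have subd: "subalgebra (density M f) F" for f using sub by (simp add: subalgebra_def)
    have FM: "A \<in> sets M" if "A \<in> sets F" for A using sub that by (auto simp: subalgebra_def)
    have P: "emeasure P A = emeasure M {\<omega>\<in>A. Y \<omega> \<in> B}" if A: "A \<in> sets F" for A
    proof -
      have "emeasure P A = (\<integral>\<^sup>+\<omega>. indicator ?b \<omega> * indicator A \<omega> \<partial>M)"
        unfolding P_def emeasure_restr_to_subalg[OF subd A] using FM[OF A] by (simp add: emeasure_density)
      also have "\<dots> = (\<integral>\<^sup>+\<omega>. indicator (A \<inter> ?b) \<omega> \<partial>M)"
        by (rule nn_integral_cong) (auto simp: indicator_def)
      also have "\<dots> = emeasure M (A \<inter> ?b)" using FM[OF A] by simp
      also have "A \<inter> ?b = {\<omega>\<in>A. Y \<omega> \<in> B}" using sets.sets_into_space[OF FM[OF A]] by auto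
      finally show ?thesis .
    qed
    have Q: "emeasure Q A = (\<integral>\<^sup>+\<omega>. indicator A \<omega> * emeasure (\<kappa> \<omega>) B \<partial>M)" if A: "A \<in> sets F" for A
      unfolding Q_def emeasure_restr_to_subalg[OF subd A]
      using FM[OF A] kM by (simp add: emeasure_density mult.commute)
    have "P = Q"
    proof (rule measure_eqI_generator_eq[OF gen(2,3), where A = "\<lambda>_. space M"])
      show "emeasure P X = emeasure Q X" if "X \<in> E" for X
        using eq[OF that B] P[of X] Q[of X] that gen(1) by auto
      show "sets P = sigma_sets (space M) E" "sets Q = sigma_sets (space M) E"
        unfolding P_def Q_def sets_restr_to_subalg[OF subd] by (fact gen(1))+
      show "emeasure P (space M) \<noteq> \<infinity>"
        using P[of "space M"] gen(1,4) by (auto simp: emeasure_eq_measure)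
    qed (use gen(4) in auto)
    then show ?thesis using P[OF A] Q[OF A] by simp
  qed
  then show ?thesis using sub Y \<kappa> by (simp add: cond_law_def)
qed

text \<open>
  The integral of \<open>\<kappa> \<omega> {y. \<not> P y}\<close> is the probability that \<open>Y\<close> violates \<open>P\<close>, which is zero.
\<close>

lemma (in prob_space) cond_law_AE_transfer:
  assumes cl: "cond_law M F Y borel \<kappa>" and P: "{y. P y} \<in> sets borel" and Y: "AE \<omega> in M. P (Y \<omega>)"
  shows "AE \<omega> in M. AE y in \<kappa> \<omega>. P y"
proof -
  have sub: "subalgebra M F" and Ym: "Y \<in> borel_measurable M" and \<kappa>: "\<kappa> \<in> F \<rightarrow>\<^sub>M prob_algebra borel"
    and eq: "\<And>A B. A \<in> sets F \<Longrightarrow> B \<in> sets borel \<Longrightarrow>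
        emeasure M {\<omega>\<in>A. Y \<omega> \<in> B} = (\<integral>\<^sup>+\<omega>. indicator A \<omega> * emeasure (\<kappa> \<omega>) B \<partial>M)"
    using cl by (auto simp: cond_law_def)
  have P': "{y. \<not> P y} \<in> sets borel" using borel_comp[OF P] by (simp add: Collect_neg_eq)
  have top: "space M \<in> sets F" using sets.top[of F] sub unfolding subalgebra_def by metis
  have km: "(\<lambda>\<omega>. emeasure (\<kappa> \<omega>) {y. \<not> P y}) \<in> borel_measurable M"
    by (rule measurable_compose[OF measurable_from_subalg[OF sub measurable_prob_algebraD[OF \<kappa>]] measurable_emeasure_subprob_algebra[OF P']])
  have "(\<integral>\<^sup>+\<omega>. emeasure (\<kappa> \<omega>) {y. \<not> P y} \<partial>M) = (\<integral>\<^sup>+\<omega>. indicator (space M) \<omega> * emeasure (\<kappa> \<omega>) {y. \<not> P y} \<partial>M)"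
    by (rule nn_integral_cong) simp
  also have "\<dots> = emeasure M {\<omega>\<in>space M. Y \<omega> \<in> {y. \<not> P y}}"
    by (rule eq[OF top P', symmetric])
  also have "\<dots> = 0"
    using Y by (intro emeasure_eq_0_AE) auto
  finally have "AE \<omega> in M. emeasure (\<kappa> \<omega>) {y. \<not> P y} = 0"
    by (subst (asm) nn_integral_0_iff_AE[OF km])
  then show ?thesis
    using AE_space
  proof eventually_elim
    case (elim \<omega>)
    have "\<kappa> \<omega> \<in> space (prob_algebra borel)" by (rule measurable_space[OF \<kappa>]) (use elim sub in \<open>simp add: subalgebra_def\<close>)
    then have "sets (\<kappa> \<omega>) = sets borel" by (simp add: space_prob_algebra)
    then have "{y. \<not> P y} \<in> null_sets (\<kappa> \<omega>)" using elim P' by (simp add: null_sets_def)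
    from AE_not_in[OF this] show ?case by simp
  qed
qed

text \<open>
  Since \<open>\<kappa>\<close> is \<open>F\<close>-measurable, the \<open>\<sigma>\<close>-algebra generated by \<open>\<kappa>\<close> is contained in \<open>F\<close>, and \<open>\<kappa>\<close> itself
  is measurable with respect to it: conditioning on \<open>\<kappa>\<close> alone gives the same answer as
  conditioning on \<open>F\<close>.
\<close>

lemma (in prob_space) cond_law_real_cond_exp:
  assumes cl: "cond_law M F Y borel \<kappa>" and B: "B \<in> sets borel"
  shows "AE \<omega> in M. real_cond_exp M (vimage_algebra (space M) \<kappa> (prob_algebra borel)) (\<lambda>\<omega>. indicator B (Y \<omega>)) \<omega> = measure (\<kappa> \<omega>) B"
proof -
  let ?S = "vimage_algebra (space M) \<kappa> (prob_algebra borel)"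
  have sub: "subalgebra M F" and Ym: "Y \<in> borel_measurable M" and \<kappa>: "\<kappa> \<in> F \<rightarrow>\<^sub>M prob_algebra borel"
    using cl by (auto simp: cond_law_def)
  have fs: "\<kappa> \<in> space M \<rightarrow> space (prob_algebra borel)"
    using measurable_space[OF \<kappa>] sub by (auto simp: subalgebra_def)
  have SF: "sets ?S \<subseteq> sets F"
    unfolding sets_vimage_algebra2[OF fs] using measurable_sets[OF \<kappa>] sub by (auto simp: subalgebra_def)
  then have subS: "subalgebra M ?S" using sub by (auto simp: subalgebra_def)
  interpret S: sigma_finite_subalgebra M ?S
    by (rule finite_measure_subalgebra_is_sigma_finite, unfold_locales) (rule subS)
  have \<kappa>S: "(\<lambda>\<omega>. measure (\<kappa> \<omega>) B) \<in> borel_measurable ?S"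
    by (rule measurable_compose[OF measurable_vimage_algebra1[OF fs] measurable_measure_prob_algebra[OF B]])
  have \<kappa>M: "(\<lambda>\<omega>. measure (\<kappa> \<omega>) B) \<in> borel_measurable M" by (rule measurable_from_subalg[OF subS \<kappa>S])
  have prob: "prob_space (\<kappa> \<omega>)" if "\<omega> \<in> space M" for \<omega> using fs that by (auto simp: space_prob_algebra)
  have i1: "integrable M (\<lambda>\<omega>. indicator B (Y \<omega>) :: real)"
    by (rule integrable_const_bound[where B = 1]) (use Ym B in \<open>auto simp: indicator_def\<close>)
  have i2: "integrable M (\<lambda>\<omega>. measure (\<kappa> \<omega>) B)"
    by (rule integrable_const_bound[where B = 1]) (use \<kappa>M prob in \<open>auto simp: prob_space.prob_le_1 intro!: AE_I2\<close>)
  show ?thesis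
  proof (rule S.real_cond_exp_charact[OF _ i1 i2 \<kappa>S])
    fix A assume "A \<in> sets ?S"
    then have A: "A \<in> sets F" using SF by auto
    have h: "(\<lambda>(\<omega>, y). indicator A \<omega> * indicator B y :: real) \<in> borel_measurable (F \<Otimes>\<^sub>M borel)" using A B by measurable
    have "(\<integral>\<omega>\<in>A. indicator B (Y \<omega>) \<partial>M) = (\<integral>\<omega>. indicator A \<omega> * indicator B (Y \<omega>) \<partial>M :: real)"
      by (simp add: set_lebesgue_integral_def)
    also have "\<dots> = (\<integral>\<omega>. \<integral>y. indicator A \<omega> * indicator B y \<partial>\<kappa> \<omega> \<partial>M)"
      by (rule cond_law_integral[OF prob_space_axioms cl h, of 1]) (auto simp: indicator_def)
    also have "\<dots> = (\<integral>\<omega>\<in>A. measure (\<kappa> \<omega>) B \<partial>M)"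
      unfolding set_lebesgue_integral_def
    proof (rule Bochner_Integration.integral_cong[OF refl])
      fix \<omega> assume w: "\<omega> \<in> space M"
      then have s: "sets (\<kappa> \<omega>) = sets borel" using fs by (auto simp: space_prob_algebra)
      have "(\<integral>y. indicator B y \<partial>\<kappa> \<omega>) = measure (\<kappa> \<omega>) B"
        using sets_eq_imp_space_eq[OF s] by simp
      then show "(\<integral>y. indicator A \<omega> * indicator B y \<partial>\<kappa> \<omega>) = indicator A \<omega> *\<^sub>R measure (\<kappa> \<omega>) B" by simp
    qed
    finally show "(\<integral>\<omega>\<in>A. indicator B (Y \<omega>) \<partial>M) = (\<integral>\<omega>\<in>A. measure (\<kappa> \<omega>) B \<partial>M)" .
  qed
qed

text \<open>
  After adding the constant \<open>C\<close>, both functions are densities of finite measures on \<open>F\<close>.  The measures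
  agree on the generator, hence on \<open>F\<close>, and densities are unique almost everywhere.
\<close>

lemma (in prob_space) AE_eq_if_integrals_agree_on_generator:
  fixes f h :: "'a \<Rightarrow> real"
  assumes sub: "subalgebra M F"
    and gen: "sets F = sigma_sets (space M) E" "Int_stable E" "E \<subseteq> Pow (space M)" "space M \<in> E"
    and f: "f \<in> borel_measurable F" "\<And>\<omega>. \<bar>f \<omega>\<bar> \<le> C" and h: "h \<in> borel_measurable F" "\<And>\<omega>. \<bar>h \<omega>\<bar> \<le> C"
    and eq: "\<And>A. A \<in> E \<Longrightarrow> (\<integral>\<omega>. indicator A \<omega> * f \<omega> \<partial>M) = (\<integral>\<omega>. indicator A \<omega> * h \<omega> \<partial>M)"
  shows "AE \<omega> in M. f \<omega> = h \<omega>"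
proof -
  let ?R = "restr_to_subalg M F"
  have sR: "sets ?R = sets F" by (rule sets_restr_to_subalg[OF sub])
  have spR: "space ?R = space M" by (rule space_restr_to_subalg)
  interpret R: prob_space ?R by (rule prob_space_restr_to_subalg[OF sub prob_space_axioms])
  have em: "emeasure (density ?R (\<lambda>\<omega>. ennreal (k \<omega> + C))) A = ennreal ((\<integral>\<omega>. indicator A \<omega> * k \<omega> \<partial>M) + C * measure M A)"
    if k: "k \<in> borel_measurable F" "\<And>\<omega>. \<bar>k \<omega>\<bar> \<le> C" and A: "A \<in> sets F" for k A
  proof -
    have AM: "A \<in> sets M" using A sub by (auto simp: subalgebra_def)
    have kM[measurable]: "k \<in> borel_measurable M" by (rule measurable_from_subalg[OF sub k(1)])
    have kR: "(\<lambda>\<omega>. ennreal (k \<omega> + C)) \<in> borel_measurable ?R" using k(1) by (simp cong: measurable_cong_sets[OF sR refl])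
    have C: "0 \<le> k \<omega> + C" for \<omega> using k(2)[of \<omega>] by linarith
    have i1: "integrable M (\<lambda>\<omega>. indicator A \<omega> * k \<omega>)"
      by (rule integrable_const_bound[where B = C]) (use AM k(2) abs_ge_zero[THEN order_trans, OF k(2)] in \<open>auto simp: indicator_def\<close>)
    have i2: "integrable M (\<lambda>\<omega>. C * indicator A \<omega>)"
      using AM by (intro integrable_mult_right integrable_real_indicator) (auto simp: emeasure_eq_measure)
    have "emeasure (density ?R (\<lambda>\<omega>. ennreal (k \<omega> + C))) A = (\<integral>\<^sup>+\<omega>. ennreal (k \<omega> + C) * indicator A \<omega> \<partial>?R)"
      by (rule emeasure_density[OF kR]) (use A sR in simp)
    also have "\<dots> = (\<integral>\<^sup>+\<omega>. ennreal (k \<omega> + C) * indicator A \<omega> \<partial>M)"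
      by (rule nn_integral_subalgebra2[OF sub]) (use k(1) A in measurable)
    also have "\<dots> = (\<integral>\<^sup>+\<omega>. ennreal (indicator A \<omega> * k \<omega> + C * indicator A \<omega>) \<partial>M)"
      by (rule nn_integral_cong) (auto simp: indicator_def)
    also have "\<dots> = ennreal (\<integral>\<omega>. indicator A \<omega> * k \<omega> + C * indicator A \<omega> \<partial>M)"
    proof (rule nn_integral_eq_integral)
      show "integrable M (\<lambda>\<omega>. indicator A \<omega> * k \<omega> + C * indicator A \<omega>)"
        by (rule Bochner_Integration.integrable_add[OF i1 i2])
    qed (use C in \<open>auto simp: indicator_def\<close>)
    also have "(\<integral>\<omega>. indicator A \<omega> * k \<omega> + C * indicator A \<omega> \<partial>M) = (\<integral>\<omega>. indicator A \<omega> * k \<omega> \<partial>M) + C * measure M A"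
      using Bochner_Integration.integral_add[OF i1 i2] sets.sets_into_space[OF AM] by (simp add: Int_absorb2)
    finally show ?thesis .
  qed
  have EF: "A \<in> sets F" if "A \<in> E" for A using that gen(1) by auto
  have "density ?R (\<lambda>\<omega>. ennreal (f \<omega> + C)) = density ?R (\<lambda>\<omega>. ennreal (h \<omega> + C))"
  proof (rule measure_eqI_generator_eq[OF gen(2,3), where A = "\<lambda>_. space M"])
    show "emeasure (density ?R (\<lambda>\<omega>. ennreal (f \<omega> + C))) X = emeasure (density ?R (\<lambda>\<omega>. ennreal (h \<omega> + C))) X"
      if "X \<in> E" for X
      by (simp only: em[OF f EF[OF that]] em[OF h EF[OF that]] eq[OF that])
    show "emeasure (density ?R (\<lambda>\<omega>. ennreal (f \<omega> + C))) (space M) \<noteq> \<infinity>"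
      by (simp only: em[OF f EF[OF gen(4)]]) simp
  qed (use sR gen in auto)
  then have "AE \<omega> in ?R. ennreal (f \<omega> + C) = ennreal (h \<omega> + C)"
    using f(1) h(1) by (subst R.density_unique_iff[symmetric]) (simp_all cong: measurable_cong_sets[OF sR refl])
  then have "AE \<omega> in M. ennreal (f \<omega> + C) = ennreal (h \<omega> + C)"
    by (rule AE_restr_to_subalg[OF sub])
  then show ?thesis
  proof eventually_elim
    case (elim \<omega>)
    have "0 \<le> f \<omega> + C" "0 \<le> h \<omega> + C" using f(2)[of \<omega>] h(2)[of \<omega>] by linarith+
    with elim show ?case by simp
  qed
qed

text \<open>
  Independence of \<open>C\<close> from \<open>F\<close> means that the conditional expectation of its indicator given \<open>F\<close> is
  constant.
\<close>

lemma (in prob_space) indep_set_nn_integral: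
  assumes sub: "subalgebra M F" and ind: "indep_set (sets F) S" and f: "f \<in> borel_measurable F" and C: "C \<in> S"
  shows "(\<integral>\<^sup>+\<omega>. f \<omega> * indicator C \<omega> \<partial>M) = (\<integral>\<^sup>+\<omega>. f \<omega> \<partial>M) * emeasure M C"
proof -
  interpret sigma_finite_subalgebra M F
    by (rule finite_measure_subalgebra_is_sigma_finite, unfold_locales) (fact sub)
  have CM: "C \<in> sets M" and mult: "\<And>A. A \<in> sets F \<Longrightarrow> prob (A \<inter> C) = prob A * prob C"
    using ind C unfolding indep_sets2_eq by auto
  have FM: "A \<in> sets M" if "A \<in> sets F" for A using sub that by (auto simp: subalgebra_def)
  have ce: "AE \<omega> in M. emeasure M C = nn_cond_exp M F (indicator C) \<omega>"
  proof (rule nn_cond_exp_charact)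
    fix A assume A: "A \<in> sets F"
    have "(\<integral>\<^sup>+\<omega>\<in>A. indicator C \<omega> \<partial>M) = (\<integral>\<^sup>+\<omega>. indicator (A \<inter> C) \<omega> \<partial>M)"
      by (rule nn_integral_cong) (auto simp: indicator_def)
    also have "\<dots> = emeasure M (A \<inter> C)" using FM[OF A] CM by simp
    also have "\<dots> = emeasure M C * emeasure M A"
      using mult[OF A] by (simp add: emeasure_eq_measure ennreal_mult mult.commute)
    also have "\<dots> = (\<integral>\<^sup>+\<omega>\<in>A. emeasure M C \<partial>M)" using FM[OF A] by (simp add: nn_integral_cmult_indicator)
    finally show "(\<integral>\<^sup>+\<omega>\<in>A. indicator C \<omega> \<partial>M) = (\<integral>\<^sup>+\<omega>\<in>A. emeasure M C \<partial>M)" .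
  qed (use CM in auto)
  have "(\<integral>\<^sup>+\<omega>. f \<omega> * indicator C \<omega> \<partial>M) = (\<integral>\<^sup>+\<omega>. f \<omega> * nn_cond_exp M F (indicator C) \<omega> \<partial>M)"
    by (rule nn_cond_exp_intg[symmetric]) (use f CM in auto)
  also have "\<dots> = (\<integral>\<^sup>+\<omega>. f \<omega> * emeasure M C \<partial>M)"
    by (rule nn_integral_cong_AE) (use ce in eventually_elim, simp)
  also have "\<dots> = (\<integral>\<^sup>+\<omega>. f \<omega> \<partial>M) * emeasure M C"
    by (rule nn_integral_multc) (rule measurable_from_subalg[OF sub f])
  finally show ?thesis .
qed

section \<open>Existence of regular conditional laws\<close>

text \<open>
  Rational endpoints suffice to generate the Borel sets; so a random distribution function needs to
  be controlled at countably many points only.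
\<close>

lemma borel_eq_atMost_rat: "borel = sigma UNIV (range (\<lambda>q. {..real_of_rat q}))"
proof (rule borel_eq_sigmaI1[where X = "range (\<lambda>a::real. {..a})"])
  show "borel = sigma UNIV (range (\<lambda>a::real. {..a}))" by (rule borel_eq_atMost)
  fix x :: "real set" assume "x \<in> range (\<lambda>a. {..a})"
  then obtain a where x: "x = {..a}" by auto
  have "x = (\<Inter>q\<in>{q. a < real_of_rat q}. {..real_of_rat q})"
  proof (rule set_eqI)
    fix y
    show "y \<in> x \<longleftrightarrow> y \<in> (\<Inter>q\<in>{q. a < real_of_rat q}. {..real_of_rat q})"
    proof (cases "y \<le> a")
      case False
      then obtain q where "a < real_of_rat q" "real_of_rat q < y" using of_rat_dense[of a y] by auto
      then show ?thesis using x by (auto simp: not_le intro!: exI[of _ q])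
    qed (auto simp: x)
  qed
  moreover have "{q. a < real_of_rat q} \<noteq> {}"
    using of_rat_dense[of a "a + 1"] by auto
  ultimately show "x \<in> sets (sigma UNIV (range (\<lambda>q. {..real_of_rat q})))"
    by (simp only:) (rule sets.countable_INT', auto)
qed auto

text \<open>
  The infimum of \<open>c\<close> over the rationals to the right of \<open>x\<close> is always monotone and right continuous
  in \<open>x\<close>.  Right continuity of \<open>c\<close> along the rationals makes it an extension of \<open>c\<close>, and the two
  limits make it a distribution function.
\<close>

lemma exists_measure_of_rational_cdf:
  fixes c :: "rat \<Rightarrow> real"
  assumes mono: "\<And>q r. q \<le> r \<Longrightarrow> c q \<le> c r"
    and nonneg: "\<And>q. 0 \<le> c q" and le1: "\<And>q. c q \<le> 1"
    and right: "\<And>q e. e > 0 \<Longrightarrow> \<exists>r>q. c r < c q + e"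
    and top: "\<And>e. e > 0 \<Longrightarrow> \<exists>q. c q > 1 - e"
    and bot: "\<And>e. e > 0 \<Longrightarrow> \<exists>q. c q < e"
  shows "\<exists>N. prob_space N \<and> sets N = sets borel \<and> (\<forall>q. emeasure N {..real_of_rat q} = ennreal (c q))"
proof -
  define F where "F x = Inf (c ` {q. x < real_of_rat q})" for x
  have ne: "{q. x < real_of_rat q} \<noteq> {}" for x
    using of_rat_dense[of x "x + 1"] by auto
  have bdd: "bdd_below (c ` S)" for S
    using nonneg by (auto intro!: bdd_belowI[where m = 0])
  have F_le: "F x \<le> c q" if "x < real_of_rat q" for x q
    unfolding F_def by (rule cINF_lower[OF bdd]) (use that in auto)
  have F_ge: "F x \<ge> C" if "\<And>q. x < real_of_rat q \<Longrightarrow> C \<le> c q" for x C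
    unfolding F_def by (rule cINF_greatest[OF ne]) (use that in auto)
  have F_lt: "\<exists>q. x < real_of_rat q \<and> c q < F x + e" if "e > 0" for x e
  proof (rule ccontr)
    assume "\<not> ?thesis"
    then have "F x + e \<le> F x" by (intro F_ge) force
    with that show False by simp
  qed
  have Fc: "F (real_of_rat q) = c q" for q
  proof (rule antisym)
    show "F (real_of_rat q) \<le> c q"
    proof (rule field_le_epsilon)
      fix e :: real assume "e > 0"
      from right[OF this, of q] obtain r where "r > q" "c r < c q + e" by auto
      then show "F (real_of_rat q) \<le> c q + e" using F_le[of "real_of_rat q" r] by (simp add: of_rat_less)
    qed
    show "c q \<le> F (real_of_rat q)" by (rule F_ge) (auto simp: of_rat_less intro: mono)
  qed
  have Fmono: "F x \<le> F y" if "x \<le> y" for x y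
    by (rule F_ge) (use that F_le in force)
  have F0: "0 \<le> F x" and F1: "F x \<le> 1" for x
    using F_ge[of x 0] nonneg ne[of x] F_le[of x] le1 by (auto intro: order_trans)
  have Fright: "continuous (at_right a) F" for a
    unfolding continuous_within
  proof (rule order_tendstoI)
    fix l assume "l < F a"
    then show "\<forall>\<^sub>F x in at_right a. l < F x"
      using Fmono by (intro eventually_at_rightI[of a "a + 1"]) (auto intro: less_le_trans)
  next
    fix u assume "F a < u"
    then obtain q where q: "a < real_of_rat q" "c q < u" using F_lt[of "u - F a" a] by auto
    show "\<forall>\<^sub>F x in at_right a. F x < u"
      using q F_le by (intro eventually_at_rightI[of a "real_of_rat q"]) (auto intro: le_less_trans)
  qed
  have Fbot: "(F \<longlongrightarrow> 0) at_bot"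
  proof (rule order_tendstoI)
    fix u :: real assume "0 < u"
    then obtain q where q: "c q < u" using bot by blast
    have "F x < u" if "x \<le> real_of_rat q - 1" for x using F_le[of x q] q that by simp
    then have "\<forall>x\<le>real_of_rat q - 1. F x < u" by blast
    then show "\<forall>\<^sub>F x in at_bot. F x < u" by (auto simp: eventually_at_bot_linorder)
  qed (auto intro!: always_eventually less_le_trans[OF _ F0])
  have Ftop: "(F \<longlongrightarrow> 1) at_top"
  proof (rule order_tendstoI)
    fix l :: real assume "l < 1"
    then obtain q where q: "l < c q" using top[of "1 - l"] by auto
    then have "\<forall>x\<ge>real_of_rat q. l < F x"
      using Fmono Fc by (metis less_le_trans)
    then show "\<forall>\<^sub>F x in at_top. l < F x" by (auto simp: eventually_at_top_linorder)
  qed (auto intro!: always_eventually le_less_trans[OF F1])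
  interpret real_distribution "interval_measure F"
    by (rule real_distribution_interval_measure[OF Fmono Fright Fbot Ftop])
  show ?thesis
  proof (intro exI conjI allI)
    show "prob_space (interval_measure F)" by unfold_locales
    show "emeasure (interval_measure F) {..real_of_rat q} = ennreal (c q)" for q
      using emeasure_interval_measure_Iic[OF Fmono Fright Fbot, of "real_of_rat q"] Fc by simp
  qed simp
qed

text \<open>
  If all terms are at least \<open>1 / (k + 1)\<close> on some event, Markov's inequality bounds the probability
  of this event by \<open>k + 1\<close> times each of the integrals.  The lemma turns the limits of the
  distribution function of a random variable into almost sure limits of its conditional version.
\<close>

lemma AE_small_term_if_integral_tendsto_0:
  fixes Y :: "nat \<Rightarrow> 'w \<Rightarrow> real"
  assumes int: "\<And>n. integrable M (Y n)" and nn: "\<And>n. AE \<omega> in M. 0 \<le> Y n \<omega>"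
    and lim: "(\<lambda>n. \<integral>\<omega>. Y n \<omega> \<partial>M) \<longlonglongrightarrow> 0" and fin: "finite_measure M"
  shows "AE \<omega> in M. \<forall>k. \<exists>n. Y n \<omega> < 1 / real (Suc k)"
proof (subst AE_all_countable, rule allI)
  interpret finite_measure M by fact
  fix k
  have [measurable]: "Y n \<in> borel_measurable M" for n using int by auto
  let ?B = "{\<omega>\<in>space M. \<forall>n. 1 / real (Suc k) \<le> Y n \<omega>}"
  have le: "measure M ?B \<le> (\<integral>\<omega>. Y n \<omega> \<partial>M) * real (Suc k)" for n
  proof -
    have "measure M ?B \<le> measure M {\<omega>\<in>space M. 1 / real (Suc k) \<le> Y n \<omega>}"
      by (rule finite_measure_mono) auto
    also have "\<dots> \<le> (\<integral>\<omega>. Y n \<omega> \<partial>M) / (1 / real (Suc k))"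
      by (rule integral_Markov_inequality_measure[OF int _ nn]) auto
    finally show ?thesis by simp
  qed
  have "(\<lambda>n. (\<integral>\<omega>. Y n \<omega> \<partial>M) * real (Suc k)) \<longlonglongrightarrow> 0"
    using tendsto_mult_right[OF lim, of "real (Suc k)"] by simp
  then have "measure M ?B \<le> 0" by (rule LIMSEQ_le_const) (use le in blast)
  then have "emeasure M ?B = 0" by (simp add: emeasure_eq_measure measure_le_0_iff)
  then have "AE \<omega> in M. \<omega> \<notin> ?B" by (intro AE_not_in) (auto simp: null_sets_def)
  then show "AE \<omega> in M. \<exists>n. Y n \<omega> < 1 / real (Suc k)"
    using AE_space by eventually_elim (auto simp: not_le)
qed

text \<open>
  The conditional probabilities of the events \<open>R \<le> q\<close>, for rational \<open>q\<close>, almost surely have the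
  countably many properties that make them the values of a distribution function.  Where they do,
  the measure with this distribution function is taken; on the exceptional set any fixed
  probability measure will do.
\<close>

lemma real_cond_law_exists:
  fixes R :: "'w \<Rightarrow> real"
  assumes M: "prob_space M" and sub: "subalgebra M F" and R: "R \<in> borel_measurable M"
  shows "\<exists>\<kappa>. cond_law M F R borel \<kappa>"
proof -
  interpret prob_space M by fact
  interpret sigma_finite_subalgebra M F
    by (rule finite_measure_subalgebra_is_sigma_finite, unfold_locales) (fact sub)
  note R[measurable]
  define I where "I q \<omega> = (indicator {..real_of_rat q} (R \<omega>) :: real)" for q \<omega>
  define c where "c q = real_cond_exp M F (I q)" for q
  have [measurable]: "I q \<in> borel_measurable M" for q unfolding I_def by measurable
  have cF[measurable]: "c q \<in> borel_measurable F" for q unfolding c_def by simp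
  have cM[measurable]: "c q \<in> borel_measurable M" for q by (rule measurable_from_subalg[OF sub cF])
  have intI: "integrable M (I q)" for q
    by (rule integrable_const_bound[where B = 1]) (auto simp: I_def indicator_def)
  have intc: "integrable M (c q)" and eqc: "(\<integral>\<omega>. c q \<omega> \<partial>M) = (\<integral>\<omega>. I q \<omega> \<partial>M)" for q
    using real_cond_exp_int[OF intI] unfolding c_def by auto
  have I_prob: "(\<integral>\<omega>. I q \<omega> \<partial>M) = cdf (distr M borel R) (real_of_rat q)" for q
  proof -
    have "(\<integral>\<omega>. I q \<omega> \<partial>M) = (\<integral>\<omega>. indicator (R -` {..real_of_rat q} \<inter> space M) \<omega> \<partial>M)"
      by (rule Bochner_Integration.integral_cong) (auto simp: I_def indicator_def)
    then show ?thesis by (simp add: cdf_def measure_distr)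
  qed
  interpret D: real_distribution "distr M borel R" by (rule real_distribution_distr[OF R])
  have mono: "AE \<omega> in M. \<forall>q r. q \<le> r \<longrightarrow> c q \<omega> \<le> c r \<omega>"
  proof (simp add: AE_all_countable, intro allI impI)
    fix q r :: rat assume "q \<le> r"
    then have "AE \<omega> in M. I q \<omega> \<le> I r \<omega>"
      by (auto simp: I_def indicator_def intro!: AE_I2 intro: order_trans[OF _ of_rat_less_eq[THEN iffD2]])
    then show "AE \<omega> in M. c q \<omega> \<le> c r \<omega>"
      unfolding c_def by (rule real_cond_exp_mono) (auto intro: intI)
  qed
  have nn: "AE \<omega> in M. \<forall>q. 0 \<le> c q \<omega>"
  proof (subst AE_all_countable, rule allI)
    fix q show "AE \<omega> in M. 0 \<le> c q \<omega>"
      unfolding c_def by (rule real_cond_exp_ge_c[OF intI]) (auto simp: I_def)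
  qed
  have le1: "AE \<omega> in M. \<forall>q. c q \<omega> \<le> 1"
  proof (subst AE_all_countable, rule allI)
    fix q show "AE \<omega> in M. c q \<omega> \<le> 1"
      unfolding c_def by (rule real_cond_exp_le_c[OF intI]) (auto simp: I_def indicator_def)
  qed
  have small: "AE \<omega> in M. \<forall>k. \<exists>n. c (s n) \<omega> - c (t n) \<omega> < 1 / real (Suc k)"
    if le: "\<And>n. t n \<le> s n"
      and lim: "(\<lambda>n. cdf (distr M borel R) (real_of_rat (s n)) - cdf (distr M borel R) (real_of_rat (t n))) \<longlonglongrightarrow> 0"
    for s t :: "nat \<Rightarrow> rat"
  proof (rule AE_small_term_if_integral_tendsto_0)
    show "AE \<omega> in M. 0 \<le> c (s n) \<omega> - c (t n) \<omega>" for n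
      using mono by eventually_elim (use le in auto)
    show "(\<lambda>n. \<integral>\<omega>. c (s n) \<omega> - c (t n) \<omega> \<partial>M) \<longlonglongrightarrow> 0"
      using lim by (simp add: intc eqc I_prob)
  qed (auto intro: intc finite_measure_axioms)
  have right: "AE \<omega> in M. \<forall>q. \<forall>k. \<exists>n::nat. c (q + 1 / of_nat (Suc n)) \<omega> < c q \<omega> + 1 / real (Suc k)"
  proof (subst AE_all_countable, rule allI)
    fix q :: rat
    have "filterlim (\<lambda>n. real_of_rat (q + 1 / of_nat (Suc n))) (at_right (real_of_rat q)) sequentially"
      unfolding filterlim_at
    proof
      have "(\<lambda>n. real_of_rat q + 1 / real (Suc n)) \<longlonglongrightarrow> real_of_rat q + 0"
        by (intro tendsto_intros LIMSEQ_Suc[OF lim_1_over_n])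
      then show "(\<lambda>n. real_of_rat (q + 1 / of_nat (Suc n))) \<longlonglongrightarrow> real_of_rat q"
        by (simp add: of_rat_add of_rat_divide)
    qed (auto simp: of_rat_add of_rat_divide)
    from filterlim_compose[OF D.cdf_is_right_cont[unfolded continuous_within] this]
    have "(\<lambda>n. cdf (distr M borel R) (real_of_rat (q + 1 / of_nat (Suc n))) - cdf (distr M borel R) (real_of_rat q)) \<longlonglongrightarrow> 0"
      by (rule LIM_zero)
    from small[OF _ this] show "AE \<omega> in M. \<forall>k. \<exists>n::nat. c (q + 1 / of_nat (Suc n)) \<omega> < c q \<omega> + 1 / real (Suc k)"
      by (simp add: algebra_simps)
  qed
  have top: "AE \<omega> in M. \<forall>k. \<exists>n::nat. 1 - 1 / real (Suc k) < c (of_nat n) \<omega>"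
  proof -
    have "AE \<omega> in M. \<forall>k. \<exists>n. 1 - c (of_nat n) \<omega> < 1 / real (Suc k)"
    proof (rule AE_small_term_if_integral_tendsto_0)
      show "AE \<omega> in M. 0 \<le> 1 - c (of_nat n) \<omega>" for n using le1 by eventually_elim simp
      have "(\<lambda>n. 1 - cdf (distr M borel R) (real n)) \<longlonglongrightarrow> 1 - 1"
        by (intro tendsto_intros filterlim_compose[OF D.cdf_lim_at_top_prob] filterlim_real_sequentially)
      then show "(\<lambda>n. \<integral>\<omega>. 1 - c (of_nat n) \<omega> \<partial>M) \<longlonglongrightarrow> 0"
        by (simp add: intc eqc I_prob prob_space)
    qed (auto intro: intc finite_measure_axioms)
    then show ?thesis by (simp add: algebra_simps)
  qed
  have bot: "AE \<omega> in M. \<forall>k. \<exists>n::nat. c (- of_nat n) \<omega> < 1 / real (Suc k)"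
  proof (rule AE_small_term_if_integral_tendsto_0)
    show "AE \<omega> in M. 0 \<le> c (- of_nat n) \<omega>" for n using nn by eventually_elim simp
    have "(\<lambda>n. cdf (distr M borel R) (- real n)) \<longlonglongrightarrow> 0"
      by (intro filterlim_compose[OF D.cdf_lim_at_bot] filterlim_compose[OF filterlim_uminus_at_bot_at_top] filterlim_real_sequentially)
    then show "(\<lambda>n. \<integral>\<omega>. c (- of_nat n) \<omega> \<partial>M) \<longlonglongrightarrow> 0"
      by (simp add: intc eqc I_prob of_rat_minus)
  qed (auto intro: intc finite_measure_axioms)
  define good where "good \<omega> \<longleftrightarrow> (\<forall>q r. q \<le> r \<longrightarrow> c q \<omega> \<le> c r \<omega>) \<and> (\<forall>q. 0 \<le> c q \<omega>) \<and> (\<forall>q. c q \<omega> \<le> 1) \<and>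
     (\<forall>q. \<forall>k. \<exists>n::nat. c (q + 1 / of_nat (Suc n)) \<omega> < c q \<omega> + 1 / real (Suc k)) \<and>
     (\<forall>k. \<exists>n::nat. 1 - 1 / real (Suc k) < c (of_nat n) \<omega>) \<and>
     (\<forall>k. \<exists>n::nat. c (- of_nat n) \<omega> < 1 / real (Suc k))" for \<omega>
  have good_meas[measurable]: "Measurable.pred F good"
    unfolding good_def by measurable
  have AE_good: "AE \<omega> in M. good \<omega>"
    using mono nn le1 right top bot by eventually_elim (auto simp: good_def)
  have "\<exists>N. prob_space N \<and> sets N = sets borel \<and> (\<forall>q. emeasure N {..real_of_rat q} = ennreal (c q \<omega>))"
    if "good \<omega>" for \<omega>
  proof (rule exists_measure_of_rational_cdf)
    show "\<exists>r>q. c r \<omega> < c q \<omega> + e" if e: "e > 0" for q e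
    proof -
      obtain k where k: "1 / real (Suc k) < e" using reals_Archimedean[OF e] by (auto simp: inverse_eq_divide)
      obtain n :: nat where "c (q + 1 / of_nat (Suc n)) \<omega> < c q \<omega> + 1 / real (Suc k)"
        using \<open>good \<omega>\<close> unfolding good_def by blast
      then show ?thesis using k by (intro exI[of _ "q + 1 / of_nat (Suc n)"]) auto
    qed
    show "\<exists>q. 1 - e < c q \<omega>" if e: "e > 0" for e
    proof -
      obtain k where k: "1 / real (Suc k) < e" using reals_Archimedean[OF e] by (auto simp: inverse_eq_divide)
      obtain n :: nat where "1 - 1 / real (Suc k) < c (of_nat n) \<omega>"
        using \<open>good \<omega>\<close> unfolding good_def by blast
      then show ?thesis using k by (intro exI[of _ "of_nat n"]) auto
    qed
    show "\<exists>q. c q \<omega> < e" if e: "e > 0" for e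
    proof -
      obtain k where k: "1 / real (Suc k) < e" using reals_Archimedean[OF e] by (auto simp: inverse_eq_divide)
      obtain n :: nat where "c (- of_nat n) \<omega> < 1 / real (Suc k)"
        using \<open>good \<omega>\<close> unfolding good_def by blast
      then show ?thesis using k by (intro exI[of _ "- of_nat n"]) auto
    qed
  qed (use that in \<open>auto simp: good_def\<close>)
  then obtain L where L: "\<And>\<omega>. good \<omega> \<Longrightarrow> prob_space (L \<omega>)" "\<And>\<omega>. good \<omega> \<Longrightarrow> sets (L \<omega>) = sets borel"
     "\<And>\<omega> q. good \<omega> \<Longrightarrow> emeasure (L \<omega>) {..real_of_rat q} = ennreal (c q \<omega>)"
    by metis
  \<comment> \<open>the unit mass at \<open>0\<close> is an arbitrary choice on a null set\<close>
  define \<kappa> where "\<kappa> \<omega> = (if good \<omega> then L \<omega> else return borel 0)" for \<omega>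
  let ?E = "range (\<lambda>q. {..real_of_rat q})"
  have Int: "Int_stable ?E"
    by (auto simp: Int_stable_def image_iff intro: exI[of _ "min _ _"] split: split_min)
  have gen: "sets borel = sigma_sets UNIV ?E"
    by (subst borel_eq_atMost_rat) (rule sets_measure_of, simp)
  have prob\<kappa>: "prob_space (\<kappa> \<omega>)" and sets\<kappa>: "sets (\<kappa> \<omega>) = sets borel" for \<omega>
    using L by (auto simp: \<kappa>_def prob_space_return)
  have \<kappa>m: "\<kappa> \<in> F \<rightarrow>\<^sub>M prob_algebra borel"
  proof (rule measurable_prob_algebra_generated[OF gen Int])
    fix A assume "A \<in> ?E"
    then obtain q where A: "A = {..real_of_rat q}" by auto
    have "(\<lambda>\<omega>. if good \<omega> then ennreal (c q \<omega>) else indicator A 0) \<in> borel_measurable F"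
      by measurable
    also have "(\<lambda>\<omega>. if good \<omega> then ennreal (c q \<omega>) else indicator A 0) = (\<lambda>\<omega>. emeasure (\<kappa> \<omega>) A)"
      by (auto simp: \<kappa>_def L A fun_eq_iff)
    finally show "(\<lambda>\<omega>. emeasure (\<kappa> \<omega>) A) \<in> borel_measurable F" .
  qed (auto simp: prob\<kappa> sets\<kappa>)
  have "emeasure M {\<omega>\<in>A. R \<omega> \<in> B} = (\<integral>\<^sup>+\<omega>. indicator A \<omega> * emeasure (\<kappa> \<omega>) B \<partial>M)"
    if A: "A \<in> sets F" and B: "B \<in> sets borel" for A B
  proof -
    have AM[measurable]: "A \<in> sets M" using A sub by (auto simp: subalgebra_def)
    have Asp: "A \<subseteq> space M" using AM sets.sets_into_space by blast
    define P where "P = distr (density M (indicator A)) borel R"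
    define Q where "Q = bind (density M (indicator A)) \<kappa>"
    have \<kappa>M: "\<kappa> \<in> density M (indicator A) \<rightarrow>\<^sub>M subprob_algebra borel"
      using measurable_from_subalg[OF sub measurable_prob_algebraD[OF \<kappa>m]] by simp
    have P: "emeasure P B = emeasure M {\<omega>\<in>A. R \<omega> \<in> B}" if "B \<in> sets borel" for B
    proof -
      have "emeasure P B = (\<integral>\<^sup>+\<omega>. indicator A \<omega> * indicator (R -` B \<inter> space M) \<omega> \<partial>M)"
        using that unfolding P_def by (subst emeasure_distr) (auto simp: emeasure_density)
      also have "\<dots> = (\<integral>\<^sup>+\<omega>. indicator {\<omega>\<in>A. R \<omega> \<in> B} \<omega> \<partial>M)"
        by (rule nn_integral_cong) (auto simp: indicator_def)
      also have "\<dots> = emeasure M {\<omega>\<in>A. R \<omega> \<in> B}"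
      proof (rule nn_integral_indicator)
        have "{\<omega>\<in>A. R \<omega> \<in> B} = A \<inter> (R -` B \<inter> space M)" using Asp by auto
        then show "{\<omega>\<in>A. R \<omega> \<in> B} \<in> sets M" using that by auto
      qed
      finally show ?thesis .
    qed
    have km: "(\<lambda>\<omega>. emeasure (\<kappa> \<omega>) B) \<in> borel_measurable M" if "B \<in> sets borel" for B
      using measurable_compose[OF measurable_from_subalg[OF sub measurable_prob_algebraD[OF \<kappa>m]]
          measurable_emeasure_subprob_algebra[OF that]] .
    have Q: "emeasure Q B = (\<integral>\<^sup>+\<omega>. indicator A \<omega> * emeasure (\<kappa> \<omega>) B \<partial>M)" if "B \<in> sets borel" for B
      unfolding Q_def
      by (subst emeasure_bind[OF _ \<kappa>M that]) (use not_empty km[OF that] in \<open>auto simp: nn_integral_density\<close>)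
    have "P = Q"
    proof (rule measure_eqI_generator_eq_countable[OF Int, where \<Omega> = UNIV and A = ?E])
      fix X assume "X \<in> ?E"
      then obtain q where X: "X = {..real_of_rat q}" by auto
      have "emeasure Q X = (\<integral>\<^sup>+\<omega>. indicator A \<omega> * emeasure (\<kappa> \<omega>) X \<partial>M)"
        by (rule Q) (simp add: X)
      also have "\<dots> = (\<integral>\<^sup>+\<omega>. ennreal (indicator A \<omega> * c q \<omega>) \<partial>M)"
        unfolding X
      proof (rule nn_integral_cong_AE)
        show "AE \<omega> in M. indicator A \<omega> * emeasure (\<kappa> \<omega>) {..real_of_rat q} = ennreal (indicator A \<omega> * c q \<omega>)"
          using AE_good by eventually_elim (auto simp: \<kappa>_def L indicator_def)
      qed
      also have "\<dots> = ennreal (\<integral>\<omega>. indicator A \<omega> * c q \<omega> \<partial>M)"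
        using nn by (intro nn_integral_eq_integral)
          (auto intro!: integrable_real_mult_indicator intc simp: mult.commute[of "indicator A _"] elim: eventually_mono)
      also have "(\<integral>\<omega>. indicator A \<omega> * c q \<omega> \<partial>M) = (\<integral>\<omega>. indicator A \<omega> * I q \<omega> \<partial>M)"
        unfolding c_def
        by (rule real_cond_exp_intg(2)) (use A in \<open>auto intro!: integrable_real_mult_indicator intI simp: mult.commute[of "indicator A _"]\<close>)
      also have "\<dots> = (\<integral>\<omega>. indicator {\<omega>\<in>A. R \<omega> \<in> X} \<omega> \<partial>M)"
        by (rule Bochner_Integration.integral_cong) (auto simp: I_def X indicator_def)
      also have "\<dots> = measure M {\<omega>\<in>A. R \<omega> \<in> X}"
      proof -
        have "{\<omega>\<in>A. R \<omega> \<in> X} \<inter> space M = {\<omega>\<in>A. R \<omega> \<in> X}" using Asp by auto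
        then show ?thesis by simp
      qed
      finally show "emeasure P X = emeasure Q X" by (subst P) (auto simp: X emeasure_eq_measure)
    next
      show "sets Q = sigma_sets UNIV ?E" unfolding gen[symmetric] Q_def
        by (rule sets_bind) (use not_empty sets\<kappa> in auto)
      have "\<Union>?E = UNIV"
        by auto (metis of_rat_dense linordered_field_no_ub less_imp_le)
      then show "\<Union>?E = UNIV" .
      show "emeasure P a \<noteq> \<infinity>" if "a \<in> ?E" for a
        using that by (subst P) (auto simp: emeasure_eq_measure)
    qed (auto simp: P_def gen)
    then show ?thesis using P[OF B] Q[OF B] by simp
  qed
  then show ?thesis
    using sub R \<kappa>m by (intro exI[of _ \<kappa>]) (simp add: cond_law_def)
qed

text \<open>
  In base \<open>4\<close> with digits \<open>0\<close> and \<open>1\<close> the part of an expansion behind any digit is worth at most a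
  third of a unit of that digit.  So the integer part of the shifted number is the integer spelled
  by the leading digits, and its parity is its last digit.
\<close>

lemma odd_floor_base4_expansion:
  fixes b :: "nat \<Rightarrow> bool"
  shows "summable (\<lambda>m. of_bool (b m) / 4 ^ Suc m :: real)"
    and "odd \<lfloor>4 ^ Suc m * (\<Sum>m. of_bool (b m) / 4 ^ Suc m :: real)\<rfloor> \<longleftrightarrow> b m"
proof -
  have geo: "(\<lambda>m. (1 / 4) ^ m * (1 / 4) :: real) sums ((1 / (1 - 1 / 4)) * (1 / 4))"
    by (intro sums_mult2 geometric_sums) simp
  have s: "summable (\<lambda>m. of_bool (c m) / 4 ^ Suc m :: real)" for c :: "nat \<Rightarrow> bool"
    by (rule summable_comparison_test'[OF sums_summable[OF geo], where N = 0]) (simp add: power_divide)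
  then show "summable (\<lambda>m. of_bool (b m) / 4 ^ Suc m :: real)" .
  define t where "t = (\<Sum>j. of_bool (b (j + Suc m)) / 4 ^ Suc j :: real)"
  have t0: "0 \<le> t" unfolding t_def by (rule suminf_nonneg[OF s]) simp
  have "t \<le> (\<Sum>m. (1 / 4) ^ m * (1 / 4) :: real)"
    unfolding t_def by (rule suminf_le[OF _ s sums_summable[OF geo]]) (simp add: power_divide)
  also have "\<dots> = 1 / 3" using sums_unique[OF geo] by simp
  finally have t1: "t < 1" by simp
  define N where "N = (\<Sum>j<Suc m. of_bool (b j) * 4 ^ (m - j) :: int)"
  have "(\<Sum>m. of_bool (b m) / 4 ^ Suc m :: real) =
      (\<Sum>j. of_bool (b (j + Suc m)) / 4 ^ Suc (j + Suc m)) + (\<Sum>j<Suc m. of_bool (b j) / 4 ^ Suc j)"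
    by (rule suminf_split_initial_segment[OF s])
  also have "(\<Sum>j. of_bool (b (j + Suc m)) / 4 ^ Suc (j + Suc m) :: real) = t / 4 ^ Suc m"
    unfolding t_def by (subst suminf_divide[OF s, symmetric]) (simp add: power_add mult_ac)
  finally have "4 ^ Suc m * (\<Sum>m. of_bool (b m) / 4 ^ Suc m :: real) =
      t + (\<Sum>j<Suc m. 4 ^ Suc m * (of_bool (b j) / 4 ^ Suc j))"
    by (simp only: distrib_left sum_distrib_left) simp
  also have "(\<Sum>j<Suc m. 4 ^ Suc m * (of_bool (b j) / 4 ^ Suc j) :: real) = of_int N"
  proof -
    have "4 ^ Suc m * (of_bool (b j) / 4 ^ Suc j) = (of_int (of_bool (b j) * 4 ^ (m - j)) :: real)" if "j < Suc m" for j
    proof -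
      have "(4::real) ^ Suc m = 4 ^ (m - j) * 4 ^ Suc j"
        unfolding power_add[symmetric] using that by simp
      then show ?thesis by simp
    qed
    then show ?thesis unfolding N_def of_int_sum by (intro sum.cong) auto
  qed
  finally have "\<lfloor>4 ^ Suc m * (\<Sum>m. of_bool (b m) / 4 ^ Suc m :: real)\<rfloor> = N"
    using t0 t1 by (intro floor_unique) auto
  moreover have "odd N \<longleftrightarrow> b m"
  proof -
    have "even (\<Sum>j<m. of_bool (b j) * 4 ^ (m - j) :: int)"
      by (intro dvd_sum) auto
    then show ?thesis unfolding N_def by simp
  qed
  ultimately show "odd \<lfloor>4 ^ Suc m * (\<Sum>m. of_bool (b m) / 4 ^ Suc m :: real)\<rfloor> \<longleftrightarrow> b m" by simp
qed

text \<open>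
  The digits of \<open>\<phi> x\<close> record, for all \<open>k\<close> and \<open>i\<close>, whether the \<open>i\<close>-th point of a countable dense set
  is within distance \<open>(1/2) ^ k\<close> of \<open>x\<close>.  To decode, one takes for each \<open>k\<close> the first point that
  is, and the limit over \<open>k\<close>.  The Borel left inverse carries conditional laws over from the reals.
\<close>

lemma borel_coding_in_reals:
  obtains \<phi> :: "'a::{banach, second_countable_topology} \<Rightarrow> real" and \<psi> :: "real \<Rightarrow> 'a"
  where "\<phi> \<in> borel_measurable borel" "\<psi> \<in> borel_measurable borel" "\<And>x. \<psi> (\<phi> x) = x"
proof -
  obtain D :: "'a set" where D: "countable D" "\<And>X. open X \<Longrightarrow> X \<noteq> {} \<Longrightarrow> \<exists>d\<in>D. d \<in> X"
    using countable_dense_exists by metis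
  have "D \<noteq> {}" using D(2)[of UNIV] by auto
  define d where "d = from_nat_into D"
  have dense: "\<exists>i. dist x (d i) < e" if "e > 0" for x e
  proof -
    from D(2)[of "ball x e"] that obtain y where "y \<in> D" "dist x y < e" by auto
    moreover from this obtain i where "d i = y" using from_nat_into_surj[OF D(1)] unfolding d_def by blast
    ultimately show ?thesis by auto
  qed
  define b where "b m x \<longleftrightarrow> dist x (d (snd (prod_decode m))) < (1 / 2) ^ fst (prod_decode m)" for m x
  define \<phi> where "\<phi> x = (\<Sum>m. of_bool (b m x) / 4 ^ Suc m :: real)" for x
  define \<psi> where "\<psi> y = lim (\<lambda>k. d (LEAST i. odd \<lfloor>4 ^ Suc (prod_encode (k, i)) * y\<rfloor>))" for y :: real
  have "\<phi> \<in> borel_measurable borel"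
    unfolding \<phi>_def b_def of_bool_def by measurable
  moreover have "\<psi> \<in> borel_measurable borel"
    unfolding \<psi>_def
  proof (rule borel_measurable_lim_metric)
    fix k
    have "(\<lambda>y::real. LEAST i. odd \<lfloor>4 ^ Suc (prod_encode (k, i)) * y\<rfloor>) \<in> borel \<rightarrow>\<^sub>M count_space UNIV"
      by measurable
    then show "(\<lambda>y::real. d (LEAST i. odd \<lfloor>4 ^ Suc (prod_encode (k, i)) * y\<rfloor>)) \<in> borel_measurable borel"
      by (rule measurable_compose) simp
  qed
  moreover have "\<psi> (\<phi> x) = x" for x
  proof -
    have odd: "odd \<lfloor>4 ^ Suc (prod_encode (k, i)) * \<phi> x\<rfloor> \<longleftrightarrow> dist x (d i) < (1 / 2) ^ k" for k i
      unfolding \<phi>_def odd_floor_base4_expansion(2) by (simp add: b_def)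
    have "dist x (d (LEAST i. dist x (d i) < (1 / 2) ^ k)) < (1 / 2) ^ k" for k
      by (rule LeastI_ex[of "\<lambda>i. dist x (d i) < (1 / 2) ^ k"]) (simp add: dense)
    then have "(\<lambda>k. d (LEAST i. dist x (d i) < (1 / 2) ^ k)) \<longlonglongrightarrow> x"
      unfolding tendsto_dist_iff[of _ x]
      by (intro tendsto_sandwich[OF _ _ tendsto_const LIMSEQ_realpow_zero[of "1/2"]])
        (auto simp: dist_commute intro!: always_eventually less_imp_le)
    then show ?thesis unfolding \<psi>_def odd by (rule limI)
  qed
  ultimately show ?thesis using that by blast
qed

theorem cond_law_exists:
  fixes X :: "'w \<Rightarrow> 'a::{banach, second_countable_topology}"
  assumes M: "prob_space M" and sub: "subalgebra M F" and X: "X \<in> borel_measurable M"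
  shows "\<exists>\<kappa>. cond_law M F X borel \<kappa>"
proof -
  obtain \<phi> :: "'a \<Rightarrow> real" and \<psi> where \<phi>: "\<phi> \<in> borel_measurable borel"
    and \<psi>: "\<psi> \<in> borel_measurable borel" and inv: "\<And>x. \<psi> (\<phi> x) = x"
    by (rule borel_coding_in_reals) blast
  obtain \<kappa> where cl: "cond_law M F (\<lambda>\<omega>. \<phi> (X \<omega>)) borel \<kappa>"
    using real_cond_law_exists[OF M sub measurable_compose[OF X \<phi>]] by blast
  have \<kappa>: "\<kappa> \<in> F \<rightarrow>\<^sub>M prob_algebra borel" using cl by (simp add: cond_law_def)
  have "emeasure M {\<omega>\<in>A. X \<omega> \<in> B} = (\<integral>\<^sup>+\<omega>. indicator A \<omega> * emeasure (distr (\<kappa> \<omega>) borel \<psi>) B \<partial>M)"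
    if A: "A \<in> sets F" and B: "B \<in> sets borel" for A B
  proof -
    have B': "\<psi> -` B \<in> sets borel" using measurable_sets[OF \<psi> B] by simp
    have "emeasure M {\<omega>\<in>A. \<phi> (X \<omega>) \<in> \<psi> -` B} = (\<integral>\<^sup>+\<omega>. indicator A \<omega> * emeasure (\<kappa> \<omega>) (\<psi> -` B) \<partial>M)"
      using cl A B' unfolding cond_law_def by blast
    also have "\<dots> = (\<integral>\<^sup>+\<omega>. indicator A \<omega> * emeasure (distr (\<kappa> \<omega>) borel \<psi>) B \<partial>M)"
    proof (rule nn_integral_cong)
      fix \<omega> assume "\<omega> \<in> space M"
      then have "\<kappa> \<omega> \<in> space (prob_algebra borel)"
        using measurable_space[OF \<kappa>] sub by (simp add: subalgebra_def)
      then have s: "sets (\<kappa> \<omega>) = sets borel" by (simp add: space_prob_algebra)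
      then have "\<psi> \<in> \<kappa> \<omega> \<rightarrow>\<^sub>M borel" using \<psi> by (simp cong: measurable_cong_sets)
      from emeasure_distr[OF this B] sets_eq_imp_space_eq[OF s]
      show "indicator A \<omega> * emeasure (\<kappa> \<omega>) (\<psi> -` B) = indicator A \<omega> * emeasure (distr (\<kappa> \<omega>) borel \<psi>) B"
        by simp
    qed
    finally show ?thesis by (simp add: inv)
  qed
  moreover have "(\<lambda>\<omega>. distr (\<kappa> \<omega>) borel \<psi>) \<in> F \<rightarrow>\<^sub>M prob_algebra borel"
    by (rule measurable_compose[OF \<kappa> measurable_distr_prob_space[OF \<psi>]])
  ultimately show ?thesis
    using sub X by (intro exI[of _ "\<lambda>\<omega>. distr (\<kappa> \<omega>) borel \<psi>"]) (simp add: cond_law_def)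
qed

section \<open>Weak convergence of probability measures\<close>

text \<open>
  A tent of height \<open>q\<close> over the ball of radius \<open>r\<close> around \<open>d\<close>.  Radius and height are rational so that
  the tents with centres in a countable dense set form a countable family.
\<close>

definition bump :: "'a::metric_space \<Rightarrow> rat \<Rightarrow> rat \<Rightarrow> 'a \<Rightarrow> real" where
  "bump d r q x = real_of_rat q * max 0 (1 - dist x d / real_of_rat r)"

lemma bump_Lipschitz:
  assumes "r > 0" "q \<ge> 0"
  shows "\<bar>bump d r q x - bump d r q y\<bar> \<le> real_of_rat q / real_of_rat r * dist x y"
proof -
  have r: "real_of_rat r > 0" and q: "real_of_rat q \<ge> 0" using assms by auto
  have "\<bar>max 0 (1 - dist x d / real_of_rat r) - max 0 (1 - dist y d / real_of_rat r)\<bar>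
      \<le> \<bar>dist x d / real_of_rat r - dist y d / real_of_rat r\<bar>"
    by (auto simp: max_def abs_if)
  also have "\<dots> = \<bar>dist x d - dist y d\<bar> / real_of_rat r"
    using r by (simp add: diff_divide_distrib[symmetric])
  also have "\<dots> \<le> dist x y / real_of_rat r"
    by (rule divide_right_mono) (use r abs_dist_diff_le[of x d y] in \<open>auto simp: dist_commute\<close>)
  finally have "real_of_rat q * \<bar>max 0 (1 - dist x d / real_of_rat r) - max 0 (1 - dist y d / real_of_rat r)\<bar>
      \<le> real_of_rat q * (dist x y / real_of_rat r)"
    using q by (rule mult_left_mono)
  then show ?thesis
    unfolding bump_def right_diff_distrib[symmetric] abs_mult using q by simp
qed

lemma bump_bounds:
  assumes "r > 0" "q \<ge> 0"
  shows "0 \<le> bump d r q x" "bump d r q x \<le> real_of_rat q"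
    "x \<notin> ball d (real_of_rat r) \<Longrightarrow> bump d r q x = 0"
proof -
  have r: "real_of_rat r > 0" and q: "real_of_rat q \<ge> 0" using assms by auto
  show "0 \<le> bump d r q x" unfolding bump_def using q by simp
  show "bump d r q x \<le> real_of_rat q"
    unfolding bump_def using q r by (auto intro!: mult_left_le simp: max_def)
  show "bump d r q x = 0" if "x \<notin> ball d (real_of_rat r)"
    using that r by (auto simp: bump_def max_def dist_commute field_simps)
qed

text \<open>
  The pointwise maximum of a list of functions.  It starts from \<open>0\<close>, which is harmless as it is
  applied to nonnegative functions.
\<close>

definition max_list :: "('a \<Rightarrow> real) list \<Rightarrow> 'a \<Rightarrow> real" where
  "max_list l x = foldr (\<lambda>b m. max (b x) m) l 0"

lemma max_list_nonneg: "0 \<le> max_list l x"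
  by (induction l) (auto simp: max_list_def)

lemma max_list_ge: "b \<in> set l \<Longrightarrow> b x \<le> max_list l x"
  by (induction l) (auto simp: max_list_def le_max_iff_disj)

lemma max_list_le: "(\<And>b. b \<in> set l \<Longrightarrow> b x \<le> C) \<Longrightarrow> 0 \<le> C \<Longrightarrow> max_list l x \<le> C"
  by (induction l) (auto simp: max_list_def)

definition bounded_lipschitz :: "('a::metric_space \<Rightarrow> real) \<Rightarrow> bool" where
  "bounded_lipschitz f \<longleftrightarrow> bounded (range f) \<and> (\<exists>L. L-lipschitz_on UNIV f)"

lemma bounded_lipschitz_max_list:
  assumes "\<And>b. b \<in> set l \<Longrightarrow> bounded_lipschitz b"
  shows "bounded_lipschitz (max_list l)"
  using assms
proof (induction l)
  case Nil
  have eq: "max_list [] = (\<lambda>_::'a. 0)" by (simp add: max_list_def fun_eq_iff)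
  have "0-lipschitz_on UNIV (\<lambda>_::'a. 0::real)" by (rule lipschitz_onI) auto
  then show ?case unfolding bounded_lipschitz_def eq by auto
next
  case (Cons b l)
  have eq: "max_list (b # l) = (\<lambda>x. max (b x) (max_list l x))" by (simp add: max_list_def fun_eq_iff)
  have bl: "bounded_lipschitz b" "bounded_lipschitz (max_list l)" using Cons by auto
  obtain K L where K: "\<And>x. \<bar>b x\<bar> \<le> K" and L: "L-lipschitz_on UNIV b"
    using bl(1) by (auto simp: bounded_lipschitz_def bounded_iff)
  obtain K' L' where K': "\<And>x. \<bar>max_list l x\<bar> \<le> K'" and L': "L'-lipschitz_on UNIV (max_list l)"
    using bl(2) by (auto simp: bounded_lipschitz_def bounded_iff)
  have "\<bar>max_list (b # l) x\<bar> \<le> max K K'" for x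
    using K[of x] K'[of x] unfolding eq by linarith
  then have "bounded (range (max_list (b # l)))" by (auto simp: bounded_iff)
  moreover have "(max L L')-lipschitz_on UNIV (max_list (b # l))"
  proof (rule lipschitz_onI)
    fix x y :: 'a
    have "dist (b x) (b y) \<le> L * dist x y" "dist (max_list l x) (max_list l y) \<le> L' * dist x y"
      using lipschitz_onD[OF L, of x y] lipschitz_onD[OF L', of x y] by auto
    moreover have "L * dist x y \<le> max L L' * dist x y" "L' * dist x y \<le> max L L' * dist x y"
      by (auto intro: mult_right_mono)
    ultimately show "dist (max_list (b # l) x) (max_list (b # l) y) \<le> max L L' * dist x y"
      unfolding eq dist_real_def by linarith
  qed (use lipschitz_on_nonneg[OF L] in auto)
  ultimately show ?case by (auto simp: bounded_lipschitz_def)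
qed

text \<open>
  If \<open>f\<close> exceeds a rational \<open>q\<close> on a ball around \<open>x\<close>, a tent of height \<open>q\<close> centred at a dense point
  much closer to \<open>x\<close> than its radius fits below \<open>f\<close> and almost reaches \<open>q\<close> at \<open>x\<close>.
\<close>

lemma countable_bumps_below:
  obtains B :: "('a::{metric_space, second_countable_topology} \<Rightarrow> real) set"
  where "countable B" "\<And>b. b \<in> B \<Longrightarrow> bounded_lipschitz b" "\<And>b x. b \<in> B \<Longrightarrow> 0 \<le> b x" "(\<lambda>_. 0) \<in> B"
    "\<And>f x e. continuous_on UNIV f \<Longrightarrow> (\<And>y. 0 \<le> f y) \<Longrightarrow> e > 0 \<Longrightarrow>
       \<exists>b\<in>B. (\<forall>y. b y \<le> f y) \<and> f x - e < b x"
proof -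
  obtain D :: "'a set" where D: "countable D" "\<And>X. open X \<Longrightarrow> X \<noteq> {} \<Longrightarrow> \<exists>d\<in>D. d \<in> X"
    using countable_dense_exists by metis
  define B where "B = (\<lambda>(d, r, q). bump d r q) ` (D \<times> {0<..} \<times> {0..})"
  have "countable B" unfolding B_def using D(1) by (intro countable_image countable_SIGMA) auto
  moreover have "bounded_lipschitz b" if "b \<in> B" for b
  proof -
    from that obtain d r q where b: "b = bump d r q" and rq: "r > 0" "q \<ge> 0" by (auto simp: B_def)
    have "(real_of_rat q / real_of_rat r)-lipschitz_on UNIV b"
      by (rule lipschitz_onI) (use bump_Lipschitz[OF rq] rq in \<open>auto simp: b dist_real_def\<close>)
    moreover have "bounded (range b)"
      unfolding bounded_iff b using bump_bounds[OF rq, of d] by (intro exI[of _ "real_of_rat q"]) auto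
    ultimately show ?thesis by (auto simp: bounded_lipschitz_def)
  qed
  moreover have "0 \<le> b x" if "b \<in> B" for b x
    using that bump_bounds(1) by (auto simp: B_def)
  moreover have "(\<lambda>_. 0) \<in> B"
  proof -
    obtain d where "d \<in> D" using D(2)[of UNIV] by auto
    moreover have "(\<lambda>_. 0) = bump d 1 0" by (simp add: bump_def fun_eq_iff)
    ultimately show ?thesis unfolding B_def by (intro image_eqI[of _ _ "(d, 1, 0)"]) auto
  qed
  moreover have "\<exists>b\<in>B. (\<forall>y. b y \<le> f y) \<and> f x - e < b x"
    if f: "continuous_on UNIV f" "\<And>y. 0 \<le> f y" and e: "e > 0" for f x and e :: real
  proof (cases "f x < e")
    case True
    then show ?thesis using f(2) \<open>(\<lambda>_. 0) \<in> B\<close> by (intro bexI[of _ "\<lambda>_. 0"]) auto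
  next
    case False
    then have fx: "0 < f x" using e by linarith
    obtain q where q: "max 0 (f x - e) < real_of_rat q" "real_of_rat q < f x"
      using of_rat_dense[of "max 0 (f x - e)" "f x"] fx e by auto
    have q0: "0 < real_of_rat q" using q by simp
    have "isCont f x" using f(1) by (simp add: continuous_on_eq_continuous_at)
    then have "(f \<longlongrightarrow> f x) (nhds x)" by (simp add: isCont_def tendsto_at_iff_tendsto_nhds)
    from order_tendstoD(1)[OF this q(2)]
    obtain \<delta> where \<delta>: "\<delta> > 0" "\<And>y. dist y x < \<delta> \<Longrightarrow> real_of_rat q < f y"
      by (auto simp: eventually_nhds_metric)
    obtain r where r: "0 < real_of_rat r" "real_of_rat r < \<delta> / 2" using of_rat_dense[of 0 "\<delta> / 2"] \<delta> by auto
    \<comment> \<open>close enough to \<open>x\<close> that the tent loses at most \<open>q - (f x - e)\<close> of its height there\<close>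
    define \<eta> where "\<eta> = real_of_rat r * min 1 ((real_of_rat q - (f x - e)) / real_of_rat q)"
    have \<eta>: "\<eta> > 0" unfolding \<eta>_def using q q0 r by (auto intro!: mult_pos_pos)
    obtain d where d: "d \<in> D" "dist x d < \<eta>" using D(2)[of "ball x \<eta>"] \<eta> by auto
    have \<eta>1: "\<eta> \<le> real_of_rat r"
      unfolding \<eta>_def using r by (intro mult_left_le) auto
    have \<eta>2: "real_of_rat q * (\<eta> / real_of_rat r) \<le> real_of_rat q - (f x - e)"
      unfolding \<eta>_def using r q0 by (simp add: min_def field_simps)
    have rq: "r > 0" "q \<ge> 0" using r q0 by auto
    have "bump d r q y \<le> f y" for y
    proof (cases "y \<in> ball d (real_of_rat r)")
      case True
      then have "dist y x < \<delta>" using dist_triangle[of y x d] d(2) \<eta>1 r by (auto simp: dist_commute)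
      then show ?thesis using \<delta>(2)[of y] bump_bounds(2)[OF rq, of d y] by linarith
    next
      case False
      then show ?thesis using bump_bounds(3)[OF rq False] f(2)[of y] by simp
    qed
    moreover have "f x - e < bump d r q x"
    proof -
      have "real_of_rat q * (dist x d / real_of_rat r) < real_of_rat q * (\<eta> / real_of_rat r)"
        using d(2) r q0 by (intro mult_strict_left_mono divide_strict_right_mono) auto
      then have "f x - e < real_of_rat q * (1 - dist x d / real_of_rat r)"
        using \<eta>2 by (simp add: right_diff_distrib)
      also have "\<dots> \<le> bump d r q x" unfolding bump_def using q0 by (intro mult_left_mono) auto
      finally show ?thesis .
    qed
    moreover have "bump d r q \<in> B" unfolding B_def using d(1) rq by (intro image_eqI[of _ _ "(d, r, q)"]) auto
    ultimately show ?thesis by blast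
  qed
  ultimately show ?thesis by (rule that)
qed

lemma integrable_bounded_continuous:
  fixes f :: "'a::metric_space \<Rightarrow> real"
  assumes "prob_space N" "sets N = sets borel" "continuous_on UNIV f" "bounded (range f)"
  shows "integrable N f"
proof -
  interpret prob_space N by fact
  obtain K where K: "\<And>x. \<bar>f x\<bar> \<le> K" using assms(4) by (auto simp: bounded_iff)
  have "f \<in> borel_measurable N"
    using borel_measurable_continuous_onI[OF assms(3)] assms(2) by (simp cong: measurable_cong_sets)
  then show ?thesis by (rule integrable_const_bound[where B = K, rotated]) (use K in auto)
qed

lemma abs_integral_le_bound:
  fixes f :: "'a::topological_space \<Rightarrow> real"
  assumes N: "prob_space N" "sets N = sets borel" and f: "f \<in> borel_measurable borel" "\<And>x. \<bar>f x\<bar> \<le> K"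
  shows "\<bar>\<integral>x. f x \<partial>N\<bar> \<le> K"
proof -
  interpret prob_space N by fact
  have "\<bar>\<integral>x. f x \<partial>N\<bar> \<le> (\<integral>x. \<bar>f x\<bar> \<partial>N)" by (rule integral_abs_bound)
  also have "\<dots> \<le> (\<integral>x. K \<partial>N)"
  proof (rule integral_mono)
    show "integrable N (\<lambda>x. \<bar>f x\<bar>)"
      by (rule integrable_const_bound[where B = K]) (use f N(2) in \<open>auto cong: measurable_cong_sets\<close>)
  qed (use f in auto)
  finally show ?thesis by (simp add: prob_space)
qed

lemma bounded_lipschitz_continuous: "bounded_lipschitz f \<Longrightarrow> continuous_on UNIV f"
  by (auto simp: bounded_lipschitz_def intro: lipschitz_on_continuous_on)

lemma converges_weakly_cong:
  assumes "\<forall>\<^sub>F n in sequentially. N n = N' n" and "converges_weakly N L"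
  shows "converges_weakly N' L"
  unfolding converges_weakly_def
proof (intro allI impI)
  fix f :: "'a \<Rightarrow> real" assume "continuous_on UNIV f \<and> bounded (range f)"
  then have "(\<lambda>n. \<integral>x. f x \<partial>N n) \<longlonglongrightarrow> (\<integral>x. f x \<partial>L)" using assms(2) by (simp add: converges_weakly_def)
  moreover have "\<forall>\<^sub>F n in sequentially. (\<integral>x. f x \<partial>N n) = (\<integral>x. f x \<partial>N' n)"
    using assms(1) by eventually_elim simp
  ultimately show "(\<lambda>n. \<integral>x. f x \<partial>N' n) \<longlonglongrightarrow> (\<integral>x. f x \<partial>L)" by (rule Lim_transform_eventually)
qed

text \<open>
  The functions are the finite maxima of tents.  A nonnegative continuous \<open>f\<close> is the increasing limit
  of such maxima, so convergence of their integrals yields \<open>\<integral>f dL \<le> liminf \<integral>f dN\<^sub>n\<close>.  If \<open>f\<close> is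
  bounded by \<open>K\<close>, this inequality for \<open>K + f\<close> and for \<open>K - f\<close> gives convergence.  The limit \<open>L\<close> is
  given in advance, so that mass cannot escape.
\<close>

theorem countable_convergence_determining:
  obtains H :: "('a::{metric_space, second_countable_topology} \<Rightarrow> real) set"
  where "countable H" "\<And>h. h \<in> H \<Longrightarrow> bounded_lipschitz h"
    "\<And>N L. (\<And>n. prob_space (N n) \<and> sets (N n) = sets borel) \<Longrightarrow> prob_space L \<Longrightarrow> sets L = sets borel \<Longrightarrow>
       (\<And>h. h \<in> H \<Longrightarrow> (\<lambda>n. \<integral>x. h x \<partial>N n) \<longlonglongrightarrow> (\<integral>x. h x \<partial>L)) \<Longrightarrow> converges_weakly N L"
proof -
  obtain B :: "('a \<Rightarrow> real) set" where B: "countable B" "\<And>b. b \<in> B \<Longrightarrow> bounded_lipschitz b"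
     "\<And>b x. b \<in> B \<Longrightarrow> 0 \<le> b x" "(\<lambda>_. 0) \<in> B"
    and below: "\<And>f x e. continuous_on UNIV f \<Longrightarrow> (\<And>y. 0 \<le> f y) \<Longrightarrow> e > 0 \<Longrightarrow>
       \<exists>b\<in>B. (\<forall>y. b y \<le> f y) \<and> f x - e < b x"
    by (rule countable_bumps_below) blast
  define H where "H = max_list ` lists B"
  have H_BL: "bounded_lipschitz h" if "h \<in> H" for h
    using that B(2) by (auto simp: H_def intro!: bounded_lipschitz_max_list)
  have cH: "countable H" unfolding H_def using B(1) by auto
  have "converges_weakly N L"
    if N: "\<And>n. prob_space (N n) \<and> sets (N n) = sets borel" and L: "prob_space L" "sets L = sets borel"
      and conv: "\<And>h. h \<in> H \<Longrightarrow> (\<lambda>n. \<integral>x. h x \<partial>N n) \<longlonglongrightarrow> (\<integral>x. h x \<partial>L)" for N L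
  proof -
    have lower: "\<forall>\<^sub>F n in sequentially. (\<integral>x. f x \<partial>L) - e < (\<integral>x. f x \<partial>N n)"
      if f: "continuous_on UNIV f" "bounded (range f)" "\<And>y. 0 \<le> f y" and e: "e > 0" for f and e :: real
    proof -
      obtain K where K: "\<And>x. f x \<le> K" using f(2) by (auto simp: bounded_iff abs_le_iff)
      let ?S = "{b\<in>B. \<forall>y. b y \<le> f y}"
      have S: "countable ?S" "?S \<noteq> {}" using B f(3) by (auto intro: countable_subset[OF _ B(1)])
      define b where "b = from_nat_into ?S"
      have b: "b i \<in> B" "b i y \<le> f y" for i y
        using from_nat_into[OF S(2), of i] by (auto simp: b_def)
      define h where "h j = max_list (map b [0..<j])" for j
      have hH: "h j \<in> H" for j unfolding h_def H_def using b(1) by (intro imageI) auto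
      have h_le: "h j x \<le> f x" for j x
        unfolding h_def by (rule max_list_le) (use b f(3) in auto)
      have h_lim: "(\<lambda>j. h j x) \<longlonglongrightarrow> f x" for x
      proof (rule order_tendstoI)
        fix a assume "a < f x"
        then obtain b' where "b' \<in> ?S" "a < b' x" using below[OF f(1) f(3), of "f x - a" x] by auto
        moreover from this obtain i where "b i = b'" using from_nat_into_surj[OF S(1)] unfolding b_def by blast
        ultimately have i: "a < b i x" by simp
        have "a < h j x" if "j > i" for j
          using i max_list_ge[of "b i" "map b [0..<j]" x] that unfolding h_def by fastforce
        then show "\<forall>\<^sub>F j in sequentially. a < h j x" by (auto simp: eventually_at_top_dense)
      next
        fix a assume "f x < a"
        then show "\<forall>\<^sub>F j in sequentially. h j x < a" by (auto intro!: always_eventually le_less_trans[OF h_le])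
      qed
      have int_h: "integrable (N n) (h j)" "integrable L (h j)" for n j
        using N L H_BL[OF hH] by (auto intro!: integrable_bounded_continuous bounded_lipschitz_continuous
            simp: bounded_lipschitz_def)
      have int_f: "integrable (N n) f" "integrable L f" for n
        using N L f by (auto intro!: integrable_bounded_continuous)
      have "(\<lambda>j. \<integral>x. h j x \<partial>L) \<longlonglongrightarrow> (\<integral>x. f x \<partial>L)"
      proof (rule integral_dominated_convergence[where w = f])
        show "AE x in L. norm (h j x) \<le> f x" for j
          using h_le by (simp add: h_def abs_of_nonneg[OF max_list_nonneg])
      qed (use int_f int_h h_lim in auto)
      from order_tendstoD(1)[OF this, of "(\<integral>x. f x \<partial>L) - e"] e
      obtain j where "(\<integral>x. f x \<partial>L) - e < (\<integral>x. h j x \<partial>L)"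
        by (auto simp: eventually_sequentially)
      from order_tendstoD(1)[OF conv[OF hH] this] show ?thesis
      proof eventually_elim
        case (elim n)
        also have "(\<integral>x. h j x \<partial>N n) \<le> (\<integral>x. f x \<partial>N n)"
          by (rule integral_mono) (use int_f int_h h_le in auto)
        finally show ?case .
      qed
    qed
    show ?thesis
      unfolding converges_weakly_def
    proof (intro allI impI)
      fix f :: "'a \<Rightarrow> real" assume "continuous_on UNIV f \<and> bounded (range f)"
      then have f: "continuous_on UNIV f" "bounded (range f)" by auto
      then obtain K where K: "\<And>x. \<bar>f x\<bar> \<le> K" by (auto simp: bounded_iff)
      have bnd: "bounded (range (\<lambda>x. K + f x))" "bounded (range (\<lambda>x. K - f x))"
        unfolding bounded_iff real_norm_def using K by (auto intro!: exI[of _ "2 * K"] simp: abs_le_iff) (smt (verit))+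
      have int_f: "integrable (N n) f" "integrable L f" for n
        using N L f by (auto intro!: integrable_bounded_continuous)
      interpret L: prob_space L by fact
      have pn: "(\<integral>x. K + f x \<partial>N n) = K + (\<integral>x. f x \<partial>N n)" "(\<integral>x. K - f x \<partial>N n) = K - (\<integral>x. f x \<partial>N n)" for n
      proof -
        interpret prob_space "N n" using N by blast
        show "(\<integral>x. K + f x \<partial>N n) = K + (\<integral>x. f x \<partial>N n)" "(\<integral>x. K - f x \<partial>N n) = K - (\<integral>x. f x \<partial>N n)"
          using int_f by (simp_all add: prob_space)
      qed
      have pl: "(\<integral>x. K + f x \<partial>L) = K + (\<integral>x. f x \<partial>L)" "(\<integral>x. K - f x \<partial>L) = K - (\<integral>x. f x \<partial>L)"
        using int_f by (simp_all add: L.prob_space)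
      have nn: "0 \<le> K + f x" "0 \<le> K - f x" for x using K[of x] by linarith+
      have l1: "\<forall>\<^sub>F n in sequentially. (\<integral>x. f x \<partial>L) - e < (\<integral>x. f x \<partial>N n)" if "e > 0" for e
        using lower[OF continuous_on_add[OF continuous_on_const f(1)] bnd(1) nn(1) that] unfolding pn pl
        by (rule eventually_mono) simp
      have l2: "\<forall>\<^sub>F n in sequentially. (\<integral>x. f x \<partial>N n) < (\<integral>x. f x \<partial>L) + e" if "e > 0" for e
        using lower[OF continuous_on_diff[OF continuous_on_const f(1)] bnd(2) nn(2) that] unfolding pn pl
        by (rule eventually_mono) simp
      show "(\<lambda>n. \<integral>x. f x \<partial>N n) \<longlonglongrightarrow> (\<integral>x. f x \<partial>L)"
      proof (rule order_tendstoI)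
        fix a assume "a < (\<integral>x. f x \<partial>L)"
        with l1[of "(\<integral>x. f x \<partial>L) - a"] show "\<forall>\<^sub>F n in sequentially. a < (\<integral>x. f x \<partial>N n)" by simp
      next
        fix a assume "(\<integral>x. f x \<partial>L) < a"
        with l2[of "a - (\<integral>x. f x \<partial>L)"] show "\<forall>\<^sub>F n in sequentially. (\<integral>x. f x \<partial>N n) < a" by simp
      qed
    qed
  qed
  from that[OF cH H_BL this] show ?thesis .
qed

text \<open>
  For closed nonempty \<open>C\<close>, a sequence of continuous functions decreasing to the indicator of \<open>C\<close>.
\<close>

definition near :: "'a::metric_space set \<Rightarrow> nat \<Rightarrow> 'a \<Rightarrow> real" where
  "near C m x = max 0 (1 - real m * infdist x C)"

lemma near_bounds: "0 \<le> near C m x" "near C m x \<le> 1"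
  by (auto simp: near_def infdist_nonneg)

lemma near_continuous: "continuous_on UNIV (near C m)"
  unfolding near_def by (intro continuous_intros)

lemma near_bounded: "bounded (range (near C m))"
  unfolding bounded_iff using near_bounds[of C m] by (intro exI[of _ 1]) auto

lemma near_tendsto:
  assumes "closed C" "C \<noteq> {}"
  shows "(\<lambda>m. near C m x) \<longlonglongrightarrow> indicator C x"
proof (cases "x \<in> C")
  case True
  then show ?thesis by (simp add: near_def)
next
  case False
  then have d: "infdist x C > 0"
    using in_closed_iff_infdist_zero[OF assms] infdist_nonneg[of x C] by (metis less_le)
  obtain k where k: "1 < real k * infdist x C" using ex_less_of_nat_mult[OF d] by auto
  have "near C m x = 0" if "m \<ge> k" for m
  proof -
    have "real k * infdist x C \<le> real m * infdist x C" using that d by (intro mult_right_mono) auto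
    with k show ?thesis by (simp add: near_def)
  qed
  then have "\<forall>\<^sub>F m in sequentially. near C m x = 0" unfolding eventually_sequentially by blast
  then show ?thesis using False by (simp add: tendsto_eventually)
qed

lemma measure_eqI_continuous_integrals:
  fixes P Q :: "'a::metric_space measure"
  assumes P: "prob_space P" "sets P = sets borel" and Q: "prob_space Q" "sets Q = sets borel"
    and eq: "\<And>f :: 'a \<Rightarrow> real. continuous_on UNIV f \<Longrightarrow> (\<And>x. 0 \<le> f x) \<Longrightarrow> (\<And>x. f x \<le> 1) \<Longrightarrow>
      (\<integral>x. f x \<partial>P) = (\<integral>x. f x \<partial>Q)"
  shows "P = Q"
proof -
  interpret P: prob_space P by fact
  interpret Q: prob_space Q by fact
  have lim: "(\<lambda>m. \<integral>x. near C m x \<partial>R) \<longlonglongrightarrow> measure R C"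
    if C: "closed C" "C \<noteq> {}" and R: "prob_space R" "sets R = sets borel" for C :: "'a set" and R
  proof -
    interpret prob_space R by fact
    have "near C m \<in> borel_measurable R" for m
      using borel_measurable_continuous_onI[OF near_continuous] R(2) by (simp cong: measurable_cong_sets)
    moreover have [measurable]: "C \<in> sets R" using C(1) R(2) by auto
    ultimately have "(\<lambda>m. \<integral>x. near C m x \<partial>R) \<longlonglongrightarrow> (\<integral>x. indicator C x \<partial>R)"
      by (intro integral_dominated_convergence[where w = "\<lambda>_. 1"])
        (auto simp: near_bounds near_tendsto[OF C])
    then show ?thesis using sets.sets_into_space[OF \<open>C \<in> sets R\<close>] by (simp add: Int_absorb2)
  qed
  show ?thesis
  proof (rule measure_eqI_generator_eq[where E = "Collect closed" and \<Omega> = UNIV and A = "\<lambda>_. UNIV"])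
    fix C :: "'a set" assume "C \<in> Collect closed"
    then have C: "closed C" by simp
    show "emeasure P C = emeasure Q C"
    proof (cases "C = {}")
      case False
      have "measure P C = measure Q C"
        using LIMSEQ_unique[OF lim[OF C False P]] lim[OF C False Q]
          eq[OF near_continuous near_bounds] by simp
      then show ?thesis by (simp add: P.emeasure_eq_measure Q.emeasure_eq_measure)
    qed simp
  next
    have "sets borel = sigma_sets UNIV (Collect closed :: 'a set set)"
      unfolding borel_eq_closed by (rule sets_measure_of) simp
    then show "sets P = sigma_sets UNIV (Collect closed)" "sets Q = sigma_sets UNIV (Collect closed)"
      using P(2) Q(2) by auto
  qed (auto simp: Int_stable_def P.emeasure_eq_measure)
qed

lemma weak_limit_supported_by_closed:
  fixes L :: "'a::metric_space measure"
  assumes conv: "converges_weakly N L" and L: "prob_space L" "sets L = sets borel"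
    and C: "closed C" "C \<noteq> {}" and supp: "\<forall>\<^sub>F n in sequentially. prob_space (N n) \<and> sets (N n) = sets borel \<and> (AE x in N n. x \<in> C)"
  shows "AE x in L. x \<in> C"
proof -
  interpret L: prob_space L by fact
  have meas: "near C 1 \<in> borel_measurable L"
    using borel_measurable_continuous_onI[OF near_continuous] L(2) by (simp cong: measurable_cong_sets)
  have int: "integrable L (near C 1)" by (rule integrable_bounded_continuous[OF L near_continuous near_bounded])
  have "(\<lambda>n. \<integral>x. near C 1 x \<partial>N n) \<longlonglongrightarrow> (\<integral>x. near C 1 x \<partial>L)"
    using conv near_continuous near_bounded unfolding converges_weakly_def by blast
  moreover have "(\<lambda>n. \<integral>x. near C 1 x \<partial>N n) \<longlonglongrightarrow> 1"
  proof (rule tendsto_eventually)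
    show "\<forall>\<^sub>F n in sequentially. (\<integral>x. near C 1 x \<partial>N n) = 1"
    using supp
  proof eventually_elim
    case (elim n)
    then interpret prob_space "N n" by simp
    have sN: "sets (N n) = sets borel" using elim by simp
    have "(\<integral>x. near C 1 x \<partial>N n) = (\<integral>x. 1 \<partial>N n)"
    proof (rule Bochner_Integration.integral_cong_AE)
      show "AE x in N n. near C 1 x = 1" using elim by (auto simp: near_def elim!: eventually_mono)
    qed (use sN borel_measurable_continuous_onI[OF near_continuous] in \<open>auto cong: measurable_cong_sets\<close>)
    then show ?case by (simp add: prob_space)
  qed
  qed
  ultimately have "(\<integral>x. near C 1 x \<partial>L) = 1"
    by (rule LIMSEQ_unique)
  then have "(\<integral>x. 1 - near C 1 x \<partial>L) = 0" using int by (simp add: L.prob_space)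
  then have "AE x in L. 1 - near C 1 x = 0"
    using int by (subst (asm) integral_nonneg_eq_0_iff_AE) (auto simp: near_bounds)
  then show ?thesis
  proof eventually_elim
    case (elim x)
    then have "infdist x C = 0" using infdist_nonneg[of x C] by (auto simp: near_def max_def split: if_splits)
    then show ?case using in_closed_iff_infdist_zero[OF C] by simp
  qed
qed

section \<open>Almost sure convergence of sums of martingale differences\<close>

text \<open>
  Let \<open>T\<close> be the sum stopped at the first exit of the partial sums from the interval
  \<open>(-\<epsilon>, \<epsilon>)\<close>.  Its increments are still orthogonal, so its second moment at time \<open>N\<close> is at most the
  sum of the \<open>(c i)\<^sup>2\<close>; and if an exit occurs by time \<open>N\<close>, the stopped sum keeps a modulus of at
  least \<open>\<epsilon>\<close> until time \<open>N\<close>.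
\<close>

lemma kolmogorov_maximal_inequality:
  fixes D :: "nat \<Rightarrow> 'w \<Rightarrow> real"
  assumes M: "prob_space M" and sub: "\<And>n. subalgebra M (G n)" and mono: "\<And>n. sets (G n) \<subseteq> sets (G (Suc n))"
    and D: "\<And>n. D n \<in> borel_measurable (G (Suc n))" and bd: "\<And>n \<omega>. \<bar>D n \<omega>\<bar> \<le> c n"
    and orth: "\<And>n \<Psi> C. \<Psi> \<in> borel_measurable (G n) \<Longrightarrow> (\<And>\<omega>. \<bar>\<Psi> \<omega>\<bar> \<le> C) \<Longrightarrow> (\<integral>\<omega>. \<Psi> \<omega> * D n \<omega> \<partial>M) = 0"
    and e: "\<epsilon> > 0"
  shows "measure M {\<omega>\<in>space M. \<exists>k\<le>N. \<epsilon> \<le> \<bar>\<Sum>i<k. D i \<omega>\<bar>} \<le> (\<Sum>i<N. (c i)\<^sup>2) / \<epsilon>\<^sup>2"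
proof -
  interpret prob_space M by fact
  have c0: "0 \<le> c n" for n using bd[of n undefined] abs_ge_zero order_trans by blast
  define S where "S k \<omega> = (\<Sum>i<k. D i \<omega>)" for k \<omega>
  define alive where "alive k \<omega> \<longleftrightarrow> (\<forall>j\<le>k. \<bar>S j \<omega>\<bar> < \<epsilon>)" for k \<omega>
  \<comment> \<open>the stopped sum: an increment counts only while no earlier partial sum has left the interval\<close>
  define T where "T k \<omega> = (\<Sum>i<k. of_bool (alive i \<omega>) * D i \<omega>)" for k \<omega>
  have spG: "space (G n) = space M" for n using sub[of n] by (simp add: subalgebra_def)
  have mono': "sets (G m) \<subseteq> sets (G n)" if "m \<le> n" for m n
    using lift_Suc_mono_le[of "\<lambda>n. sets (G n)", OF mono that] .
  have lift: "f \<in> borel_measurable (G n)" if "f \<in> borel_measurable (G m)" "m \<le> n" for f :: "'w \<Rightarrow> real" and m n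
    using that(1) mono'[OF that(2)] unfolding measurable_def spG by blast
  have Dm: "D i \<in> borel_measurable (G n)" if "i < n" for i n
    using lift[OF D, of i n] that by auto
  have Sm: "S k \<in> borel_measurable (G n)" if "k \<le> n" for k n
    unfolding S_def by (rule borel_measurable_sum) (use Dm that in auto)
  have am: "Measurable.pred (G n) (alive k)" if "k \<le> n" for k n
  proof -
    have "Measurable.pred (G n) (\<lambda>\<omega>. \<bar>S j \<omega>\<bar> < \<epsilon>)" if "j \<le> k" for j
    proof -
      have [measurable]: "S j \<in> borel_measurable (G n)" using Sm[of j n] \<open>k \<le> n\<close> that by simp
      show ?thesis by measurable
    qed
    then show ?thesis unfolding alive_def by measurable
  qed
  have Tm: "T k \<in> borel_measurable (G n)" if "k \<le> n" for k n
    unfolding T_def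
  proof (rule borel_measurable_sum)
    fix i assume "i \<in> {..<k}"
    then have [measurable]: "D i \<in> borel_measurable (G n)" "Measurable.pred (G n) (alive i)"
      using Dm am that by auto
    show "(\<lambda>\<omega>. of_bool (alive i \<omega>) * D i \<omega>) \<in> borel_measurable (G n)"
      unfolding of_bool_def by measurable
  qed
  have TM: "T k \<in> borel_measurable M" and DM: "D k \<in> borel_measurable M" for k
    using measurable_from_subalg[OF sub Tm[of k k]] measurable_from_subalg[OF sub D] by auto
  have aM: "Measurable.pred M (alive k)" for k
    using measurable_from_subalg[OF sub am[of k k]] by auto
  have Tbd: "\<bar>T k \<omega>\<bar> \<le> (\<Sum>i<k. c i)" for k \<omega>
    unfolding T_def by (rule order_trans[OF sum_abs], rule sum_mono) (use bd c0 in \<open>auto simp: abs_mult\<close>)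
  have int: "integrable M f" if "f \<in> borel_measurable M" "\<And>\<omega>. \<bar>f \<omega>\<bar> \<le> C" for f :: "'w \<Rightarrow> real" and C
    by (rule integrable_const_bound[where B = C]) (use that in auto)
  have C0: "0 \<le> (\<Sum>i<k. c i)" for k using c0 by (rule sum_nonneg)
  have T2: "integrable M (\<lambda>\<omega>. (T k \<omega>)\<^sup>2)" for k
    by (rule int[of _ "(\<Sum>i<k. c i)\<^sup>2"]) (use TM Tbd C0 in \<open>auto simp: abs_le_square_iff[symmetric]\<close>)
  have var: "(\<integral>\<omega>. (T k \<omega>)\<^sup>2 \<partial>M) \<le> (\<Sum>i<k. (c i)\<^sup>2)" for k
  proof (induction k)
    case (Suc k)
    let ?P = "\<lambda>\<omega>. (T k \<omega> * of_bool (alive k \<omega>)) * D k \<omega>"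
    let ?Q = "\<lambda>\<omega>. (of_bool (alive k \<omega>) * D k \<omega>)\<^sup>2"
    have bm: "(\<lambda>\<omega>. T k \<omega> * of_bool (alive k \<omega>)) \<in> borel_measurable (G k)"
      using Tm[of k k] am[of k k] unfolding of_bool_def by measurable
    have b1: "\<bar>T k \<omega> * of_bool (alive k \<omega>)\<bar> \<le> (\<Sum>i<k. c i)" for \<omega>
      using Tbd[of k \<omega>] C0[of k] by (auto simp: abs_mult)
    have [measurable]: "T k \<in> borel_measurable M" "Measurable.pred M (alive k)" "D k \<in> borel_measurable M"
      by (fact TM aM DM)+
    have iP: "integrable M ?P"
    proof (rule int)
      show "?P \<in> borel_measurable M" unfolding of_bool_def by measurable
      show "\<bar>?P \<omega>\<bar> \<le> (\<Sum>i<k. c i) * c k" for \<omega>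
        unfolding abs_mult[of _ "D k \<omega>"] by (rule mult_mono[OF b1 bd C0]) simp
    qed
    have qb: "?Q \<omega> \<le> (c k)\<^sup>2" for \<omega>
      using bd[of k \<omega>] c0[of k] by (auto simp: abs_le_square_iff[symmetric])
    have iQ: "integrable M ?Q"
    proof (rule int)
      show "?Q \<in> borel_measurable M" unfolding of_bool_def by measurable
      show "\<bar>?Q \<omega>\<bar> \<le> (c k)\<^sup>2" for \<omega> using qb by simp
    qed
    have "(\<integral>\<omega>. (T (Suc k) \<omega>)\<^sup>2 \<partial>M) = (\<integral>\<omega>. (T k \<omega>)\<^sup>2 + 2 * ?P \<omega> + ?Q \<omega> \<partial>M)"
      by (rule Bochner_Integration.integral_cong) (auto simp: T_def power2_eq_square algebra_simps)
    also have "\<dots> = (\<integral>\<omega>. (T k \<omega>)\<^sup>2 \<partial>M) + 2 * (\<integral>\<omega>. ?P \<omega> \<partial>M) + (\<integral>\<omega>. ?Q \<omega> \<partial>M)"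
      using T2 iP iQ by simp
    also have "(\<integral>\<omega>. ?P \<omega> \<partial>M) = 0"
      by (rule orth[OF bm b1])
    also have "(\<integral>\<omega>. ?Q \<omega> \<partial>M) \<le> (\<integral>\<omega>. (c k)\<^sup>2 \<partial>M)"
      by (rule integral_mono[OF iQ]) (use qb in auto)
    finally show ?case using Suc by (simp add: prob_space)
  qed (simp add: T_def)
  have stop: "(alive k \<omega> \<and> T k \<omega> = S k \<omega>) \<or> (\<epsilon> \<le> \<bar>T k \<omega>\<bar> \<and> \<not> alive k \<omega>)" for k \<omega>
  proof (induction k)
    case 0
    then show ?case using e by (simp add: alive_def T_def S_def)
  next
    case (Suc k)
    have T: "T (Suc k) \<omega> = T k \<omega> + of_bool (alive k \<omega>) * D k \<omega>" and S: "S (Suc k) \<omega> = S k \<omega> + D k \<omega>"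
      by (simp_all add: T_def S_def)
    have a: "alive (Suc k) \<omega> \<longleftrightarrow> alive k \<omega> \<and> \<bar>S (Suc k) \<omega>\<bar> < \<epsilon>" by (auto simp: alive_def le_Suc_eq)
    show ?case using Suc unfolding a T by (auto simp: S)
  qed
  have "{\<omega>\<in>space M. \<exists>k\<le>N. \<epsilon> \<le> \<bar>\<Sum>i<k. D i \<omega>\<bar>} \<subseteq> {\<omega>\<in>space M. \<epsilon>\<^sup>2 \<le> (T N \<omega>)\<^sup>2}"
  proof safe
    fix \<omega> k assume "k \<le> N" "\<epsilon> \<le> \<bar>\<Sum>i<k. D i \<omega>\<bar>"
    then have "\<not> alive N \<omega>" by (auto simp: alive_def S_def not_less)
    then have "\<epsilon> \<le> \<bar>T N \<omega>\<bar>" using stop by blast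
    then show "\<epsilon>\<^sup>2 \<le> (T N \<omega>)\<^sup>2" using e by (simp add: abs_le_square_iff[symmetric])
  qed
  then have "measure M {\<omega>\<in>space M. \<exists>k\<le>N. \<epsilon> \<le> \<bar>\<Sum>i<k. D i \<omega>\<bar>} \<le> measure M {\<omega>\<in>space M. \<epsilon>\<^sup>2 \<le> (T N \<omega>)\<^sup>2}"
    using TM by (intro finite_measure_mono) auto
  also have "\<dots> \<le> (\<integral>\<omega>. (T N \<omega>)\<^sup>2 \<partial>M) / \<epsilon>\<^sup>2"
    by (rule integral_Markov_inequality_measure[OF T2]) (use e in auto)
  also have "\<dots> \<le> (\<Sum>i<N. (c i)\<^sup>2) / \<epsilon>\<^sup>2"
    by (rule divide_right_mono[OF var]) simp
  finally show ?thesis .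
qed

text \<open>
  The maximal inequality for the sums started at \<open>m\<close> bounds the probability of a later deviation by a
  tail of a convergent series.  So almost surely the partial sums form a Cauchy sequence.
\<close>

theorem martingale_differences_converge:
  fixes D :: "nat \<Rightarrow> 'w \<Rightarrow> real"
  assumes M: "prob_space M" and sub: "\<And>n. subalgebra M (G n)" and mono: "\<And>n. sets (G n) \<subseteq> sets (G (Suc n))"
    and D: "\<And>n. D n \<in> borel_measurable (G (Suc n))" and bd: "\<And>n \<omega>. \<bar>D n \<omega>\<bar> \<le> c n"
    and orth: "\<And>n \<Psi> C. \<Psi> \<in> borel_measurable (G n) \<Longrightarrow> (\<And>\<omega>. \<bar>\<Psi> \<omega>\<bar> \<le> C) \<Longrightarrow> (\<integral>\<omega>. \<Psi> \<omega> * D n \<omega> \<partial>M) = 0"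
    and summ: "summable (\<lambda>n. (c n)\<^sup>2)"
  shows "AE \<omega> in M. convergent (\<lambda>n. \<Sum>i<n. D i \<omega>)"
proof -
  interpret prob_space M by fact
  have [measurable]: "D k \<in> borel_measurable M" for k
    using measurable_from_subalg[OF sub D] by auto
  have max_tail: "measure M {\<omega>\<in>space M. \<exists>k. \<epsilon> \<le> \<bar>\<Sum>i<k. D (i + m) \<omega>\<bar>} \<le> (\<Sum>i. (c (i + m))\<^sup>2) / \<epsilon>\<^sup>2"
    if e: "\<epsilon> > 0" for \<epsilon> m
  proof -
    let ?A = "\<lambda>N. {\<omega>\<in>space M. \<exists>k\<le>N. \<epsilon> \<le> \<bar>\<Sum>i<k. D (i + m) \<omega>\<bar>}"
    have "(\<lambda>N. measure M (?A N)) \<longlonglongrightarrow> measure M (\<Union>N. ?A N)"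
      by (rule finite_Lim_measure_incseq) (auto simp: incseq_def intro: order_trans)
    moreover have "(\<Union>N. ?A N) = {\<omega>\<in>space M. \<exists>k. \<epsilon> \<le> \<bar>\<Sum>i<k. D (i + m) \<omega>\<bar>}" by auto
    moreover have "measure M (?A N) \<le> (\<Sum>i. (c (i + m))\<^sup>2) / \<epsilon>\<^sup>2" for N
    proof -
      have "measure M (?A N) \<le> (\<Sum>i<N. (c (i + m))\<^sup>2) / \<epsilon>\<^sup>2"
        by (rule kolmogorov_maximal_inequality[where G = "\<lambda>n. G (n + m)", OF M sub])
          (use mono D bd orth e in \<open>auto intro: orth\<close>)
      also have "\<dots> \<le> (\<Sum>i. (c (i + m))\<^sup>2) / \<epsilon>\<^sup>2"
        by (intro divide_right_mono sum_le_suminf) (use summ in \<open>auto simp: summable_iff_shift[of "\<lambda>n. (c n)\<^sup>2"]\<close>)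
      finally show ?thesis .
    qed
    ultimately show ?thesis by (intro LIMSEQ_le_const2) auto
  qed
  have "AE \<omega> in M. \<exists>m. \<forall>k. \<bar>\<Sum>i<k. D (i + m) \<omega>\<bar> < 1 / real (Suc j)" for j
  proof -
    let ?e = "1 / real (Suc j)"
    let ?B = "{\<omega>\<in>space M. \<forall>m. \<exists>k. ?e \<le> \<bar>\<Sum>i<k. D (i + m) \<omega>\<bar>}"
    have le: "measure M ?B \<le> (\<Sum>i. (c (i + m))\<^sup>2) / ?e\<^sup>2" for m
    proof -
      have "measure M ?B \<le> measure M {\<omega>\<in>space M. \<exists>k. ?e \<le> \<bar>\<Sum>i<k. D (i + m) \<omega>\<bar>}"
        by (rule finite_measure_mono) auto
      also have "\<dots> \<le> (\<Sum>i. (c (i + m))\<^sup>2) / ?e\<^sup>2" by (rule max_tail) simp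
      finally show ?thesis .
    qed
    have "(\<lambda>m. (\<Sum>i. (c (i + m))\<^sup>2) / ?e\<^sup>2) \<longlonglongrightarrow> 0"
      using tendsto_divide[OF suminf_exist_split2[OF summ] tendsto_const, of "?e\<^sup>2"] by simp
    then have "measure M ?B \<le> 0" by (rule LIMSEQ_le_const) (use le in blast)
    then have "emeasure M ?B = 0" by (simp add: emeasure_eq_measure measure_le_0_iff)
    then have "AE \<omega> in M. \<omega> \<notin> ?B" by (intro AE_not_in) (auto simp: null_sets_def)
    then show ?thesis using AE_space by eventually_elim (auto simp: not_le)
  qed
  then have "AE \<omega> in M. \<forall>j. \<exists>m. \<forall>k. \<bar>\<Sum>i<k. D (i + m) \<omega>\<bar> < 1 / real (Suc j)"
    by (simp add: AE_all_countable)
  then show ?thesis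
  proof eventually_elim
    case (elim \<omega>)
    have "Cauchy (\<lambda>n. \<Sum>i<n. D i \<omega>)"
    proof (rule metric_CauchyI)
      fix e :: real assume "e > 0"
      then obtain j where j: "1 / real (Suc j) < e / 2"
        using reals_Archimedean[of "e / 2"] by (auto simp: inverse_eq_divide)
      obtain m where m: "\<And>k. \<bar>\<Sum>i<k. D (i + m) \<omega>\<bar> < 1 / real (Suc j)" using elim by blast
      have "\<bar>(\<Sum>i<n. D i \<omega>) - (\<Sum>i<m. D i \<omega>)\<bar> < e / 2" if "n \<ge> m" for n
      proof -
        have "(\<Sum>i<n. D i \<omega>) = (\<Sum>i<m. D i \<omega>) + (\<Sum>i<n - m. D (i + m) \<omega>)"
          using sum.atLeastLessThan_concat[of 0 m n "\<lambda>i. D i \<omega>"] that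
            sum.shift_bounds_nat_ivl[of "\<lambda>i. D i \<omega>" 0 m "n - m"]
          by (simp add: lessThan_atLeast0)
        then show ?thesis using m[of "n - m"] j by simp
      qed
      then have close: "dist (\<Sum>i<n. D i \<omega>) (\<Sum>i<m. D i \<omega>) < e / 2" if "n \<ge> m" for n
        using that by (simp add: dist_real_def)
      show "\<exists>K. \<forall>a\<ge>K. \<forall>b\<ge>K. dist (\<Sum>i<a. D i \<omega>) (\<Sum>i<b. D i \<omega>) < e"
        using close by (meson dist_triangle_half_l)
    qed
    then show ?case by (simp add: Cauchy_convergent_iff)
  qed
qed

section \<open>Geometry of the trees\<close>

lemma coord_axis_vec [simp]: "coord (axis_vec n) i = (if i = n then 1 else 0)"
  by (simp add: axis_vec.rep_eq)

lemma norm_axis_vec [simp]: "norm (axis_vec n) = 1"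
proof -
  have "(\<lambda>i. \<bar>coord (axis_vec n) i\<bar>) sums 1"
    using sums_single[of n "\<lambda>_. 1::real"] by (simp add: if_distrib[of abs] cong: if_cong)
  then show ?thesis unfolding norm_ell1_def by (rule sums_unique[symmetric])
qed

lemma bounded_linear_coord: "bounded_linear (\<lambda>x. coord x i)"
  by (rule bounded_linear_intro[where K = 1]) (auto intro: abs_coord_le_norm)

lemmas continuous_on_coord [continuous_intros] =
  bounded_linear.continuous_on[OF bounded_linear_coord]

lemma borel_measurable_coord [measurable]: "(\<lambda>x. coord x i) \<in> borel_measurable borel"
  by (intro borel_measurable_continuous_onI continuous_intros)

definition branch :: "(nat \<Rightarrow> real) \<Rightarrow> (nat \<Rightarrow> ell1) \<Rightarrow> nat \<Rightarrow> ell1 set" where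
  "branch a g n = {g n + x *\<^sub>R axis_vec n | x. x \<in> {0..a (Suc n)}}"

lemma finite_tree_Suc: "finite_tree a g (Suc n) = finite_tree a g n \<union> branch a g n"
  by (simp add: branch_def)

declare finite_tree.simps(2) [simp del]

lemma compact_branch: "compact (branch a g n)"
proof -
  have "branch a g n = (\<lambda>x. g n + x *\<^sub>R axis_vec n) ` {0..a (Suc n)}" by (auto simp: branch_def)
  then show ?thesis by (simp add: compact_continuous_image continuous_intros)
qed

lemma connected_branch: "connected (branch a g n)"
proof -
  have "branch a g n = (\<lambda>x. g n + x *\<^sub>R axis_vec n) ` {0..a (Suc n)}" by (auto simp: branch_def)
  then show ?thesis by (simp add: connected_continuous_image continuous_intros)
qed

lemma compact_finite_tree: "compact (finite_tree a g n)"
  by (induction n) (auto simp: finite_tree_Suc intro: compact_Un compact_branch)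

lemma finite_tree_mono: "m \<le> n \<Longrightarrow> finite_tree a g m \<subseteq> finite_tree a g n"
  by (rule lift_Suc_mono_le[of "finite_tree a g"]) (auto simp: finite_tree_Suc)

lemma branch_subset_finite_tree: "i < n \<Longrightarrow> branch a g i \<subseteq> finite_tree a g n"
  using finite_tree_mono[of "Suc i" n a g] by (auto simp: finite_tree_Suc)

lemma zero_in_finite_tree: "0 \<in> finite_tree a g n"
  using finite_tree_mono[of 0 n a g] by auto

lemma limit_tree_eq: "limit_tree a g = closure (\<Union>n. finite_tree a g n)"
proof -
  have "(\<Union>n\<in>{1..}. finite_tree a g n) = (\<Union>n. finite_tree a g n)"
  proof (intro equalityI UN_least)
    fix n
    have "finite_tree a g n \<subseteq> finite_tree a g (Suc n)" by (rule finite_tree_mono) simp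
    also have "\<dots> \<subseteq> (\<Union>n\<in>{1..}. finite_tree a g n)" by (rule UN_upper) simp
    finally show "finite_tree a g n \<subseteq> (\<Union>n\<in>{1..}. finite_tree a g n)" .
  qed (rule UN_upper, simp)
  then show ?thesis by (simp add: limit_tree_def)
qed

lemma finite_tree_subset_limit_tree: "finite_tree a g n \<subseteq> limit_tree a g"
  unfolding limit_tree_eq by (rule subset_trans[OF UN_upper[OF UNIV_I] closure_subset])

lemma closed_limit_tree: "closed (limit_tree a g)"
  by (simp add: limit_tree_def)

lemma coord_finite_tree_eq_0:
  assumes "\<And>n. g n \<in> finite_tree a g n" and "x \<in> finite_tree a g n" and "n \<le> i"
  shows "coord x i = 0"
  using assms(2,3)
proof (induction n arbitrary: x)
  case (Suc n)
  show ?case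
  proof (cases "x \<in> finite_tree a g n")
    case False
    then obtain s where "x = g n + s *\<^sub>R axis_vec n" using Suc.prems by (auto simp: finite_tree_Suc branch_def)
    then show ?thesis using Suc.IH[OF assms(1)[of n]] Suc.prems(2) by simp
  qed (use Suc in auto)
qed simp

lemma connected_finite_tree:
  assumes "\<And>n. g n \<in> finite_tree a g n" and "\<And>i. i \<ge> 1 \<Longrightarrow> a i > 0"
  shows "connected (finite_tree a g n)"
proof (induction n)
  case (Suc n)
  have "g n \<in> branch a g n"
    unfolding branch_def using assms(2)[of "Suc n"] by (auto intro!: exI[of _ 0])
  then show ?case
    unfolding finite_tree_Suc using assms(1)[of n]
    by (intro connected_Un Suc connected_branch) auto
qed simp

text \<open>
  All points of the finite trees have finite support, so \<open>x\<close> is in none of them.  Their union is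
  connected, and the tree without \<open>x\<close> lies between this union and its closure.
\<close>

lemma infinite_support_imp_leaf:
  assumes g: "\<And>n. g n \<in> finite_tree a g n" and a: "\<And>i. i \<ge> 1 \<Longrightarrow> a i > 0"
    and x: "x \<in> limit_tree a g" and inf: "\<And>n. \<exists>i\<ge>n. coord x i \<noteq> 0"
  shows "x \<in> leaves (limit_tree a g)"
proof -
  have "x \<notin> finite_tree a g n" for n
    using inf[of n] coord_finite_tree_eq_0[OF g] by blast
  then have "(\<Union>n. finite_tree a g n) \<subseteq> limit_tree a g - {x}"
    using finite_tree_subset_limit_tree by blast
  moreover have "connected (\<Union>n. finite_tree a g n)"
  proof (rule connected_Union)
    have "0 \<in> (\<Inter>n. finite_tree a g n)" using zero_in_finite_tree by blast
    then show "\<Inter>(range (finite_tree a g)) \<noteq> {}" by blast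
  qed (use connected_finite_tree[OF g a] in auto)
  moreover have "limit_tree a g - {x} \<subseteq> closure (\<Union>n. finite_tree a g n)"
    unfolding limit_tree_eq by auto
  ultimately have "connected (limit_tree a g - {x})"
    using connected_intermediate_closure by blast
  then show ?thesis using x by (simp add: leaves_def)
qed

definition truncation :: "nat \<Rightarrow> ell1 \<Rightarrow> ell1" where
  "truncation k x = (\<Sum>i<k. coord x i *\<^sub>R axis_vec i)"

lemma coord_sum: "coord (\<Sum>i\<in>I. f i) j = (\<Sum>i\<in>I. coord (f i) j)"
  by (rule linear_sum[OF bounded_linear.linear[OF bounded_linear_coord]])

lemma coord_truncation [simp]: "coord (truncation k x) i = (if i < k then coord x i else 0)"
  by (simp add: truncation_def coord_sum if_distrib[of "\<lambda>c. _ * c"] sum.delta cong: if_cong)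

lemma continuous_truncation: "continuous_on S (truncation k)"
  unfolding truncation_def by (intro continuous_intros)

lemma truncation_finite_tree:
  assumes g: "\<And>n. g n \<in> finite_tree a g n" and "x \<in> finite_tree a g n"
  shows "truncation k x \<in> finite_tree a g k"
  using assms(2)
proof (induction n arbitrary: x)
  case 0
  then have "truncation k x = 0" by (intro ell1_eqI) simp
  then show ?case by (simp add: zero_in_finite_tree)
next
  case (Suc n)
  show ?case
  proof (cases "x \<in> finite_tree a g n")
    case False
    then obtain s where s: "x = g n + s *\<^sub>R axis_vec n" using Suc.prems by (auto simp: finite_tree_Suc branch_def)
    show ?thesis
    proof (cases "n < k")
      case True
      then have "truncation k x = x"
        using coord_finite_tree_eq_0[OF g Suc.prems] by (intro ell1_eqI) auto
      then show ?thesis using Suc.prems finite_tree_mono[of "Suc n" k a g] True by auto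
    next
      case False
      then have "truncation k x = truncation k (g n)" by (intro ell1_eqI) (simp add: s)
      then show ?thesis using Suc.IH[OF g] by simp
    qed
  qed (rule Suc.IH)
qed

text \<open>
  Cutting off the coordinates from \<open>k\<close> on projects each finite tree to the compact tree with \<open>k\<close>
  segments.  By continuity this extends to the points added by the completion, which gives a hold
  on them.
\<close>

lemma truncation_limit_tree:
  assumes g: "\<And>n. g n \<in> finite_tree a g n" and "x \<in> limit_tree a g"
  shows "truncation k x \<in> finite_tree a g k"
proof -
  have "truncation k ` closure (\<Union>n. finite_tree a g n) \<subseteq> finite_tree a g k"
    by (rule image_closure_subset)
      (use truncation_finite_tree[OF g] in \<open>auto intro: continuous_truncation compact_imp_closed compact_finite_tree\<close>)
  then show ?thesis using assms(2) unfolding limit_tree_eq by auto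
qed

text \<open>
  A later segment keeps the coordinate \<open>i\<close> of the point at which it is glued.  So another point with
  coordinate \<open>t\<close> could only occur if some segment were glued exactly at \<open>x\<close>.
\<close>

lemma branch_point_unique:
  assumes g: "\<And>n. g n \<in> finite_tree a g n"
    and x: "x = g i + t *\<^sub>R axis_vec i" "t > 0" "x \<notin> range g"
    and y: "y \<in> finite_tree a g n" "coord y i = t"
  shows "y = x"
  using y
proof (induction n arbitrary: y)
  case 0
  then show ?case using x(2) by simp
next
  case (Suc n)
  show ?case
  proof (cases "y \<in> finite_tree a g n")
    case False
    then obtain s where s: "y = g n + s *\<^sub>R axis_vec n" using Suc.prems by (auto simp: finite_tree_Suc branch_def)
    show ?thesis
    proof (cases "n = i")
      case True
      then show ?thesis using s Suc.prems(2) coord_finite_tree_eq_0[OF g g, of i i] x(1) by simp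
    next
      case False
      then have "coord (g n) i = t" using s Suc.prems(2) by simp
      from Suc.IH[OF g this] show ?thesis using x(3) by auto
    qed
  qed (use Suc in auto)
qed

text \<open>
  Only \<open>x\<close> itself has \<open>i\<close>-th coordinate \<open>t\<close>; so the tree without \<open>x\<close> is split by the open conditions
  that this coordinate is smaller or larger than \<open>t\<close>.  The root and the end of the segment are on
  different sides.
\<close>

lemma branch_interior_in_skeleton:
  assumes g: "\<And>n. g n \<in> finite_tree a g n"
    and x: "x = g i + t *\<^sub>R axis_vec i" "0 < t" "t < a (Suc i)" "x \<notin> range g"
  shows "x \<in> skeleton (limit_tree a g)"
proof -
  have gi: "coord (g i) i = 0" by (rule coord_finite_tree_eq_0[OF g g]) simp
  have branch: "g i + s *\<^sub>R axis_vec i \<in> limit_tree a g" if "0 \<le> s" "s \<le> a (Suc i)" for s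
    using finite_tree_subset_limit_tree[of a g "Suc i"] that by (auto simp: finite_tree_Suc branch_def)
  have xT: "x \<in> limit_tree a g" unfolding x(1) by (rule branch) (use x in auto)
  have only: "y = x" if y: "y \<in> limit_tree a g" "coord y i = t" for y
  proof (rule ell1_eqI)
    fix j
    define k where "k = Suc (max i j)"
    have "truncation k y = x"
      by (rule branch_point_unique[OF g x(1,2,4) truncation_limit_tree[OF g y(1)]]) (use y(2) in \<open>simp add: k_def\<close>)
    then have "coord (truncation k y) j = coord x j" by simp
    moreover have "j < k" by (simp add: k_def)
    ultimately show "coord y j = coord x j" by simp
  qed
  have "\<not> connected (limit_tree a g - {x})"
  proof -
    let ?A = "{y. coord y i < t}" and ?B = "{y. t < coord y i}"
    have "open ?A" "open ?B" by (intro open_Collect_less continuous_intros)+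
    moreover have "limit_tree a g - {x} \<subseteq> ?A \<union> ?B" using only by (auto simp: not_less le_less)
    moreover have "?A \<inter> ?B \<inter> (limit_tree a g - {x}) = {}" by auto
    moreover have "0 \<in> ?A \<inter> (limit_tree a g - {x})"
    proof -
      have "coord x i = t" using gi x(1) by simp
      then have "x \<noteq> 0" using x(2) by auto
      then show ?thesis using x(2) subsetD[OF finite_tree_subset_limit_tree zero_in_finite_tree] by auto
    qed
    moreover have "g i + a (Suc i) *\<^sub>R axis_vec i \<in> ?B \<inter> (limit_tree a g - {x})"
    proof -
      have "coord (g i + a (Suc i) *\<^sub>R axis_vec i) i = a (Suc i)" "coord x i = t" using gi x(1) by simp_all
      then have "g i + a (Suc i) *\<^sub>R axis_vec i \<noteq> x" using x(3) by auto
      then show ?thesis using branch[of "a (Suc i)"] x gi by simp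
    qed
    ultimately show ?thesis unfolding connected_def by blast
  qed
  then show ?thesis using xT by (simp add: skeleton_def leaves_def)
qed

section \<open>The length measure\<close>

abbreviation unit_law :: "real measure" where
  "unit_law \<equiv> uniform_measure lborel {0<..<1}"

lemma prob_space_unit_law: "prob_space unit_law"
  by (rule prob_space_uniform_measure) auto

lemma emeasure_lborel_Icc_scaled:
  assumes c: "c > 0" and P: "{x. P x} \<in> sets (borel :: real measure)"
  shows "emeasure lborel {x\<in>{0..c}. P x} = ennreal c * emeasure unit_law {v. P (c * v)}"
proof -
  have P': "{v. P (c * v)} \<in> sets borel"
    using measurable_sets_borel[OF _ P, of "\<lambda>v. c * v"] by (simp add: vimage_def)
  have S: "{x\<in>{0..c}. P x} \<in> sets borel"
    using P by (simp add: Collect_conj_eq)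
  have "emeasure lborel {x\<in>{0..c}. P x} = (\<integral>\<^sup>+x. indicator {x\<in>{0..c}. P x} x \<partial>lborel)"
    using S by simp
  also have "\<dots> = ennreal c * (\<integral>\<^sup>+v. indicator {x\<in>{0..c}. P x} (0 + c * v) \<partial>lborel)"
    using nn_integral_real_affine[of "indicator {x\<in>{0..c}. P x}" c 0] S c by simp
  also have "(\<integral>\<^sup>+v. indicator {x\<in>{0..c}. P x} (0 + c * v) \<partial>lborel)
      = (\<integral>\<^sup>+v. indicator ({0<..<1} \<inter> {v. P (c * v)}) v \<partial>lborel)"
  proof (rule nn_integral_cong_AE)
    show "AE v in lborel. indicator {x\<in>{0..c}. P x} (0 + c * v) = (indicator ({0<..<1} \<inter> {v. P (c * v)}) v :: ennreal)"
      using AE_lborel_singleton[of 0] AE_lborel_singleton[of 1]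
      by eventually_elim (use c in \<open>auto simp: indicator_def zero_le_mult_iff\<close>)
  qed
  also have "\<dots> = emeasure unit_law {v. P (c * v)}"
    using P' by (simp add: divide_ennreal_def)
  finally show ?thesis .
qed

text \<open>
  The law of a uniform point on the segment \<open>n\<close> when it is glued at \<open>y\<close>.
\<close>

definition end_law :: "(nat \<Rightarrow> real) \<Rightarrow> nat \<Rightarrow> ell1 \<Rightarrow> ell1 measure" where
  "end_law a n y = distr unit_law borel (\<lambda>v. y + (a (Suc n) * v) *\<^sub>R axis_vec n)"

lemma measurable_branch_map: "(\<lambda>x. y + (c * x) *\<^sub>R axis_vec n) \<in> borel_measurable borel"
  by (intro borel_measurable_continuous_onI continuous_intros)

lemma prob_space_end_law: "prob_space (end_law a n y)"
  unfolding end_law_def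
  by (rule prob_space.prob_space_distr[OF prob_space_unit_law]) (simp add: measurable_branch_map)

lemma sets_end_law [simp, measurable_cong]: "sets (end_law a n y) = sets borel"
  and space_end_law [simp]: "space (end_law a n y) = UNIV"
  by (simp_all add: end_law_def)

lemma emeasure_end_law:
  assumes "B \<in> sets borel"
  shows "emeasure (end_law a n y) B = emeasure unit_law {v. y + (a (Suc n) * v) *\<^sub>R axis_vec n \<in> B}"
proof -
  have "(\<lambda>v. y + (a (Suc n) * v) *\<^sub>R axis_vec n) \<in> unit_law \<rightarrow>\<^sub>M borel" by (simp add: measurable_branch_map)
  from emeasure_distr[OF this assms] show ?thesis by (simp add: end_law_def vimage_def)
qed

lemma emeasure_branch_piece:
  assumes "a (Suc n) > 0" "B \<in> sets borel"
  shows "emeasure lborel {x \<in> {0..a (Suc n)}. y + x *\<^sub>R axis_vec n \<in> B} = ennreal (a (Suc n)) * emeasure (end_law a n y) B"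
proof -
  have "{x. y + x *\<^sub>R axis_vec n \<in> B} \<in> sets borel"
    using measurable_sets_borel[OF measurable_branch_map[of y 1 n] assms(2)] by (simp add: vimage_def)
  from emeasure_lborel_Icc_scaled[OF assms(1) this] show ?thesis using assms(2) by (simp add: emeasure_end_law)
qed

lemma measurable_end_law [measurable]: "end_law a n \<in> borel \<rightarrow>\<^sub>M prob_algebra borel"
proof -
  have c: "(\<lambda>y::ell1. unit_law) \<in> borel \<rightarrow>\<^sub>M prob_algebra borel"
    by (rule measurable_const) (auto simp: space_prob_algebra prob_space_unit_law)
  have "(\<lambda>(y, v). y + (a (Suc n) * v) *\<^sub>R axis_vec n) \<in> borel \<Otimes>\<^sub>M borel \<rightarrow>\<^sub>M borel"
    unfolding borel_prod split_beta
    by (intro borel_measurable_continuous_onI continuous_intros)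
  from measurable_distr_prob_space2[OF c this] show ?thesis by (simp add: end_law_def[abs_def])
qed

lemma sets_length_measure [simp]: "sets (length_measure a g I) = sets borel"
  and space_length_measure [simp]: "space (length_measure a g I) = UNIV"
  by (simp_all add: length_measure_def)

lemma sets_normalized_length [simp]: "sets (normalized_length a g I) = sets borel"
  and space_normalized_length [simp]: "space (normalized_length a g I) = UNIV"
  by (simp_all add: normalized_length_def)

context
  fixes a :: "nat \<Rightarrow> real"
  assumes pos: "\<And>i. i \<ge> 1 \<Longrightarrow> a i > 0"
begin

lemma emeasure_length_measure_sum:
  assumes "B \<in> sets borel"
  shows "emeasure (length_measure a g {..<n}) B = (\<Sum>i<n. ennreal (a (Suc i)) * emeasure (end_law a i (g i)) B)"
  unfolding emeasure_length_measure[OF assms] nn_integral_count_space_finite[OF finite_lessThan]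
  by (rule sum.cong[OF refl emeasure_branch_piece[OF pos assms]]) simp

lemma total_length_Suc: "total_length a (Suc n) = total_length a n + a (Suc n)"
  by (simp add: total_length_def)

lemma total_length_nonneg: "total_length a n \<ge> 0"
  unfolding total_length_def by (rule sum_nonneg) (use pos in \<open>auto intro: less_imp_le\<close>)

lemma total_length_pos: "n \<ge> 1 \<Longrightarrow> total_length a n > 0"
  unfolding total_length_def by (rule sum_pos) (use pos in auto)

lemma emeasure_end_law_UNIV [simp]: "emeasure (end_law a n y) UNIV = 1"
  using prob_space.emeasure_space_1[OF prob_space_end_law, of a n y] by simp

lemma emeasure_length_measure_UNIV: "emeasure (length_measure a g {..<n}) UNIV = ennreal (total_length a n)"
proof -
  have "emeasure (length_measure a g {..<n}) UNIV = (\<Sum>i<n. ennreal (a (Suc i)))"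
    by (simp add: emeasure_length_measure_sum)
  also have "\<dots> = ennreal (\<Sum>i<n. a (Suc i))"
    by (rule sum_ennreal) (use pos in \<open>auto intro: less_imp_le\<close>)
  also have "(\<Sum>i<n. a (Suc i)) = total_length a n"
    by (induction n) (simp_all add: total_length_def)
  finally show ?thesis .
qed

text \<open>
  The probability that the marked point jumps to the segment \<open>n\<close>.  It is also the share of this
  segment in the length of the tree with \<open>n + 1\<close> segments.
\<close>

definition glue_prob :: "nat \<Rightarrow> real" where
  "glue_prob n = a (Suc n) / total_length a (Suc n)"

lemma glue_prob_bounds: "0 < glue_prob n" "glue_prob n \<le> 1" "glue_prob 0 = 1"
  and one_minus_glue_prob: "1 - glue_prob n = total_length a n / total_length a (Suc n)"
proof -
  have p: "total_length a (Suc n) > 0" "a (Suc n) > 0" by (auto intro: total_length_pos pos)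
  show "0 < glue_prob n" using p by (simp add: glue_prob_def)
  show "glue_prob n \<le> 1" using p total_length_nonneg[of n] by (simp add: glue_prob_def total_length_Suc field_simps)
  show "glue_prob 0 = 1" using pos[of 1] by (simp add: glue_prob_def total_length_def)
  show "1 - glue_prob n = total_length a n / total_length a (Suc n)"
    using p by (simp add: glue_prob_def field_simps) (simp add: total_length_Suc)
qed

text \<open>
  Over the empty set of segments \<open>normalized_length\<close> is not a probability measure.  The unit mass at
  the root takes its place: it has weight \<open>1 - glue_prob 0 = 0\<close> in the recursion below, and it is the
  law of the marked point at time \<open>0\<close>, so that inductions can start there.
\<close>

definition tree_law :: "(nat \<Rightarrow> ell1) \<Rightarrow> nat \<Rightarrow> ell1 measure" where
  "tree_law g n = (if n = 0 then return borel 0 else normalized_length a g {..<n})"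

lemma sets_tree_law [simp, measurable_cong]: "sets (tree_law g n) = sets borel"
  and space_tree_law [simp]: "space (tree_law g n) = UNIV"
  by (simp_all add: tree_law_def)

lemma emeasure_tree_law:
  assumes "B \<in> sets borel" "n \<ge> 1"
  shows "emeasure (tree_law g n) B = emeasure (length_measure a g {..<n}) B / ennreal (total_length a n)"
  using assms by (simp add: tree_law_def normalized_length_def emeasure_length_measure_UNIV)

lemma prob_space_tree_law: "prob_space (tree_law g n)"
proof (cases "n = 0")
  case False
  have "emeasure (tree_law g n) UNIV = 1"
    using False total_length_pos[of n] by (simp add: emeasure_tree_law emeasure_length_measure_UNIV divide_ennreal)
  then show ?thesis by (intro prob_spaceI) simp
qed (simp add: tree_law_def prob_space_return)

lemma emeasure_tree_law_Suc:
  assumes B: "B \<in> sets borel"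
  shows "emeasure (tree_law g (Suc n)) B =
     ennreal (1 - glue_prob n) * emeasure (tree_law g n) B + ennreal (glue_prob n) * emeasure (end_law a n (g n)) B"
proof -
  have p: "total_length a (Suc n) > 0" "a (Suc n) > 0" by (auto intro: total_length_pos pos)
  have e: "ennreal (a (Suc n)) * E / ennreal (total_length a (Suc n)) = ennreal (glue_prob n) * E" for E
    using p by (simp add: glue_prob_def divide_ennreal[symmetric] ennreal_divide_times mult.commute)
      (metis ennreal_times_divide mult.commute)
  have "emeasure (tree_law g (Suc n)) B = emeasure (length_measure a g {..<n}) B / ennreal (total_length a (Suc n))
     + ennreal (glue_prob n) * emeasure (end_law a n (g n)) B"
    using B by (simp add: emeasure_tree_law emeasure_length_measure_sum add_divide_distrib_ennreal e)
  also have "emeasure (length_measure a g {..<n}) B / ennreal (total_length a (Suc n))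
      = ennreal (1 - glue_prob n) * emeasure (tree_law g n) B"
  proof (cases "n = 0")
    case True
    then show ?thesis using emeasure_length_measure_sum[OF B, of g n] by (simp add: glue_prob_bounds)
  next
    case False
    then have q: "total_length a n > 0" by (auto intro: total_length_pos)
    have "emeasure (length_measure a g {..<n}) B = ennreal (total_length a n) * emeasure (tree_law g n) B"
      using False B q by (simp add: emeasure_tree_law ennreal_times_divide mult.commute[of "ennreal (total_length a n)"]
          ennreal_mult_divide_eq mult_divide_eq_ennreal)
    then show ?thesis unfolding one_minus_glue_prob
      using p q by (simp add: divide_ennreal[symmetric] ennreal_divide_times mult.commute)
        (metis ennreal_times_divide mult.commute)
  qed
  finally show ?thesis .
qed

lemma tree_law_Suc:
  "tree_law g (Suc n) =
     bind (measure_pmf (bernoulli_pmf (glue_prob n))) (\<lambda>b. if b then end_law a n (g n) else tree_law g n)"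
    (is "_ = bind ?M ?K")
proof (rule measure_eqI)
  have K: "?K \<in> measure_pmf (bernoulli_pmf (glue_prob n)) \<rightarrow>\<^sub>M prob_algebra borel"
    by (auto simp: space_prob_algebra prob_space_end_law prob_space_tree_law)
  have M: "?M \<in> space (prob_algebra (count_space UNIV))"
    by (auto simp: space_prob_algebra prob_space_measure_pmf)
  have K': "?K \<in> count_space UNIV \<rightarrow>\<^sub>M prob_algebra borel"
    by (auto simp: space_prob_algebra prob_space_end_law prob_space_tree_law)
  show "sets (tree_law g (Suc n)) = sets (bind ?M ?K)"
    using sets_bind'[OF M K'] by simp
  fix B assume "B \<in> sets (tree_law g (Suc n))"
  then have B: "B \<in> sets borel" by simp
  have "emeasure (bind ?M ?K) B = (\<integral>\<^sup>+b. emeasure (?K b) B \<partial>?M)"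
    by (rule emeasure_bind_prob_algebra[OF M K' B])
  also have "\<dots> = emeasure (tree_law g (Suc n)) B"
    unfolding emeasure_tree_law_Suc[OF B]
    using glue_prob_bounds(1,2)[of n] by (subst nn_integral_bernoulli_pmf) (auto simp: mult.commute add.commute)
  finally show "emeasure (tree_law g (Suc n)) B = emeasure (bind ?M ?K) B" by simp
qed

lemma integral_tree_law_Suc:
  fixes f :: "ell1 \<Rightarrow> real"
  assumes f: "f \<in> borel_measurable borel" "\<And>x. \<bar>f x\<bar> \<le> C"
  shows "(\<integral>x. f x \<partial>tree_law g (Suc n)) =
    (\<integral>x. f x \<partial>tree_law g n) + glue_prob n * ((\<integral>x. f x \<partial>end_law a n (g n)) - (\<integral>x. f x \<partial>tree_law g n))"
proof -
  let ?M = "measure_pmf (bernoulli_pmf (glue_prob n))"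
  let ?K = "\<lambda>b. if b then end_law a n (g n) else tree_law g n"
  have "(\<integral>x. f x \<partial>tree_law g (Suc n)) = (\<integral>b. (\<integral>x. f x \<partial>?K b) \<partial>?M)"
    unfolding tree_law_Suc
  proof (rule integral_bind[OF f(1) f(2), where B' = 1])
    show "?K \<in> ?M \<rightarrow>\<^sub>M subprob_algebra borel"
      using prob_space_end_law prob_space_tree_law
      by (auto simp: space_subprob_algebra intro: prob_space_imp_subprob_space split: if_splits)
    show "AE b in ?M. emeasure (?K b) (space (?K b)) \<le> ennreal 1"
      using prob_space.emeasure_le_1[OF prob_space_end_law] prob_space.emeasure_le_1[OF prob_space_tree_law]
      by (auto intro!: AE_I2)
  qed (auto intro: measure_pmf.finite_measure_axioms)
  also have "\<dots> = glue_prob n * (\<integral>x. f x \<partial>end_law a n (g n)) + (1 - glue_prob n) * (\<integral>x. f x \<partial>tree_law g n)"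
    using glue_prob_bounds(1,2)[of n] by (subst integral_bernoulli_pmf) (auto simp: mult.commute)
  finally show ?thesis by (simp add: algebra_simps)
qed

lemma measurable_tree_law:
  assumes "\<And>k. k < n \<Longrightarrow> (\<lambda>\<omega>. g k \<omega>) \<in> borel_measurable F"
  shows "(\<lambda>\<omega>. tree_law (\<lambda>k. g k \<omega>) n) \<in> F \<rightarrow>\<^sub>M prob_algebra borel"
  using assms
proof (induction n)
  case 0
  then show ?case by (auto simp: tree_law_def space_prob_algebra prob_space_return)
next
  case (Suc n)
  have IH: "(\<lambda>\<omega>. tree_law (\<lambda>k. g k \<omega>) n) \<in> F \<rightarrow>\<^sub>M prob_algebra borel" by (rule Suc.IH) (simp add: Suc.prems)
  have E: "(\<lambda>\<omega>. end_law a n (g n \<omega>)) \<in> F \<rightarrow>\<^sub>M prob_algebra borel"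
    by (rule measurable_compose[OF Suc.prems measurable_end_law]) simp
  show ?case
  proof (rule measurable_prob_algebra_generated[where G = "sets borel" and \<Omega> = UNIV])
    show "sets borel = sigma_sets UNIV (sets (borel :: ell1 measure))"
      using sets.sigma_sets_eq[of "borel :: ell1 measure"] by simp
    show "Int_stable (sets (borel :: ell1 measure))" by (rule sets.Int_stable)
    fix B :: "ell1 set" assume B: "B \<in> sets borel"
    have m1: "(\<lambda>\<omega>. emeasure (tree_law (\<lambda>k. g k \<omega>) n) B) \<in> borel_measurable F"
      by (rule measurable_compose[OF measurable_prob_algebraD[OF IH] measurable_emeasure_subprob_algebra[OF B]])
    have m2: "(\<lambda>\<omega>. emeasure (end_law a n (g n \<omega>)) B) \<in> borel_measurable F"
      by (rule measurable_compose[OF measurable_prob_algebraD[OF E] measurable_emeasure_subprob_algebra[OF B]])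
    show "(\<lambda>\<omega>. emeasure (tree_law (\<lambda>k. g k \<omega>) (Suc n)) B) \<in> borel_measurable F"
      unfolding emeasure_tree_law_Suc[OF B] using m1 m2 by measurable
  qed (auto simp: prob_space_tree_law)
qed

lemma AE_length_measure_branch: "AE x in length_measure a g I. x \<in> (\<Union>i\<in>I. branch a g i)"
proof -
  have B: "- (\<Union>i\<in>I. branch a g i) \<in> sets borel"
    using compact_imp_closed[OF compact_branch] by (intro borel_comp sets.countable_UN'') (auto intro: borel_closed)
  have "emeasure (length_measure a g I) (- (\<Union>i\<in>I. branch a g i)) = (\<integral>\<^sup>+i. 0 \<partial>count_space I)"
    unfolding emeasure_length_measure[OF B]
  proof (rule nn_integral_cong)
    fix i assume "i \<in> space (count_space I)"
    then have "{x \<in> {0..a (Suc i)}. g i + x *\<^sub>R axis_vec i \<in> - (\<Union>i\<in>I. branch a g i)} = {}"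
      by (auto simp: branch_def)
    then show "emeasure lborel {x \<in> {0..a (Suc i)}. g i + x *\<^sub>R axis_vec i \<in> - (\<Union>i\<in>I. branch a g i)} = 0"
      by (simp only: emeasure_empty)
  qed
  then have "- (\<Union>i\<in>I. branch a g i) \<in> null_sets (length_measure a g I)"
    using B by (simp add: null_sets_def)
  from AE_not_in[OF this] show ?thesis by simp
qed

lemma length_measure_countable_null:
  assumes "countable Q"
  shows "AE x in length_measure a g I. x \<notin> Q"
proof -
  have "AE x in length_measure a g I. x \<notin> {q}" for q
  proof (rule AE_not_in)
    have "emeasure (length_measure a g I) {q} = (\<integral>\<^sup>+i. 0 \<partial>count_space I)"
    proof (subst emeasure_length_measure, simp, rule nn_integral_cong)
      fix i
      have "{x \<in> {0..a (Suc i)}. g i + x *\<^sub>R axis_vec i \<in> {q}} \<subseteq> {coord q i - coord (g i) i}" by auto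
      then have "emeasure lborel {x \<in> {0..a (Suc i)}. g i + x *\<^sub>R axis_vec i \<in> {q}} \<le> emeasure lborel {coord q i - coord (g i) i}"
        by (rule emeasure_mono) simp
      then show "emeasure lborel {x \<in> {0..a (Suc i)}. g i + x *\<^sub>R axis_vec i \<in> {q}} = 0" by simp
    qed
    then show "{q} \<in> null_sets (length_measure a g I)" by (simp add: null_sets_def)
  qed
  then have "AE x in length_measure a g I. \<forall>q\<in>Q. x \<noteq> q"
    using assms by (subst AE_ball_countable) auto
  then show ?thesis by eventually_elim auto
qed

lemma AE_normalized_length: "AE x in length_measure a g I. P x \<Longrightarrow> AE x in normalized_length a g I. P x"
proof -
  assume P: "AE x in length_measure a g I. P x"
  then obtain N where N: "N \<in> null_sets (length_measure a g I)" "{x. \<not> P x} \<subseteq> N"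
    by (auto elim: AE_E2 simp: eventually_ae_filter)
  then have "N \<in> null_sets (normalized_length a g I)"
    by (auto simp: null_sets_def normalized_length_def)
  then show ?thesis using N(2) by (intro AE_I'[of N]) auto
qed

lemma AE_tree_law_in_tree: "AE x in tree_law g n. x \<in> finite_tree a g n"
proof (cases "n = 0")
  case False
  have "AE x in normalized_length a g {..<n}. x \<in> (\<Union>i\<in>{..<n}. branch a g i)"
    by (rule AE_normalized_length[OF AE_length_measure_branch])
  then have "AE x in normalized_length a g {..<n}. x \<in> finite_tree a g n"
    by eventually_elim (use branch_subset_finite_tree in blast)
  moreover have "tree_law g n = normalized_length a g {..<n}" using False by (simp add: tree_law_def)
  ultimately show ?thesis by (simp only:)
next
  case True
  then have "tree_law g n = return borel 0" by (simp add: tree_law_def)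
  moreover have "AE x in return borel (0::ell1). x \<in> finite_tree a g n"
    using True by (subst AE_return) auto
  ultimately show ?thesis by (simp only:)
qed

text \<open>
  Gluing points and ends of segments are countably many points, hence negligible for the length
  measure; any other point of a segment is in the skeleton.
\<close>

lemma normalized_length_in_skeleton:
  assumes g: "\<And>n. g n \<in> finite_tree a g n"
  shows "AE x in normalized_length a g I. x \<in> skeleton (limit_tree a g)"
proof (rule AE_normalized_length)
  let ?Q = "range g \<union> range (\<lambda>i. g i + a (Suc i) *\<^sub>R axis_vec i)"
  have "AE x in length_measure a g I. x \<notin> ?Q"
    by (rule length_measure_countable_null) auto
  then show "AE x in length_measure a g I. x \<in> skeleton (limit_tree a g)"
    using AE_length_measure_branch
  proof eventually_elim
    case (elim x)
    then obtain i t where it: "x = g i + t *\<^sub>R axis_vec i" "0 \<le> t" "t \<le> a (Suc i)"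
      by (auto simp: branch_def)
    have "t \<noteq> 0" "t \<noteq> a (Suc i)" "x \<notin> range g" using elim(1) it(1) by auto
    with branch_interior_in_skeleton[OF g it(1)] it show ?case by auto
  qed
qed

end

section \<open>The filtration of the gluing points\<close>

text \<open>
  Used to adjoin one more variable to a \<open>\<sigma>\<close>-algebra: it is enough to check statements on
  intersections of an old event and an event of the new variable.
\<close>

lemma (in prob_space) sets_sigma_Un:
  assumes E: "E \<subseteq> Pow (space M)" and E': "E' \<subseteq> Pow (space M)"
  defines "R \<equiv> {A \<inter> D | A D. A \<in> sigma_sets (space M) E \<and> D \<in> sigma_sets (space M) E'}"
  shows "sigma_sets (space M) (E \<union> E') = sigma_sets (space M) R" and "Int_stable R" and "R \<subseteq> Pow (space M)"
    and "space M \<in> R"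
proof -
  have sE: "A \<subseteq> space M" if "A \<in> sigma_sets (space M) E" for A using sigma_sets_into_sp[OF E that] .
  show P: "R \<subseteq> Pow (space M)" using sE by (auto simp: R_def)
  have top: "space M \<in> sigma_sets (space M) X" for X by (rule sigma_sets_top)
  then show "space M \<in> R" unfolding R_def by blast
  interpret s1: sigma_algebra "space M" "sigma_sets (space M) E" by (rule sigma_algebra_sigma_sets[OF E])
  interpret s2: sigma_algebra "space M" "sigma_sets (space M) E'" by (rule sigma_algebra_sigma_sets[OF E'])
  interpret s3: sigma_algebra "space M" "sigma_sets (space M) (E \<union> E')"
    by (rule sigma_algebra_sigma_sets) (use E E' in auto)
  show "Int_stable R"
  proof (rule Int_stableI)
    fix a b assume "a \<in> R" "b \<in> R"
    then obtain A D A' D' where "a = A \<inter> D" "b = A' \<inter> D'" and m: "A \<in> sigma_sets (space M) E" "D \<in> sigma_sets (space M) E'"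
      "A' \<in> sigma_sets (space M) E" "D' \<in> sigma_sets (space M) E'" unfolding R_def by blast
    then have "a \<inter> b = (A \<inter> A') \<inter> (D \<inter> D')" by auto
    then show "a \<inter> b \<in> R" unfolding R_def using s1.Int[OF m(1,3)] s2.Int[OF m(2,4)] by blast
  qed
  show "sigma_sets (space M) (E \<union> E') = sigma_sets (space M) R"
  proof (rule antisym; rule sigma_sets_mono)
    show "E \<union> E' \<subseteq> sigma_sets (space M) R"
    proof
      fix x assume "x \<in> E \<union> E'"
      then have "x \<in> R"
      proof
        assume "x \<in> E"
        then have "x = x \<inter> space M" "x \<in> sigma_sets (space M) E" using E by auto
        then show ?thesis unfolding R_def using top by blast
      next
        assume "x \<in> E'"
        then have "x = space M \<inter> x" "x \<in> sigma_sets (space M) E'" using E' by auto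
        then show ?thesis unfolding R_def using top by blast
      qed
      then show "x \<in> sigma_sets (space M) R" by auto
    qed
    show "R \<subseteq> sigma_sets (space M) (E \<union> E')"
    proof
      fix x assume "x \<in> R"
      then obtain A D where x: "x = A \<inter> D" "A \<in> sigma_sets (space M) E" "D \<in> sigma_sets (space M) E'"
        unfolding R_def by blast
      then have "A \<in> sigma_sets (space M) (E \<union> E')" "D \<in> sigma_sets (space M) (E \<union> E')"
        using sigma_sets_mono'[of E "E \<union> E'"] sigma_sets_mono'[of E' "E \<union> E'"] by auto
      then show "x \<in> sigma_sets (space M) (E \<union> E')" unfolding x(1) by (rule s3.Int)
    qed
  qed
qed

context segment_gluing
begin

abbreviation p :: "nat \<Rightarrow> real" where "p \<equiv> glue_prob a"
abbreviation X :: "nat \<Rightarrow> 'w \<Rightarrow> ell1" where "X \<equiv> marked_point a U V"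
abbreviation \<mu>n :: "nat \<Rightarrow> 'w \<Rightarrow> ell1 measure" where "\<mu>n n \<omega> \<equiv> tree_law a (\<lambda>k. g k \<omega>) n"

text \<open>
  The event that the marked point jumps to the segment \<open>n\<close>, as a condition on \<open>U (Suc n)\<close>.  The first
  segment is always marked.
\<close>

definition mark_moves :: "nat \<Rightarrow> real \<Rightarrow> bool" where
  "mark_moves n u \<longleftrightarrow> n = 0 \<or> u \<le> p n"

lemmas glue_prob_def' = glue_prob_def[OF length_pos]

lemma X_Suc: "X (Suc n) \<omega> = (if mark_moves n (U (Suc n) \<omega>) then X n \<omega> + (a (Suc n) * V (Suc n) \<omega>) *\<^sub>R axis_vec n else X n \<omega>)"
  by (simp add: mark_moves_def glue_prob_def')

declare marked_point.simps(2) [simp del]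

lemma glue_marked': "\<omega> \<in> space M \<Longrightarrow> mark_moves n (U (Suc n) \<omega>) \<Longrightarrow> g n \<omega> = X n \<omega>"
  using glue_marked[of n \<omega>] glue_root[of \<omega>] by (cases "n = 0") (auto simp: mark_moves_def glue_prob_def')

definition hist_gen :: "nat set \<Rightarrow> nat set \<Rightarrow> 'w set set" where
  "hist_gen I K = (\<Union>i\<in>I. {U i -` B \<inter> space M | B. B \<in> sets borel}) \<union>
     (\<Union>i\<in>I. {V i -` B \<inter> space M | B. B \<in> sets borel}) \<union>
     (\<Union>k\<in>K. {g k -` B \<inter> space M | B. B \<in> sets borel})"

text \<open>
  The information in \<open>U i\<close>, \<open>V i\<close> for \<open>i \<in> I\<close> and in \<open>g k\<close> for \<open>k \<in> K\<close>.  Three kinds are used: the past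
  \<open>hist {1..n} {..<n}\<close>, the future \<open>hist {n<..} {}\<close>, and the gluing points alone \<open>hist {} {..<n}\<close>.
\<close>

definition hist :: "nat set \<Rightarrow> nat set \<Rightarrow> 'w measure" where
  "hist I K = sigma (space M) (hist_gen I K)"

lemma hist_gen_Pow: "hist_gen I K \<subseteq> Pow (space M)"
  by (auto simp: hist_gen_def)

lemma space_hist [simp]: "space (hist I K) = space M"
  and sets_hist: "sets (hist I K) = sigma_sets (space M) (hist_gen I K)"
  using hist_gen_Pow by (simp_all add: hist_def space_measure_of sets_measure_of)

lemma hist_mono: "I \<subseteq> I' \<Longrightarrow> K \<subseteq> K' \<Longrightarrow> sets (hist I K) \<subseteq> sets (hist I' K')"
  unfolding sets_hist by (rule sigma_sets_mono') (auto simp: hist_gen_def)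

lemma measurable_hist_mono:
  "f \<in> hist I K \<rightarrow>\<^sub>M N \<Longrightarrow> I \<subseteq> I' \<Longrightarrow> K \<subseteq> K' \<Longrightarrow> f \<in> hist I' K' \<rightarrow>\<^sub>M N"
  using hist_mono[of I I' K K'] unfolding measurable_def space_hist by blast

lemma U_hist: "i \<in> I \<Longrightarrow> U i \<in> borel_measurable (hist I K)"
  and V_hist: "i \<in> I \<Longrightarrow> V i \<in> borel_measurable (hist I K)"
  and g_hist: "k \<in> K \<Longrightarrow> g k \<in> borel_measurable (hist I K)"
  by (auto intro!: measurableI sigma_sets.Basic simp: sets_hist) (auto simp: hist_gen_def)

lemma hist_least:
  assumes "space F = space M" "\<And>i. i \<in> I \<Longrightarrow> U i \<in> borel_measurable F" "\<And>i. i \<in> I \<Longrightarrow> V i \<in> borel_measurable F"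
    "\<And>k. k \<in> K \<Longrightarrow> g k \<in> borel_measurable F"
  shows "sets (hist I K) \<subseteq> sets F"
proof -
  have "hist_gen I K \<subseteq> sets F"
    using measurable_sets[OF assms(2)] measurable_sets[OF assms(3)] measurable_sets[OF assms(4)]
    by (auto simp: hist_gen_def assms(1))
  from sets.sigma_sets_subset[OF this] show ?thesis by (simp add: sets_hist assms(1))
qed

lemma U_rv: "i \<ge> 1 \<Longrightarrow> U i \<in> borel_measurable M" and V_rv: "i \<ge> 1 \<Longrightarrow> V i \<in> borel_measurable M"
proof -
  have *: "\<forall>z\<in>UNIV \<times> {1..}. (case z of (b, i) \<Rightarrow> if b then U i else V i) \<in> borel_measurable M"
    using indep unfolding indep_vars_def2 by blast
  show "i \<ge> 1 \<Longrightarrow> U i \<in> borel_measurable M" "i \<ge> 1 \<Longrightarrow> V i \<in> borel_measurable M"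
    using bspec[OF *, of "(True, i)"] bspec[OF *, of "(False, i)"] by auto
qed

lemma subalgebra_hist: "I \<subseteq> {1..} \<Longrightarrow> subalgebra M (hist I K)"
  using hist_least[of M I K] U_rv V_rv glue_measurable by (auto simp: subalgebra_def)

lemma hist_gen_Un: "hist_gen (I \<union> I') (K \<union> K') = hist_gen I K \<union> hist_gen I' K'"
  by (auto simp: hist_gen_def)

lemma hist_Un:
  defines "R I K I' K' \<equiv> {A \<inter> D | A D. A \<in> sets (hist I K) \<and> D \<in> sets (hist I' K')}"
  shows "sets (hist (I \<union> I') (K \<union> K')) = sigma_sets (space M) (R I K I' K')" "Int_stable (R I K I' K')"
    "R I K I' K' \<subseteq> Pow (space M)" "space M \<in> R I K I' K'"
  using sets_sigma_Un[OF hist_gen_Pow[of I K] hist_gen_Pow[of I' K']]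
  unfolding R_def sets_hist hist_gen_Un by auto

lemma hist_single_glue: "sets (hist {} {k}) = {g k -` B \<inter> space M | B. B \<in> sets borel}"
proof
  have "{g k -` B \<inter> space M | B. B \<in> sets borel} = sets (vimage_algebra (space M) (g k) borel)"
    by (simp add: sets_vimage_algebra2)
  moreover have "sets (hist {} {k}) \<subseteq> sets (vimage_algebra (space M) (g k) borel)"
    by (rule hist_least) (auto intro: measurable_vimage_algebra1)
  ultimately show "sets (hist {} {k}) \<subseteq> {g k -` B \<inter> space M | B. B \<in> sets borel}" by simp
  show "{g k -` B \<inter> space M | B. B \<in> sets borel} \<subseteq> sets (hist {} {k})"
    unfolding sets_hist by (auto simp: hist_gen_def)
qed

lemma X_hist: "n \<le> m \<Longrightarrow> X n \<in> borel_measurable (hist {1..m} K)"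
proof (induction n)
  case 0
  have "X 0 = (\<lambda>_. 0)" by (simp add: fun_eq_iff)
  then show ?case by simp
next
  case (Suc n)
  have [measurable]: "X n \<in> borel_measurable (hist {1..m} K)" "U (Suc n) \<in> borel_measurable (hist {1..m} K)"
    "V (Suc n) \<in> borel_measurable (hist {1..m} K)"
    using Suc by (auto intro: U_hist V_hist)
  show ?case unfolding X_Suc[abs_def] mark_moves_def by measurable
qed

lemma measurable_\<mu>n: "{..<n} \<subseteq> K \<Longrightarrow> (\<lambda>\<omega>. \<mu>n n \<omega>) \<in> hist I K \<rightarrow>\<^sub>M prob_algebra borel"
  by (rule measurable_tree_law[OF length_pos]) (auto intro: g_hist)

lemma emeasure_\<mu>n_hist: "{..<n} \<subseteq> K \<Longrightarrow> B \<in> sets borel \<Longrightarrow> (\<lambda>\<omega>. emeasure (\<mu>n n \<omega>) B) \<in> borel_measurable (hist I K)"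
  by (rule measurable_compose[OF measurable_prob_algebraD[OF measurable_\<mu>n] measurable_emeasure_subprob_algebra])

text \<open>
  The conditional law of \<open>g n\<close> given all \<open>U i\<close>, \<open>V i\<close> and the earlier gluing points.  It is a function
  of the past and of \<open>U (Suc n)\<close>.
\<close>

definition glue_kernel :: "nat \<Rightarrow> 'w \<Rightarrow> ell1 measure" where
  "glue_kernel n \<omega> = (if mark_moves n (U (Suc n) \<omega>) then return borel (X n \<omega>) else \<mu>n n \<omega>)"

lemma measurable_glue_kernel: "glue_kernel n \<in> hist {1..Suc n} {..<n} \<rightarrow>\<^sub>M prob_algebra borel"
proof -
  have [measurable]: "U (Suc n) \<in> borel_measurable (hist {1..Suc n} {..<n})" by (rule U_hist) simp
  have X: "X n \<in> borel_measurable (hist {1..Suc n} {..<n})" by (rule X_hist) simp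
  show ?thesis
    unfolding glue_kernel_def[abs_def]
  proof (rule measurable_If)
    show "(\<lambda>\<omega>. return borel (X n \<omega>)) \<in> hist {1..Suc n} {..<n} \<rightarrow>\<^sub>M prob_algebra borel"
      by (rule measurable_compose[OF X measurable_return_prob_space])
    show "(\<lambda>\<omega>. \<mu>n n \<omega>) \<in> hist {1..Suc n} {..<n} \<rightarrow>\<^sub>M prob_algebra borel"
      by (rule measurable_\<mu>n) simp
    show "{\<omega> \<in> space (hist {1..Suc n} {..<n}). mark_moves n (U (Suc n) \<omega>)} \<in> sets (hist {1..Suc n} {..<n})"
      unfolding mark_moves_def by measurable
  qed
qed

lemma subalgebra_gluing_history: "subalgebra M (gluing_history M U V g n)"
  and hist_subset_gluing_history: "sets (hist {1..} {..<n}) \<subseteq> sets (gluing_history M U V g n)"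
proof -
  let ?f = "\<lambda>\<omega>. (\<lambda>i\<in>{1..}. U i \<omega>, \<lambda>i\<in>{1..}. V i \<omega>, \<lambda>k\<in>{..<n}. g k \<omega>)"
  let ?N = "PiM {1..} (\<lambda>_. borel) \<Otimes>\<^sub>M PiM {1..} (\<lambda>_. borel) \<Otimes>\<^sub>M PiM {..<n} (\<lambda>_. borel) :: ((nat \<Rightarrow> real) \<times> (nat \<Rightarrow> real) \<times> (nat \<Rightarrow> ell1)) measure"
  have f: "?f \<in> M \<rightarrow>\<^sub>M ?N"
    by (intro measurable_Pair measurable_restrict) (auto intro: U_rv V_rv glue_measurable)
  then have fs: "?f \<in> space M \<rightarrow> space ?N" by (auto dest: measurable_space)
  show "subalgebra M (gluing_history M U V g n)"
    unfolding subalgebra_def gluing_history_def sets_vimage_algebra2[OF fs]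
    using measurable_sets[OF f] by auto
  have m: "?f \<in> gluing_history M U V g n \<rightarrow>\<^sub>M ?N"
    unfolding gluing_history_def by (rule measurable_vimage_algebra1[OF fs])
  show "sets (hist {1..} {..<n}) \<subseteq> sets (gluing_history M U V g n)"
  proof (rule hist_least)
    show "space (gluing_history M U V g n) = space M" by (simp add: gluing_history_def)
    fix i :: nat assume i: "i \<in> {1..}"
    have "(\<lambda>\<omega>. fst (?f \<omega>) i) \<in> borel_measurable (gluing_history M U V g n)"
      by (rule measurable_compose[OF measurable_compose[OF m measurable_fst] measurable_component_singleton]) (fact i)
    then show "U i \<in> borel_measurable (gluing_history M U V g n)" using i by simp
    have "(\<lambda>\<omega>. fst (snd (?f \<omega>)) i) \<in> borel_measurable (gluing_history M U V g n)"
      by (rule measurable_compose[OF measurable_compose[OF measurable_compose[OF m measurable_snd] measurable_fst]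
            measurable_component_singleton]) (fact i)
    then show "V i \<in> borel_measurable (gluing_history M U V g n)" using i by simp
  next
    fix k assume k: "k \<in> {..<n}"
    have "(\<lambda>\<omega>. snd (snd (?f \<omega>)) k) \<in> borel_measurable (gluing_history M U V g n)"
      by (rule measurable_compose[OF measurable_compose[OF measurable_compose[OF m measurable_snd] measurable_snd]
            measurable_component_singleton]) (fact k)
    then show "g k \<in> borel_measurable (gluing_history M U V g n)" using k by simp
  qed
qed

text \<open>
  If the marked point jumps, \<open>g n\<close> is the marked point, which is determined by the conditioning; if it
  stays, this is the integrated form of the uniform choice of the gluing point.
\<close>

lemma glue_cond_law: "cond_law M (hist {1..} {..<n}) (g n) borel (glue_kernel n)"
  unfolding cond_law_def
proof (intro conjI ballI)
  let ?F = "hist {1..} {..<n}"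
  show sub: "subalgebra M ?F" by (rule subalgebra_hist) simp
  show "g n \<in> borel_measurable M" by (rule glue_measurable)
  show \<kappa>: "glue_kernel n \<in> ?F \<rightarrow>\<^sub>M prob_algebra borel"
    by (rule measurable_hist_mono[OF measurable_glue_kernel]) auto
  fix A and B :: "ell1 set" assume A: "A \<in> sets ?F" and B: "B \<in> sets borel"
  have AM[measurable]: "A \<in> sets M" using A sub by (auto simp: subalgebra_def)
  have [measurable]: "g n \<in> borel_measurable M" by (rule glue_measurable)
  have UF: "U (Suc n) \<in> borel_measurable ?F" by (rule U_hist) simp
  define J where "J = {\<omega>\<in>space M. mark_moves n (U (Suc n) \<omega>)}"
  have "{\<omega>\<in>space ?F. mark_moves n (U (Suc n) \<omega>)} \<in> sets ?F"
    unfolding mark_moves_def using UF by measurable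
  then have JF: "J \<in> sets ?F" by (simp add: J_def)
  then have JM[measurable]: "J \<in> sets M" using sub by (auto simp: subalgebra_def)
  have km: "(\<lambda>\<omega>. emeasure (glue_kernel n \<omega>) B) \<in> borel_measurable M"
    by (rule measurable_from_subalg[OF sub measurable_compose[OF measurable_prob_algebraD[OF \<kappa>] measurable_emeasure_subprob_algebra[OF B]]])
  have gB: "g n -` B \<inter> space M \<in> sets M" by (rule measurable_sets[OF glue_measurable B])
  have moved: "(\<integral>\<^sup>+\<omega>. indicator (A \<inter> J) \<omega> * indicator B (g n \<omega>) \<partial>M) =
      (\<integral>\<^sup>+\<omega>. indicator (A \<inter> J) \<omega> * emeasure (glue_kernel n \<omega>) B \<partial>M)"
    by (rule nn_integral_cong) (auto simp: J_def glue_kernel_def glue_marked' B indicator_def)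
  have stayed: "(\<integral>\<^sup>+\<omega>. indicator (A - J) \<omega> * indicator B (g n \<omega>) \<partial>M) =
      (\<integral>\<^sup>+\<omega>. indicator (A - J) \<omega> * emeasure (glue_kernel n \<omega>) B \<partial>M)"
  proof (cases "n = 0")
    case True
    then have "A - J = {}" using sets.sets_into_space[OF AM] by (auto simp: J_def mark_moves_def)
    then show ?thesis by (simp only:) simp
  next
    case False
    then have n1: "n \<ge> 1" by simp
    let ?H = "gluing_history M U V g n"
    interpret S: sigma_finite_subalgebra M ?H
      by (rule finite_measure_subalgebra_is_sigma_finite, unfold_locales) (rule subalgebra_gluing_history)
    have "A - J \<in> sets ?H" using A JF hist_subset_gluing_history by blast
    then have ind[measurable]: "(indicator (A - J) :: 'w \<Rightarrow> real) \<in> borel_measurable ?H" by simp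
    let ?i = "\<lambda>\<omega>. indicator B (g n \<omega>) :: real"
    have iM: "?i \<in> borel_measurable M" using B by measurable
    have ii: "integrable M (\<lambda>\<omega>. indicator (A - J) \<omega> * ?i \<omega>)"
      by (rule integrable_const_bound[where B = 1]) (use iM in \<open>auto simp: indicator_def\<close>)
    have AE: "AE \<omega> in M. indicator (A - J) \<omega> * real_cond_exp M ?H ?i \<omega> = indicator (A - J) \<omega> * measure (glue_kernel n \<omega>) B"
      using glue_uniform[OF n1 B] AE_space
      by eventually_elim (use False in \<open>auto simp: J_def glue_kernel_def mark_moves_def glue_prob_def' tree_law_def[OF length_pos] indicator_def\<close>)
    have prob: "\<omega> \<in> space M \<Longrightarrow> prob_space (glue_kernel n \<omega>)" for \<omega>
      using measurable_space[OF \<kappa>] by (simp add: space_prob_algebra)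
    have mm: "(\<lambda>\<omega>. measure (glue_kernel n \<omega>) B) \<in> borel_measurable M"
      using km unfolding measure_def by measurable
    have "(\<integral>\<^sup>+\<omega>. indicator (A - J) \<omega> * indicator B (g n \<omega>) \<partial>M) = (\<integral>\<^sup>+\<omega>. ennreal (indicator (A - J) \<omega> * ?i \<omega>) \<partial>M)"
      by (rule nn_integral_cong) (auto simp: indicator_def)
    also have "\<dots> = ennreal (\<integral>\<omega>. indicator (A - J) \<omega> * ?i \<omega> \<partial>M)"
      by (rule nn_integral_eq_integral[OF ii]) (auto simp: indicator_def)
    also have "(\<integral>\<omega>. indicator (A - J) \<omega> * ?i \<omega> \<partial>M) = (\<integral>\<omega>. indicator (A - J) \<omega> * real_cond_exp M ?H ?i \<omega> \<partial>M)"
      by (rule S.real_cond_exp_intg(2)[OF ii ind iM, symmetric])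
    also have "\<dots> = (\<integral>\<omega>. indicator (A - J) \<omega> * measure (glue_kernel n \<omega>) B \<partial>M)"
    proof (rule Bochner_Integration.integral_cong_AE[OF _ _ AE])
      show "(\<lambda>\<omega>. indicator (A - J) \<omega> * real_cond_exp M ?H ?i \<omega>) \<in> borel_measurable M"
        using measurable_from_subalg[OF subalgebra_gluing_history ind] by simp
    qed (use mm in simp)
    also have "ennreal \<dots> = (\<integral>\<^sup>+\<omega>. ennreal (indicator (A - J) \<omega> * measure (glue_kernel n \<omega>) B) \<partial>M)"
    proof (rule nn_integral_eq_integral[symmetric])
      show "integrable M (\<lambda>\<omega>. indicator (A - J) \<omega> * measure (glue_kernel n \<omega>) B)"
        by (rule integrable_const_bound[where B = 1])
          (use mm prob in \<open>auto simp: indicator_def prob_space.prob_le_1 intro!: AE_I2\<close>)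
    qed auto
    also have "\<dots> = (\<integral>\<^sup>+\<omega>. indicator (A - J) \<omega> * emeasure (glue_kernel n \<omega>) B \<partial>M)"
    proof (rule nn_integral_cong)
      fix \<omega> assume "\<omega> \<in> space M"
      then interpret K: prob_space "glue_kernel n \<omega>" by (rule prob)
      show "ennreal (indicator (A - J) \<omega> * measure (glue_kernel n \<omega>) B) = indicator (A - J) \<omega> * emeasure (glue_kernel n \<omega>) B"
        by (auto simp: indicator_def K.emeasure_eq_measure)
    qed
    finally show ?thesis .
  qed
  have "{\<omega>\<in>A. g n \<omega> \<in> B} = A \<inter> (g n -` B \<inter> space M)" using sets.sets_into_space[OF AM] by auto
  then have "emeasure M {\<omega>\<in>A. g n \<omega> \<in> B} = (\<integral>\<^sup>+\<omega>. indicator (A \<inter> (g n -` B \<inter> space M)) \<omega> \<partial>M)"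
    using gB by simp
  also have "\<dots> = (\<integral>\<^sup>+\<omega>. indicator (A \<inter> J) \<omega> * indicator B (g n \<omega>) + indicator (A - J) \<omega> * indicator B (g n \<omega>) \<partial>M)"
    by (rule nn_integral_cong) (auto simp: indicator_def)
  also have "\<dots> = (\<integral>\<^sup>+\<omega>. indicator (A \<inter> J) \<omega> * indicator B (g n \<omega>) \<partial>M) + (\<integral>\<^sup>+\<omega>. indicator (A - J) \<omega> * indicator B (g n \<omega>) \<partial>M)"
    by (rule nn_integral_add) (use B in measurable)
  also have "\<dots> = (\<integral>\<^sup>+\<omega>. indicator (A \<inter> J) \<omega> * emeasure (glue_kernel n \<omega>) B + indicator (A - J) \<omega> * emeasure (glue_kernel n \<omega>) B \<partial>M)"
    unfolding moved stayed by (rule nn_integral_add[symmetric]) (use km in measurable)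
  also have "\<dots> = (\<integral>\<^sup>+\<omega>. indicator A \<omega> * emeasure (glue_kernel n \<omega>) B \<partial>M)"
    by (rule nn_integral_cong) (auto simp: indicator_def)
  finally show "emeasure M {\<omega>\<in>A. g n \<omega> \<in> B} = (\<integral>\<^sup>+\<omega>. indicator A \<omega> * emeasure (glue_kernel n \<omega>) B \<partial>M)" .
qed

end

section \<open>Conditional laws of the marked points and of the gluing points\<close>

context segment_gluing
begin

lemma indep_blocks:
  assumes "I \<subseteq> UNIV \<times> {1..}" "I' \<subseteq> UNIV \<times> {1..}" "I \<inter> I' = {}"
  defines "E \<equiv> \<lambda>z. {(case z of (b, i) \<Rightarrow> if b then U i else V i) -` B \<inter> space M | B. B \<in> sets borel}"
  shows "indep_set (sigma_sets (space M) (\<Union>z\<in>I. E z)) (sigma_sets (space M) (\<Union>z\<in>I'. E z))"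
proof -
  let ?I = "case_bool I I'"
  have "indep_sets E (UNIV \<times> {1..})"
    using indep unfolding indep_vars_def2 E_def by blast
  then have ind: "indep_sets E (\<Union>j\<in>UNIV. ?I j)"
    by (rule indep_sets_mono_index[rotated]) (use assms(1,2) in \<open>auto simp: UNIV_bool\<close>)
  have "Int_stable (E z)" for z
    unfolding Int_stable_def E_def
  proof safe
    fix B C :: "real set" assume "B \<in> sets borel" "C \<in> sets borel"
    then show "\<exists>D. (case z of (b, i) \<Rightarrow> if b then U i else V i) -` B \<inter> space M \<inter> ((case z of (b, i) \<Rightarrow> if b then U i else V i) -` C \<inter> space M) =
      (case z of (b, i) \<Rightarrow> if b then U i else V i) -` D \<inter> space M \<and> D \<in> sets borel"
      by (intro exI[of _ "B \<inter> C"]) auto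
  qed
  then have "indep_sets (\<lambda>j. sigma_sets (space M) (\<Union>i\<in>?I j. E i)) UNIV"
    by (intro indep_sets_collect_sigma[OF ind])
      (use assms(3) in \<open>auto simp: disjoint_family_on_def split: bool.splits\<close>)
  moreover have "(\<lambda>j. sigma_sets (space M) (\<Union>i\<in>?I j. E i)) =
      case_bool (sigma_sets (space M) (\<Union>z\<in>I. E z)) (sigma_sets (space M) (\<Union>z\<in>I'. E z))"
    by (auto simp: fun_eq_iff split: bool.splits)
  ultimately show ?thesis unfolding indep_set_def by simp
qed

lemma hist_fresh_eq: "sets (hist I {}) = sigma_sets (space M)
   (\<Union>z\<in>UNIV \<times> I. {(case z of (b, i) \<Rightarrow> if b then U i else V i) -` B \<inter> space M | B. B \<in> sets borel})"
proof -
  have "(\<Union>z\<in>UNIV \<times> I. {(case z of (b, i) \<Rightarrow> if b then U i else V i) -` B \<inter> space M | B. B \<in> sets borel}) = hist_gen I {}"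
  proof (rule set_eqI)
    fix x
    have *: "(UNIV :: bool set) \<times> I = {True} \<times> I \<union> {False} \<times> I" by (auto simp: UNIV_bool)
    show "x \<in> (\<Union>z\<in>UNIV \<times> I. {(case z of (b, i) \<Rightarrow> if b then U i else V i) -` B \<inter> space M | B. B \<in> sets borel})
       \<longleftrightarrow> x \<in> hist_gen I {}"
      unfolding hist_gen_def * by auto
  qed
  then show ?thesis by (simp add: sets_hist)
qed

lemma indep_fresh: "I \<subseteq> {1..} \<Longrightarrow> I' \<subseteq> {1..} \<Longrightarrow> I \<inter> I' = {} \<Longrightarrow> indep_set (sets (hist I {})) (sets (hist I' {}))"
  unfolding hist_fresh_eq by (rule indep_blocks) auto

lemma indep_set_hist_generator:
  assumes "sets F = sigma_sets (space M) R" "Int_stable R" "I' \<subseteq> {1..}"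
    and "\<And>A C. A \<in> R \<Longrightarrow> C \<in> sets (hist I' {}) \<Longrightarrow> prob (A \<inter> C) = prob A * prob C" "R \<subseteq> events"
  shows "indep_set (sets F) (sets (hist I' {}))"
proof -
  have "sets (hist I' {}) \<subseteq> events" using subalgebra_hist[OF assms(3)] by (simp add: subalgebra_def)
  then have "indep_set R (sets (hist I' {}))" using assms by (simp add: indep_sets2_eq)
  from indep_set_sigma_sets[OF this assms(2) sets.Int_stable]
  show ?thesis using assms(1) sets.sigma_sets_eq[of "hist I' {}"] by simp
qed

text \<open>
  By induction: adjoining \<open>U (Suc n)\<close> and \<open>V (Suc n)\<close> to the past preserves independence from the later
  variables because the \<open>U i\<close>, \<open>V i\<close> are independent of each other.  Adjoining \<open>g n\<close> preserves it
  because the conditional law of \<open>g n\<close>, even given the later variables, is a function of the past and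
  of \<open>U (Suc n)\<close>.
\<close>

lemma indep_hist_tail:
  "indep_set (sets (hist {1..n} {..<n})) (sets (hist {n<..} {}))"
  "indep_set (sets (hist {1..Suc n} {..<n})) (sets (hist {Suc n<..} {}))"
proof -
  have ev: "A \<in> events" if "A \<in> sets (hist I K)" "I \<subseteq> {1..}" for A I K
    using subalgebra_hist[OF that(2), of K] that(1) by (auto simp: subalgebra_def)
  have uv: "indep_set (sets (hist {1..Suc n} {..<n})) (sets (hist {Suc n<..} {}))"
    if IH: "indep_set (sets (hist {1..n} {..<n})) (sets (hist {n<..} {}))" for n
  proof -
    have "{1..Suc n} = {1..n} \<union> {Suc n}" by auto
    then have un: "hist {1..Suc n} {..<n} = hist ({1..n} \<union> {Suc n}) ({..<n} \<union> {})" by simp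
    show ?thesis
      unfolding un
    proof (rule indep_set_hist_generator[OF hist_Un(1,2)])
      fix S C assume "S \<in> {A \<inter> D | A D. A \<in> sets (hist {1..n} {..<n}) \<and> D \<in> sets (hist {Suc n} {})}"
        and C: "C \<in> sets (hist {Suc n<..} {})"
      then obtain A D where S: "S = A \<inter> D" and A: "A \<in> sets (hist {1..n} {..<n})" and D: "D \<in> sets (hist {Suc n} {})" by blast
      have Dt: "D \<in> sets (hist {n<..} {})" using D hist_mono[of "{Suc n}" "{n<..}" "{}" "{}"] by auto
      have Ct: "C \<in> sets (hist {n<..} {})" using C hist_mono[of "{Suc n<..}" "{n<..}" "{}" "{}"] by auto
      have DC: "prob (D \<inter> C) = prob D * prob C"
        using indep_fresh[of "{Suc n}" "{Suc n<..}"] D C unfolding indep_sets2_eq by fastforce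
      have "prob (A \<inter> (D \<inter> C)) = prob A * prob (D \<inter> C)" "prob (A \<inter> D) = prob A * prob D"
        using IH A Dt sets.Int[OF Dt Ct] unfolding indep_sets2_eq by auto
      then show "prob (S \<inter> C) = prob S * prob C" unfolding S by (simp add: DC Int_assoc)
    next
      show "{A \<inter> D | A D. A \<in> sets (hist {1..n} {..<n}) \<and> D \<in> sets (hist {Suc n} {})} \<subseteq> events"
        using ev[of _ "{1..n}"] ev[of _ "{Suc n}"] by (auto intro!: sets.Int)
    qed auto
  qed
  show main: "indep_set (sets (hist {1..n} {..<n})) (sets (hist {n<..} {}))"
  proof (induction n)
    case 0
    have e: "hist_gen {1..0} {..<0} = {}" by (simp add: hist_gen_def)
    show ?case
    proof (rule indep_set_hist_generator[where R = "{}"])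
      show "sets (hist {1..0} {..<0}) = sigma_sets (space M) {}" unfolding sets_hist e ..
    qed (auto simp: Int_stable_def)
  next
    case (Suc n)
    let ?F = "hist {1..Suc n} {..<n}"
    have "{..<Suc n} = {..<n} \<union> {n}" by auto
    then have un: "hist {1..Suc n} {..<Suc n} = hist ({1..Suc n} \<union> {}) ({..<n} \<union> {n})" by simp
    show ?case
      unfolding un
    proof (rule indep_set_hist_generator[OF hist_Un(1,2)])
      fix S C assume "S \<in> {A \<inter> D | A D. A \<in> sets ?F \<and> D \<in> sets (hist {} {n})}"
        and C: "C \<in> sets (hist {Suc n<..} {})"
      then obtain A B where S: "S = A \<inter> (g n -` B \<inter> space M)" and A: "A \<in> sets ?F" and B: "B \<in> sets borel"
        unfolding hist_single_glue by blast
      have cl: "\<And>A. A \<in> sets (hist {1..} {..<n}) \<Longrightarrow>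
          emeasure M {\<omega>\<in>A. g n \<omega> \<in> B} = (\<integral>\<^sup>+\<omega>. indicator A \<omega> * emeasure (glue_kernel n \<omega>) B \<partial>M)"
        using glue_cond_law[of n] B unfolding cond_law_def by blast
      have A': "A \<in> sets (hist {1..} {..<n})" using A hist_mono[of "{1..Suc n}" "{1..}" "{..<n}" "{..<n}"] by auto
      have C': "C \<in> sets (hist {1..} {..<n})" using C hist_mono[of "{Suc n<..}" "{1..}" "{}" "{..<n}"] by fastforce
      have AM: "A \<subseteq> space M" using sets.sets_into_space[OF A] by simp
      have S1: "S = {\<omega>\<in>A. g n \<omega> \<in> B}" and S2: "S \<inter> C = {\<omega>\<in>A \<inter> C. g n \<omega> \<in> B}" using S AM by auto
      have kF: "(\<lambda>\<omega>. indicator A \<omega> * emeasure (glue_kernel n \<omega>) B) \<in> borel_measurable ?F"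
        using A measurable_compose[OF measurable_prob_algebraD[OF measurable_glue_kernel] measurable_emeasure_subprob_algebra[OF B]]
        by simp
      have "emeasure M (S \<inter> C) = (\<integral>\<^sup>+\<omega>. (indicator A \<omega> * emeasure (glue_kernel n \<omega>) B) * indicator C \<omega> \<partial>M)"
        unfolding S2 cl[OF sets.Int[OF A' C']] by (rule nn_integral_cong) (auto simp: indicator_def)
      also have "\<dots> = emeasure M S * emeasure M C"
        unfolding S1 cl[OF A'] by (rule indep_set_nn_integral[OF _ uv[OF Suc] kF C]) (rule subalgebra_hist, auto)
      finally show "prob (S \<inter> C) = prob S * prob C"
        by (simp add: emeasure_eq_measure ennreal_mult[symmetric])
    next
      show "{A \<inter> D | A D. A \<in> sets ?F \<and> D \<in> sets (hist {} {n})} \<subseteq> events"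
        using ev[of _ "{1..Suc n}"] ev[of _ "{}"] by (auto intro!: sets.Int)
    qed auto
  qed
  show "indep_set (sets (hist {1..Suc n} {..<n})) (sets (hist {Suc n<..} {}))"
    by (rule uv[OF main])
qed

lemma sets_unit_pair: "sets (unit_law \<Otimes>\<^sub>M unit_law) = sets (borel \<Otimes>\<^sub>M borel)"
  by (intro sets_pair_measure_cong) auto

lemma distr_UV: "i \<ge> 1 \<Longrightarrow> distr M (borel \<Otimes>\<^sub>M borel) (\<lambda>\<omega>. (U i \<omega>, V i \<omega>)) = unit_law \<Otimes>\<^sub>M unit_law"
proof -
  assume i: "i \<ge> 1"
  have "indep_var borel (U i) borel (V i)"
    unfolding indep_var_eq using i U_rv V_rv indep_blocks[of "{(True, i)}" "{(False, i)}"] by simp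
  then show ?thesis
    unfolding indep_var_distribution_eq using U_uniform[OF i] V_uniform[OF i] by simp
qed

lemma fresh_cond_law:
  "cond_law M (hist {1..n} {..<n}) (\<lambda>\<omega>. (U (Suc n) \<omega>, V (Suc n) \<omega>)) (borel \<Otimes>\<^sub>M borel) (\<lambda>_. unit_law \<Otimes>\<^sub>M unit_law)"
  unfolding cond_law_def
proof (intro conjI ballI)
  let ?F = "hist {1..n} {..<n}"
  let ?Y = "\<lambda>\<omega>. (U (Suc n) \<omega>, V (Suc n) \<omega>)"
  show sub: "subalgebra M ?F" by (rule subalgebra_hist) auto
  have rv: "U (Suc n) \<in> borel_measurable M" "V (Suc n) \<in> borel_measurable M" by (auto intro: U_rv V_rv)
  then show Y: "?Y \<in> M \<rightarrow>\<^sub>M borel \<Otimes>\<^sub>M borel" by simp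
  interpret pair: pair_prob_space unit_law unit_law
    by (intro pair_prob_space.intro pair_sigma_finite.intro prob_space_imp_sigma_finite prob_space_unit_law)
  show "(\<lambda>_. unit_law \<Otimes>\<^sub>M unit_law) \<in> ?F \<rightarrow>\<^sub>M prob_algebra (borel \<Otimes>\<^sub>M borel)"
    by (rule measurable_const) (simp add: space_prob_algebra sets_unit_pair pair.prob_space_axioms)
  fix A and B :: "(real \<times> real) set" assume A: "A \<in> sets ?F" and B: "B \<in> sets (borel \<Otimes>\<^sub>M borel)"
  let ?C = "?Y -` B \<inter> space M"
  have "?Y \<in> hist {n<..} {} \<rightarrow>\<^sub>M borel \<Otimes>\<^sub>M borel"
    using U_hist[of "Suc n" "{n<..}"] V_hist[of "Suc n" "{n<..}"] by simp
  from measurable_sets[OF this B] have C: "?C \<in> sets (hist {n<..} {})" by simp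
  have AM: "A \<in> sets M" using A sub by (auto simp: subalgebra_def)
  have "{\<omega>\<in>A. ?Y \<omega> \<in> B} = A \<inter> ?C" using sets.sets_into_space[OF AM] by auto
  then have "emeasure M {\<omega>\<in>A. ?Y \<omega> \<in> B} = emeasure M A * emeasure M ?C"
    using indep_hist_tail(1)[of n] A C unfolding indep_sets2_eq by (simp add: emeasure_eq_measure ennreal_mult)
  also have "emeasure M ?C = emeasure (unit_law \<Otimes>\<^sub>M unit_law) B"
    using emeasure_distr[OF Y B] distr_UV[of "Suc n"] by simp
  also have "emeasure M A * \<dots> = (\<integral>\<^sup>+\<omega>. indicator A \<omega> * emeasure (unit_law \<Otimes>\<^sub>M unit_law) B \<partial>M)"
    using AM by (simp add: nn_integral_multc)
  finally show "emeasure M {\<omega>\<in>A. ?Y \<omega> \<in> B} = (\<integral>\<^sup>+\<omega>. indicator A \<omega> * emeasure (unit_law \<Otimes>\<^sub>M unit_law) B \<partial>M)" .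
qed

lemma prob_space_M: "prob_space M" by (rule prob_space_axioms)

lemma p_bounds: "0 < p n" "p n \<le> 1" "p 0 = 1"
  by (rule glue_prob_bounds[OF length_pos], simp)+

lemma mark_moves_meas [measurable]: "Measurable.pred borel (mark_moves n)"
  unfolding mark_moves_def by measurable

lemma nn_integral_unit_mark_moves:
  "(\<integral>\<^sup>+u. (if mark_moves n u then x else y) \<partial>unit_law) = ennreal (p n) * x + ennreal (1 - p n) * y"
proof -
  have ind: "(if mark_moves n u then x else y) = x * indicator {u. mark_moves n u} u + y * indicator {u. \<not> mark_moves n u} u" for u
    by simp
  have sets: "{u. mark_moves n u} \<in> sets borel" "{u. \<not> mark_moves n u} \<in> sets borel" by measurable
  have e: "emeasure unit_law B = emeasure lborel ({0<..<1} \<inter> B)" if "B \<in> sets borel" for B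
    using that by (simp add: divide_ennreal_def)
  have "emeasure unit_law {u. mark_moves n u} = ennreal (p n)"
  proof (cases "n = 0")
    case True
    then have "{u. mark_moves n u} = UNIV" by (simp add: mark_moves_def)
    then show ?thesis using True by (subst e[OF sets(1)]) (simp add: p_bounds)
  next
    case False
    have "{0<..<1} \<inter> {u. mark_moves n u} = (if p n < 1 then {0<..p n} else {0<..<1})"
      using False p_bounds(1,2)[of n] by (auto simp: mark_moves_def)
    then show ?thesis using p_bounds(1,2)[of n] by (subst e[OF sets(1)]) auto
  qed
  moreover have "emeasure unit_law {u. \<not> mark_moves n u} = ennreal (1 - p n)"
  proof (cases "n = 0")
    case True
    then have "{u. \<not> mark_moves n u} = {}" by (simp add: mark_moves_def)
    then show ?thesis using True by (subst e[OF sets(2)]) (simp add: p_bounds)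
  next
    case False
    have "{0<..<1} \<inter> {u. \<not> mark_moves n u} = {p n<..<1}"
      using False p_bounds(1,2)[of n] by (auto simp: mark_moves_def)
    then show ?thesis using p_bounds(1,2)[of n] by (subst e[OF sets(2)]) auto
  qed
  ultimately show ?thesis
    unfolding ind using sets by (simp add: nn_integral_add nn_integral_cmult_indicator mult.commute)
qed

text \<open>
  Independence of \<open>(U (Suc n), V (Suc n))\<close> from the past, in the form in which it is used: the integrand
  depends on \<open>U (Suc n)\<close> only through the jump, and on \<open>V (Suc n)\<close> only if there is a jump.
\<close>

lemma nn_integral_fresh:
  fixes \<psi> :: "'w \<Rightarrow> real \<Rightarrow> ennreal"
  assumes \<xi>: "\<xi> \<in> borel_measurable (hist {1..n} {..<n})"
    and \<psi>: "(\<lambda>(\<omega>, v). \<psi> \<omega> v) \<in> borel_measurable (hist {1..n} {..<n} \<Otimes>\<^sub>M borel)"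
  shows "(\<integral>\<^sup>+\<omega>. (if mark_moves n (U (Suc n) \<omega>) then \<psi> \<omega> (V (Suc n) \<omega>) else \<xi> \<omega>) \<partial>M) =
     (\<integral>\<^sup>+\<omega>. ennreal (p n) * (\<integral>\<^sup>+v. \<psi> \<omega> v \<partial>unit_law) + ennreal (1 - p n) * \<xi> \<omega> \<partial>M)"
proof -
  let ?F = "hist {1..n} {..<n}"
  let ?h = "\<lambda>\<omega> z. if mark_moves n (fst z) then \<psi> \<omega> (snd z) else \<xi> \<omega>"
  have sub: "subalgebra M ?F" by (rule subalgebra_hist) auto
  interpret pair: pair_prob_space unit_law unit_law
    by (intro pair_prob_space.intro pair_sigma_finite.intro prob_space_imp_sigma_finite prob_space_unit_law)
  have [measurable]: "\<xi> \<in> borel_measurable ?F" by fact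
  have ps: "(\<lambda>x. \<psi> (fst x) (snd (snd x))) \<in> borel_measurable (?F \<Otimes>\<^sub>M (borel \<Otimes>\<^sub>M borel))"
    using measurable_compose[OF _ \<psi>, of "\<lambda>x. (fst x, snd (snd x))" "?F \<Otimes>\<^sub>M (borel \<Otimes>\<^sub>M borel)"] by simp
  have h: "(\<lambda>(\<omega>, z). ?h \<omega> z) \<in> borel_measurable (?F \<Otimes>\<^sub>M (borel \<Otimes>\<^sub>M borel))"
    unfolding split_beta
  proof (rule measurable_If)
    show "{x \<in> space (?F \<Otimes>\<^sub>M (borel \<Otimes>\<^sub>M borel)). mark_moves n (fst (snd x))} \<in> sets (?F \<Otimes>\<^sub>M (borel \<Otimes>\<^sub>M borel))"
      by measurable
  qed (use ps in measurable)
  have "(\<integral>\<^sup>+\<omega>. (if mark_moves n (U (Suc n) \<omega>) then \<psi> \<omega> (V (Suc n) \<omega>) else \<xi> \<omega>) \<partial>M) =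
     (\<integral>\<^sup>+\<omega>. (\<integral>\<^sup>+z. ?h \<omega> z \<partial>(unit_law \<Otimes>\<^sub>M unit_law)) \<partial>M)"
    using cond_law_nn_integral[OF prob_space_M fresh_cond_law h] by (simp only: fst_conv snd_conv)
  also have "\<dots> = (\<integral>\<^sup>+\<omega>. ennreal (p n) * (\<integral>\<^sup>+v. \<psi> \<omega> v \<partial>unit_law) + ennreal (1 - p n) * \<xi> \<omega> \<partial>M)"
  proof (rule nn_integral_cong)
    fix \<omega> assume w: "\<omega> \<in> space M"
    then have wF: "\<omega> \<in> space ?F" by simp
    have \<psi>v[measurable]: "\<psi> \<omega> \<in> borel_measurable borel"
      using measurable_compose[OF measurable_Pair1'[OF wF] \<psi>] by simp
    have "(\<integral>\<^sup>+z. ?h \<omega> z \<partial>(unit_law \<Otimes>\<^sub>M unit_law)) = (\<integral>\<^sup>+v. \<integral>\<^sup>+u. ?h \<omega> (u, v) \<partial>unit_law \<partial>unit_law)"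
    proof (rule pair.nn_integral_snd[symmetric])
      have "?h \<omega> \<in> borel_measurable (borel \<Otimes>\<^sub>M borel)" by measurable
      then show "?h \<omega> \<in> borel_measurable (unit_law \<Otimes>\<^sub>M unit_law)"
        by (simp add: measurable_cong_sets[OF sets_unit_pair refl])
    qed
    also have "\<dots> = (\<integral>\<^sup>+v. ennreal (p n) * \<psi> \<omega> v + ennreal (1 - p n) * \<xi> \<omega> \<partial>unit_law)"
      by (simp only: fst_conv snd_conv nn_integral_unit_mark_moves)
    also have "\<dots> = ennreal (p n) * (\<integral>\<^sup>+v. \<psi> \<omega> v \<partial>unit_law) + ennreal (1 - p n) * \<xi> \<omega>"
      by (simp add: nn_integral_add nn_integral_cmult prob_space.emeasure_space_1[OF prob_space_unit_law, simplified])
    finally show "(\<integral>\<^sup>+z. ?h \<omega> z \<partial>(unit_law \<Otimes>\<^sub>M unit_law)) =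
       ennreal (p n) * (\<integral>\<^sup>+v. \<psi> \<omega> v \<partial>unit_law) + ennreal (1 - p n) * \<xi> \<omega>" .
  qed
  finally show ?thesis .
qed

lemmas sets_\<mu>n [simp, measurable_cong] = sets_tree_law[OF length_pos]
lemmas space_\<mu>n [simp] = space_tree_law[OF length_pos]

lemma emeasure_glue_kernel:
  assumes B: "B \<in> sets borel"
  shows "emeasure (glue_kernel n \<omega>) B = (if mark_moves n (U (Suc n) \<omega>) then indicator B (X n \<omega>) else emeasure (\<mu>n n \<omega>) B)"
  using B by (simp add: glue_kernel_def)

lemma hist_glue_subset: "sets (hist {} {..<n}) \<subseteq> sets (hist {1..} {..<n})" "sets (hist {} {..<n}) \<subseteq> sets (hist {1..n} {..<n})"
  by (rule hist_mono; simp)+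

text \<open>
  With probability \<open>p n\<close>, independently of the past, \<open>g n\<close> is the marked point, and otherwise it is a
  uniform point of the tree; given the gluing points both have law \<open>\<mu>n n\<close>.
\<close>

lemma glue_cond_law_if_marked:
  assumes K1: "cond_law M (hist {} {..<n}) (X n) borel (\<lambda>\<omega>. \<mu>n n \<omega>)"
  shows "cond_law M (hist {} {..<n}) (g n) borel (\<lambda>\<omega>. \<mu>n n \<omega>)"
  unfolding cond_law_def
proof (intro conjI ballI)
  let ?G = "hist {} {..<n}"
  show sub: "subalgebra M ?G" by (rule subalgebra_hist) simp
  show "g n \<in> borel_measurable M" by (rule glue_measurable)
  show "(\<lambda>\<omega>. \<mu>n n \<omega>) \<in> ?G \<rightarrow>\<^sub>M prob_algebra borel" by (rule measurable_\<mu>n) simp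
  fix A and B :: "ell1 set" assume A: "A \<in> sets ?G" and B: "B \<in> sets borel"
  let ?F = "hist {1..n} {..<n}"
  have subF: "subalgebra M ?F" by (rule subalgebra_hist) auto
  have A': "A \<in> sets (hist {1..} {..<n})" and AF[measurable]: "A \<in> sets ?F" using A hist_glue_subset by auto
  have [measurable]: "X n \<in> borel_measurable ?F" by (rule X_hist) simp
  have [measurable]: "(\<lambda>\<omega>. emeasure (\<mu>n n \<omega>) B) \<in> borel_measurable ?F" by (rule emeasure_\<mu>n_hist[OF _ B]) simp
  let ?\<psi> = "\<lambda>\<omega> (v::real). indicator A \<omega> * indicator B (X n \<omega>) :: ennreal"
  let ?\<xi> = "\<lambda>\<omega>. indicator A \<omega> * emeasure (\<mu>n n \<omega>) B"
  have m1: "(\<lambda>\<omega>. indicator A \<omega> * indicator B (X n \<omega>) :: ennreal) \<in> borel_measurable ?F" using B by measurable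
  have m2: "?\<xi> \<in> borel_measurable ?F" by measurable
  have m3: "(\<lambda>(\<omega>, v). ?\<psi> \<omega> v) \<in> borel_measurable (?F \<Otimes>\<^sub>M borel)"
    unfolding split_beta by (rule measurable_compose[OF measurable_fst m1])
  have "emeasure M {\<omega>\<in>A. g n \<omega> \<in> B} = (\<integral>\<^sup>+\<omega>. indicator A \<omega> * emeasure (glue_kernel n \<omega>) B \<partial>M)"
    using glue_cond_law[of n] A' B unfolding cond_law_def by blast
  also have "\<dots> = (\<integral>\<^sup>+\<omega>. (if mark_moves n (U (Suc n) \<omega>) then ?\<psi> \<omega> (V (Suc n) \<omega>) else ?\<xi> \<omega>) \<partial>M)"
    by (rule nn_integral_cong) (simp add: emeasure_glue_kernel[OF B])
  also have "\<dots> = (\<integral>\<^sup>+\<omega>. ennreal (p n) * (\<integral>\<^sup>+v. ?\<psi> \<omega> v \<partial>unit_law) + ennreal (1 - p n) * ?\<xi> \<omega> \<partial>M)"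
    by (rule nn_integral_fresh[OF m2 m3])
  also have "\<dots> = (\<integral>\<^sup>+\<omega>. ennreal (p n) * (indicator A \<omega> * indicator B (X n \<omega>)) + ennreal (1 - p n) * ?\<xi> \<omega> \<partial>M)"
    by (simp add: prob_space.emeasure_space_1[OF prob_space_unit_law, simplified])
  also have "\<dots> = ennreal (p n) * (\<integral>\<^sup>+\<omega>. indicator A \<omega> * indicator B (X n \<omega>) \<partial>M) + ennreal (1 - p n) * (\<integral>\<^sup>+\<omega>. ?\<xi> \<omega> \<partial>M)"
    using measurable_from_subalg[OF subF m1] measurable_from_subalg[OF subF m2]
    by (simp add: nn_integral_add nn_integral_cmult)
  also have "(\<integral>\<^sup>+\<omega>. indicator A \<omega> * indicator B (X n \<omega>) \<partial>M) = (\<integral>\<^sup>+\<omega>. ?\<xi> \<omega> \<partial>M)"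
  proof -
    have h: "(\<lambda>(\<omega>, y). indicator A \<omega> * indicator B y :: ennreal) \<in> borel_measurable (?G \<Otimes>\<^sub>M borel)"
      using A B by measurable
    have "(\<integral>\<^sup>+\<omega>. indicator A \<omega> * indicator B (X n \<omega>) \<partial>M) = (\<integral>\<^sup>+\<omega>. \<integral>\<^sup>+y. indicator A \<omega> * indicator B y \<partial>\<mu>n n \<omega> \<partial>M)"
      by (rule cond_law_nn_integral[OF prob_space_M K1 h])
    also have "\<dots> = (\<integral>\<^sup>+\<omega>. ?\<xi> \<omega> \<partial>M)"
      by (rule nn_integral_cong) (simp add: B nn_integral_cmult_indicator)
    finally show ?thesis .
  qed
  also have "ennreal (p n) * (\<integral>\<^sup>+\<omega>. ?\<xi> \<omega> \<partial>M) + ennreal (1 - p n) * (\<integral>\<^sup>+\<omega>. ?\<xi> \<omega> \<partial>M) = (\<integral>\<^sup>+\<omega>. ?\<xi> \<omega> \<partial>M)"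
    unfolding distrib_right[symmetric] using p_bounds(1,2)[of n] by (simp add: ennreal_plus[symmetric] del: ennreal_plus)
  finally show "emeasure M {\<omega>\<in>A. g n \<omega> \<in> B} = (\<integral>\<^sup>+\<omega>. ?\<xi> \<omega> \<partial>M)" .
qed

text \<open>
  The condition is tested on the events \<open>A \<inter> {g n \<in> B'}\<close> with \<open>A\<close> depending on the first \<open>n\<close> gluing
  points.  On the left, if the marked point jumps then \<open>g n = X n\<close>, and otherwise \<open>g n\<close> is
  independent of \<open>X n\<close>; on the right, \<open>\<mu>n (Suc n)\<close> is a mixture.  Both sides become the integral
  over \<open>A\<close> of \<open>p n * (\<integral>y\<in>B'. end_law a n y B d\<mu>) + (1 - p n) * \<mu> B * \<mu> B'\<close>, where \<open>\<mu> = \<mu>n n \<omega>\<close>.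
\<close>

lemma marked_cond_law_Suc:
  assumes K1: "cond_law M (hist {} {..<n}) (X n) borel (\<lambda>\<omega>. \<mu>n n \<omega>)"
  shows "cond_law M (hist {} {..<Suc n}) (X (Suc n)) borel (\<lambda>\<omega>. \<mu>n (Suc n) \<omega>)"
proof -
  let ?G = "hist {} {..<n}" and ?F = "hist {1..n} {..<n}"
  note K2 = glue_cond_law_if_marked[OF K1]
  have "{..<Suc n} = {..<n} \<union> {n}" by auto
  then have un: "hist {} {..<Suc n} = hist ({} \<union> {}) ({..<n} \<union> {n})" by simp
  have subF: "subalgebra M ?F" and subG: "subalgebra M ?G" by (rule subalgebra_hist, auto)+
  show ?thesis
  proof (rule cond_lawI_generator[OF prob_space_M _ _ _ _ hist_Un(2)[of "{}" "{..<n}" "{}" "{n}"]])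
    show "subalgebra M (hist {} {..<Suc n})" by (rule subalgebra_hist) simp
    show "X (Suc n) \<in> borel_measurable M"
      by (rule measurable_from_subalg[OF subalgebra_hist X_hist[of "Suc n" "Suc n" "{}"]]) auto
    show "(\<lambda>\<omega>. \<mu>n (Suc n) \<omega>) \<in> hist {} {..<Suc n} \<rightarrow>\<^sub>M prob_algebra borel" by (rule measurable_\<mu>n) simp
    show "sets (hist {} {..<Suc n}) = sigma_sets (space M) {A \<inter> D | A D. A \<in> sets ?G \<and> D \<in> sets (hist {} {n})}"
      unfolding un by (rule hist_Un(1))
    show "{A \<inter> D | A D. A \<in> sets ?G \<and> D \<in> sets (hist {} {n})} \<subseteq> Pow (space M)" by (rule hist_Un(3))
    show "space M \<in> {A \<inter> D | A D. A \<in> sets ?G \<and> D \<in> sets (hist {} {n})}" by (rule hist_Un(4))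
    fix S and B :: "ell1 set"
    assume "S \<in> {A \<inter> D | A D. A \<in> sets ?G \<and> D \<in> sets (hist {} {n})}" and B: "B \<in> sets borel"
    then obtain A B' where S: "S = A \<inter> (g n -` B' \<inter> space M)" and A: "A \<in> sets ?G" and B': "B' \<in> sets borel"
      unfolding hist_single_glue by blast
    have AF[measurable]: "A \<in> sets ?F" and A1: "A \<in> sets (hist {1..} {..<n})" using A hist_glue_subset by auto
    have Asp: "A \<subseteq> space M" using sets.sets_into_space[OF A] by simp
    note B[measurable] B'[measurable]
    have Xn[measurable]: "X n \<in> borel_measurable ?F" by (rule X_hist) simp
    have mB[measurable]: "(\<lambda>\<omega>. emeasure (\<mu>n n \<omega>) B) \<in> borel_measurable ?G"
      and mB'[measurable]: "(\<lambda>\<omega>. emeasure (\<mu>n n \<omega>) B') \<in> borel_measurable ?G"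
      "(\<lambda>\<omega>. emeasure (\<mu>n n \<omega>) B') \<in> borel_measurable ?F"
      by (rule emeasure_\<mu>n_hist[OF _ B] emeasure_\<mu>n_hist[OF _ B'], simp)+
    have eB[measurable]: "(\<lambda>y. emeasure (end_law a n y) B) \<in> borel_measurable borel"
      by (rule measurable_compose[OF measurable_prob_algebraD[OF measurable_end_law] measurable_emeasure_subprob_algebra[OF B]])
    define A2 where "A2 = A \<inter> (X (Suc n) -` B \<inter> space M)"
    have "X (Suc n) \<in> borel_measurable (hist {1..} {..<n})"
      by (rule measurable_hist_mono[OF X_hist[of "Suc n" "Suc n" "{}"]]) auto
    from measurable_sets[OF this B] have A2: "A2 \<in> sets (hist {1..} {..<n})" using A1 unfolding A2_def by auto
    have s1: "{\<omega>\<in>S. X (Suc n) \<omega> \<in> B} = {\<omega>\<in>A2. g n \<omega> \<in> B'}" using Asp by (auto simp: S A2_def)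
    let ?e = "\<lambda>y (v::real). y + (a (Suc n) * v) *\<^sub>R axis_vec n"
    let ?\<psi> = "\<lambda>\<omega> (v::real). indicator A \<omega> * (indicator B' (X n \<omega>) * indicator B (?e (X n \<omega>) v)) :: ennreal"
    let ?\<xi> = "\<lambda>\<omega>. indicator A \<omega> * (indicator B (X n \<omega>) * emeasure (\<mu>n n \<omega>) B')"
    let ?h = "\<lambda>\<omega> y. indicator A \<omega> * (ennreal (p n) * (indicator B' y * emeasure (end_law a n y) B)
       + ennreal (1 - p n) * (indicator B y * emeasure (\<mu>n n \<omega>) B'))"
    let ?k = "\<lambda>\<omega> y. indicator A \<omega> * (ennreal (p n) * (indicator B' y * emeasure (end_law a n y) B)
       + ennreal (1 - p n) * (indicator B' y * emeasure (\<mu>n n \<omega>) B))"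
    have m\<xi>: "?\<xi> \<in> borel_measurable ?F" by measurable
    have e_meas: "(\<lambda>(y, v). ?e y v) \<in> borel \<Otimes>\<^sub>M borel \<rightarrow>\<^sub>M borel"
      unfolding borel_prod split_beta by (intro borel_measurable_continuous_onI continuous_intros)
    have "(\<lambda>x. ?e (X n (fst x)) (snd x)) \<in> borel_measurable (?F \<Otimes>\<^sub>M borel)"
      using measurable_compose[OF measurable_Pair[OF measurable_compose[OF measurable_fst Xn] measurable_snd] e_meas]
      by simp
    then have m\<psi>: "(\<lambda>(\<omega>, v). ?\<psi> \<omega> v) \<in> borel_measurable (?F \<Otimes>\<^sub>M borel)"
      unfolding split_beta by measurable
    have "emeasure M {\<omega>\<in>S. X (Suc n) \<omega> \<in> B} = (\<integral>\<^sup>+\<omega>. indicator A2 \<omega> * emeasure (glue_kernel n \<omega>) B' \<partial>M)"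
      unfolding s1 using glue_cond_law[of n] A2 B' unfolding cond_law_def by blast
    also have "\<dots> = (\<integral>\<^sup>+\<omega>. (if mark_moves n (U (Suc n) \<omega>) then ?\<psi> \<omega> (V (Suc n) \<omega>) else ?\<xi> \<omega>) \<partial>M)"
      by (rule nn_integral_cong) (auto simp: emeasure_glue_kernel[OF B'] A2_def X_Suc indicator_def)
    also have "\<dots> = (\<integral>\<^sup>+\<omega>. ennreal (p n) * (\<integral>\<^sup>+v. ?\<psi> \<omega> v \<partial>unit_law) + ennreal (1 - p n) * ?\<xi> \<omega> \<partial>M)"
      by (rule nn_integral_fresh[OF m\<xi> m\<psi>])
    also have "\<dots> = (\<integral>\<^sup>+\<omega>. ?h \<omega> (X n \<omega>) \<partial>M)"
    proof (rule nn_integral_cong)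
      fix \<omega>
      have em: "?e (X n \<omega>) \<in> borel_measurable borel" by (rule measurable_branch_map)
      have "(\<integral>\<^sup>+v. indicator B (?e (X n \<omega>) v) \<partial>unit_law) = (\<integral>\<^sup>+v. indicator (?e (X n \<omega>) -` B) v \<partial>unit_law)"
        by (rule nn_integral_cong) (simp add: indicator_def)
      also have "\<dots> = emeasure unit_law (?e (X n \<omega>) -` B)"
        using measurable_sets[OF em B] by (intro nn_integral_indicator) simp
      also have "\<dots> = emeasure (end_law a n (X n \<omega>)) B"
        by (simp add: emeasure_end_law[OF B] vimage_def)
      finally have "(\<integral>\<^sup>+v. ?\<psi> \<omega> v \<partial>unit_law) = indicator A \<omega> * (indicator B' (X n \<omega>) * emeasure (end_law a n (X n \<omega>)) B)"
        using em by (subst nn_integral_cmult, measurable)+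
      then show "ennreal (p n) * (\<integral>\<^sup>+v. ?\<psi> \<omega> v \<partial>unit_law) + ennreal (1 - p n) * ?\<xi> \<omega> = ?h \<omega> (X n \<omega>)"
        by (simp add: distrib_left mult_ac)
    qed
    also have "\<dots> = (\<integral>\<^sup>+\<omega>. \<integral>\<^sup>+y. ?h \<omega> y \<partial>\<mu>n n \<omega> \<partial>M)"
      by (rule cond_law_nn_integral[OF prob_space_M K1]) (use A in measurable)
    also have "\<dots> = (\<integral>\<^sup>+\<omega>. \<integral>\<^sup>+y. ?k \<omega> y \<partial>\<mu>n n \<omega> \<partial>M)"
    proof (rule nn_integral_cong)
      fix \<omega>
      have [measurable]: "(\<lambda>y. indicator B' y * emeasure (end_law a n y) B) \<in> borel_measurable (\<mu>n n \<omega>)"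
        "(indicator B :: ell1 \<Rightarrow> ennreal) \<in> borel_measurable (\<mu>n n \<omega>)" "(indicator B' :: ell1 \<Rightarrow> ennreal) \<in> borel_measurable (\<mu>n n \<omega>)"
        by (simp_all cong: measurable_cong_sets)
      have "(\<integral>\<^sup>+y. ?h \<omega> y \<partial>\<mu>n n \<omega>) = indicator A \<omega> * (ennreal (p n) * (\<integral>\<^sup>+y. indicator B' y * emeasure (end_law a n y) B \<partial>\<mu>n n \<omega>)
         + ennreal (1 - p n) * (emeasure (\<mu>n n \<omega>) B * emeasure (\<mu>n n \<omega>) B'))"
        by (simp add: nn_integral_cmult nn_integral_add nn_integral_multc)
      also have "\<dots> = (\<integral>\<^sup>+y. ?k \<omega> y \<partial>\<mu>n n \<omega>)"
        by (simp add: nn_integral_cmult nn_integral_add nn_integral_multc mult.commute)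
      finally show "(\<integral>\<^sup>+y. ?h \<omega> y \<partial>\<mu>n n \<omega>) = (\<integral>\<^sup>+y. ?k \<omega> y \<partial>\<mu>n n \<omega>)" .
    qed
    also have "\<dots> = (\<integral>\<^sup>+\<omega>. ?k \<omega> (g n \<omega>) \<partial>M)"
      by (rule cond_law_nn_integral[OF prob_space_M K2, symmetric]) (use A in measurable)
    also have "\<dots> = (\<integral>\<^sup>+\<omega>. indicator S \<omega> * emeasure (\<mu>n (Suc n) \<omega>) B \<partial>M)"
      by (rule nn_integral_cong)
        (auto simp: S emeasure_tree_law_Suc[OF length_pos B] indicator_def add.commute)
    finally show "emeasure M {\<omega>\<in>S. X (Suc n) \<omega> \<in> B} = (\<integral>\<^sup>+\<omega>. indicator S \<omega> * emeasure (\<mu>n (Suc n) \<omega>) B \<partial>M)" .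
  qed
qed

theorem marked_cond_law: "cond_law M (hist {} {..<n}) (X n) borel (\<lambda>\<omega>. \<mu>n n \<omega>)"
proof (induction n)
  case 0
  have e: "X 0 = (\<lambda>_. 0)" by (simp add: fun_eq_iff)
  have sub: "subalgebra M (hist {} {..<0})" by (rule subalgebra_hist) simp
  show ?case
    unfolding cond_law_def
  proof (intro conjI ballI)
    show "(\<lambda>\<omega>. \<mu>n 0 \<omega>) \<in> hist {} {..<0} \<rightarrow>\<^sub>M prob_algebra borel" by (rule measurable_\<mu>n) simp
    fix A and B :: "ell1 set" assume "A \<in> sets (hist {} {..<0})" "B \<in> sets borel"
    moreover from this have "A \<in> sets M" using sub by (auto simp: subalgebra_def)
    ultimately show "emeasure M {\<omega>\<in>A. X 0 \<omega> \<in> B} = (\<integral>\<^sup>+\<omega>. indicator A \<omega> * emeasure (\<mu>n 0 \<omega>) B \<partial>M)"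
      by (cases "0 \<in> B") (simp_all add: tree_law_def[OF length_pos])
  qed (use sub in \<open>simp_all add: e\<close>)
qed (rule marked_cond_law_Suc)

theorem gluing_cond_law: "cond_law M (hist {} {..<n}) (g n) borel (\<lambda>\<omega>. \<mu>n n \<omega>)"
  by (rule glue_cond_law_if_marked[OF marked_cond_law])

end

section \<open>Trees of finite total length\<close>

context
  fixes a :: "nat \<Rightarrow> real"
  assumes pos: "\<And>i. i \<ge> 1 \<Longrightarrow> a i > 0"
    and summ: "summable (\<lambda>i. a (Suc i))"
begin

lemma total_length_eq_sum: "total_length a n = (\<Sum>i<n. a (Suc i))"
  by (induction n) (simp_all add: total_length_def)

lemma emeasure_length_measure_UNIV_suminf:
  "emeasure (length_measure a g UNIV) UNIV = ennreal (\<Sum>i. a (Suc i))"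
proof -
  have "emeasure (length_measure a g UNIV) UNIV = (\<integral>\<^sup>+i. ennreal (a (Suc i)) \<partial>count_space UNIV)"
  proof (subst emeasure_length_measure, simp, rule nn_integral_cong)
    fix i
    have "{x \<in> {0..a (Suc i)}. g i + x *\<^sub>R axis_vec i \<in> UNIV} = {0..a (Suc i)}" by auto
    then show "emeasure lborel {x \<in> {0..a (Suc i)}. g i + x *\<^sub>R axis_vec i \<in> UNIV} = ennreal (a (Suc i))"
      using pos[of "Suc i"] by (simp only:) simp
  qed
  also have "\<dots> = (\<Sum>i. ennreal (a (Suc i)))" by (rule nn_integral_count_space_nat)
  also have "\<dots> = ennreal (\<Sum>i. a (Suc i))"
    by (rule suminf_ennreal2) (use pos summ in \<open>auto intro: less_imp_le\<close>)
  finally show ?thesis .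
qed

lemma suminf_length_pos: "0 < (\<Sum>i. a (Suc i))"
  by (rule suminf_pos[OF summ]) (use pos in auto)

lemma prob_space_normalized_length_UNIV: "prob_space (normalized_length a g UNIV)"
  unfolding normalized_length_def
  by (rule prob_space_uniform_measure)
    (use suminf_length_pos in \<open>simp_all add: emeasure_length_measure_UNIV_suminf\<close>)

lemma emeasure_tree_law_le:
  assumes B: "B \<in> sets borel" and n: "n \<ge> 1"
  shows "emeasure (tree_law a g n) B \<le> ennreal ((\<Sum>i. a (Suc i)) / total_length a n) * emeasure (normalized_length a g UNIV) B"
proof -
  let ?s = "\<Sum>i. a (Suc i)"
  have t: "0 < total_length a n" by (rule total_length_pos[OF pos n])
  have s: "0 < ?s" by (rule suminf_length_pos)
  have le: "emeasure (length_measure a g {..<n}) B \<le> emeasure (length_measure a g UNIV) B"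
    unfolding emeasure_length_measure[OF B]
    by (subst nn_integral_count_space_indicator[where X = "{..<n}"])
      (auto intro!: nn_integral_mono simp: indicator_def)
  have "emeasure (length_measure a g UNIV) B = ennreal ?s * emeasure (normalized_length a g UNIV) B"
    using B s by (simp add: normalized_length_def emeasure_length_measure_UNIV_suminf ennreal_times_divide
        mult_divide_eq_ennreal mult.commute[of "ennreal ?s"])
  with le have "emeasure (tree_law a g n) B \<le> ennreal ?s * emeasure (normalized_length a g UNIV) B / ennreal (total_length a n)"
    using B n by (simp add: emeasure_tree_law[OF pos] divide_right_mono_ennreal)
  also have "\<dots> = ennreal (?s / total_length a n) * emeasure (normalized_length a g UNIV) B"
    using s t by (simp add: divide_ennreal[symmetric] ennreal_times_divide mult.commute)
  finally show ?thesis .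
qed

lemma nn_integral_tree_law_le:
  fixes f :: "ell1 \<Rightarrow> ennreal"
  assumes n: "n \<ge> 1" and f: "f \<in> borel_measurable borel"
  shows "(\<integral>\<^sup>+x. f x \<partial>tree_law a g n) \<le> ennreal ((\<Sum>i. a (Suc i)) / total_length a n) * (\<integral>\<^sup>+x. f x \<partial>normalized_length a g UNIV)"
proof -
  let ?c = "ennreal ((\<Sum>i. a (Suc i)) / total_length a n)"
  have "tree_law a g n \<le> scale_measure ?c (normalized_length a g UNIV)"
    by (subst le_measure)
      (use emeasure_tree_law_le[OF _ n] in \<open>auto simp: sets_tree_law[OF pos] le_fun_def emeasure_notin_sets\<close>)
  then have "(\<integral>\<^sup>+x. f x \<partial>tree_law a g n) \<le> (\<integral>\<^sup>+x. f x \<partial>scale_measure ?c (normalized_length a g UNIV))"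
    by (intro nn_integral_mono_measure) (simp_all add: sets_tree_law[OF pos])
  also have "\<dots> = ?c * (\<integral>\<^sup>+x. f x \<partial>normalized_length a g UNIV)"
    by (rule nn_integral_scale_measure) (use f in \<open>simp cong: measurable_cong_sets\<close>)
  finally show ?thesis .
qed

text \<open>
  The domination of \<open>tree_law a g n\<close> by a multiple of the normalized length measure, with a factor
  tending to \<open>1\<close>, passes to the weak limit: \<open>\<integral>f dL\<close> is at most the integral of \<open>f\<close> against the normalized
  length measure.  The same for \<open>1 - f\<close> gives equality.
\<close>

lemma weak_limit_eq_normalized_length:
  assumes L: "prob_space L" "sets L = sets borel" and conv: "converges_weakly (tree_law a g) L"
  shows "L = normalized_length a g UNIV"
proof (rule measure_eqI_continuous_integrals[OF L prob_space_normalized_length_UNIV sets_normalized_length])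
  let ?\<nu> = "normalized_length a g UNIV"
  let ?s = "\<Sum>i. a (Suc i)"
  interpret L: prob_space L by (fact L(1))
  interpret N: prob_space ?\<nu> by (rule prob_space_normalized_length_UNIV)
  have le: "(\<integral>x. f x \<partial>L) \<le> (\<integral>x. f x \<partial>?\<nu>)" if f: "continuous_on UNIV f" "\<And>x. 0 \<le> f x" "\<And>x. f x \<le> 1" for f :: "ell1 \<Rightarrow> real"
  proof -
    have "norm (f x) \<le> 1" for x using f(2,3)[of x] by simp
    then have bd: "bounded (range f)" unfolding bounded_iff by blast
    have fm: "f \<in> borel_measurable borel" by (rule borel_measurable_continuous_onI[OF f(1)])
    have i2: "integrable ?\<nu> f"
      by (rule integrable_bounded_continuous[OF prob_space_normalized_length_UNIV sets_normalized_length f(1) bd])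
    have step: "(\<integral>x. f x \<partial>tree_law a g n) \<le> ?s / total_length a n * (\<integral>x. f x \<partial>?\<nu>)" if n: "n \<ge> 1" for n
    proof -
      have i1: "integrable (tree_law a g n) f"
        by (rule integrable_bounded_continuous[OF prob_space_tree_law[OF pos] sets_tree_law[OF pos] f(1) bd])
      have c: "0 \<le> ?s / total_length a n" using suminf_length_pos total_length_pos[of a, OF pos n] by simp
      have "ennreal (\<integral>x. f x \<partial>tree_law a g n) = (\<integral>\<^sup>+x. ennreal (f x) \<partial>tree_law a g n)"
        using i1 f(2) by (intro nn_integral_eq_integral[symmetric]) auto
      also have "\<dots> \<le> ennreal (?s / total_length a n) * (\<integral>\<^sup>+x. ennreal (f x) \<partial>?\<nu>)"
        by (rule nn_integral_tree_law_le[OF n]) (use fm in simp)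
      also have "(\<integral>\<^sup>+x. ennreal (f x) \<partial>?\<nu>) = ennreal (\<integral>x. f x \<partial>?\<nu>)"
        using i2 f(2) by (intro nn_integral_eq_integral) auto
      finally have le: "ennreal (\<integral>x. f x \<partial>tree_law a g n) \<le> ennreal (?s / total_length a n) * ennreal (\<integral>x. f x \<partial>?\<nu>)" .
      have n0: "0 \<le> (\<integral>x. f x \<partial>?\<nu>)" using f(2) by simp
      from le show ?thesis
        unfolding ennreal_mult[OF c n0, symmetric] by (subst (asm) ennreal_le_iff[OF mult_nonneg_nonneg[OF c n0]])
    qed
    have "(\<lambda>n. \<integral>x. f x \<partial>tree_law a g n) \<longlonglongrightarrow> (\<integral>x. f x \<partial>L)"
      using conv f(1) bd by (simp add: converges_weakly_def)
    moreover have "(\<lambda>n. ?s / total_length a n * (\<integral>x. f x \<partial>?\<nu>)) \<longlonglongrightarrow> ?s / ?s * (\<integral>x. f x \<partial>?\<nu>)"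
      unfolding total_length_eq_sum
      by (intro tendsto_intros summable_LIMSEQ[OF summ]) (use suminf_length_pos in simp)
    ultimately have "(\<integral>x. f x \<partial>L) \<le> ?s / ?s * (\<integral>x. f x \<partial>?\<nu>)"
      by (rule LIMSEQ_le) (use step in blast)
    then show ?thesis using suminf_length_pos by simp
  qed
  fix f :: "ell1 \<Rightarrow> real" assume f: "continuous_on UNIV f" "\<And>x. 0 \<le> f x" "\<And>x. f x \<le> 1"
  have "norm (f x) \<le> 1" for x using f(2,3)[of x] by simp
  then have bd: "bounded (range f)" unfolding bounded_iff by blast
  have i: "integrable L f" "integrable ?\<nu> f"
    by (rule integrable_bounded_continuous[OF L f(1) bd]
        integrable_bounded_continuous[OF prob_space_normalized_length_UNIV sets_normalized_length f(1) bd])+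
  have "(\<integral>x. 1 - f x \<partial>L) \<le> (\<integral>x. 1 - f x \<partial>?\<nu>)"
    by (rule le) (use f in \<open>auto intro!: continuous_on_diff continuous_on_const\<close>)
  then have "(\<integral>x. f x \<partial>?\<nu>) \<le> (\<integral>x. f x \<partial>L)" using i by (simp add: L.prob_space N.prob_space[simplified])
  with le[OF f] show "(\<integral>x. f x \<partial>L) = (\<integral>x. f x \<partial>?\<nu>)" by simp
qed

end

section \<open>Almost sure properties of the random tree\<close>

context segment_gluing
begin

abbreviation gs :: "'w \<Rightarrow> nat \<Rightarrow> ell1" where "gs \<omega> \<equiv> \<lambda>k. g k \<omega>"

lemma AE_V_in_unit_interval: "AE \<omega> in M. V i \<omega> \<in> {0<..<1}" if i: "i \<ge> 1"
proof -
  have "AE v in distr M borel (V i). v \<in> {0<..<1}"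
    unfolding V_uniform[OF i] by (rule AE_uniform_measureI) auto
  then show ?thesis by (subst (asm) AE_distr_iff) (auto intro: V_rv[OF i])
qed

text \<open>
  The tree is a random set.  Its graph is measurable as each segment is a translate of a fixed
  compact set by its gluing point.
\<close>

lemma finite_tree_graph_measurable:
  "{..<n} \<subseteq> K \<Longrightarrow> Measurable.pred (hist I K \<Otimes>\<^sub>M borel) (\<lambda>(\<omega>, y). y \<in> finite_tree a (gs \<omega>) n)"
proof (induction n)
  case 0
  have "Measurable.pred (hist I K \<Otimes>\<^sub>M borel) (\<lambda>x. snd x \<in> {0::ell1})" by measurable
  then show ?case by (simp add: split_beta')
next
  case (Suc n)
  have IH: "Measurable.pred (hist I K \<Otimes>\<^sub>M borel) (\<lambda>x. snd x \<in> finite_tree a (gs (fst x)) n)"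
    using Suc by (simp add: split_beta' lessThan_Suc)
  let ?S = "branch a (\<lambda>_. 0) n"
  have S: "?S \<in> sets borel" by (intro borel_closed compact_imp_closed compact_branch)
  have gm: "g n \<in> borel_measurable (hist I K)" by (rule g_hist) (use Suc.prems in auto)
  have "(\<lambda>x. snd x - g n (fst x)) \<in> borel_measurable (hist I K \<Otimes>\<^sub>M borel)"
    by (intro borel_measurable_diff measurable_snd measurable_compose[OF measurable_fst gm])
  from measurable_sets[OF this S]
  have "Measurable.pred (hist I K \<Otimes>\<^sub>M borel) (\<lambda>x. snd x - g n (fst x) \<in> ?S)"
    by (simp add: pred_def vimage_def Int_def conj_commute)
  moreover have "snd x - g n (fst x) \<in> ?S \<longleftrightarrow> snd x \<in> branch a (gs (fst x)) n" for x
    by (auto simp: branch_def algebra_simps)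
  ultimately have "Measurable.pred (hist I K \<Otimes>\<^sub>M borel) (\<lambda>x. snd x \<in> branch a (gs (fst x)) n)" by simp
  then show ?case using IH by (simp add: split_beta' finite_tree_Suc)
qed

text \<open>
  Given the earlier gluing points, \<open>g n\<close> has law \<open>\<mu>n n\<close>, which is carried by the tree with \<open>n\<close> segments.
\<close>

lemma AE_glued_in_tree: "AE \<omega> in M. \<forall>n. g n \<omega> \<in> finite_tree a (gs \<omega>) n"
proof (subst AE_all_countable, rule allI)
  fix n
  let ?G = "hist {} {..<n}"
  have m: "Measurable.pred (?G \<Otimes>\<^sub>M borel) (\<lambda>(\<omega>, y). y \<in> finite_tree a (gs \<omega>) n)"
    by (rule finite_tree_graph_measurable) simp
  have h: "(\<lambda>(\<omega>, y). indicator {y. y \<notin> finite_tree a (gs \<omega>) n} y :: ennreal) \<in> borel_measurable (?G \<Otimes>\<^sub>M borel)"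
  proof -
    have "(\<lambda>x. indicator {x \<in> space (?G \<Otimes>\<^sub>M borel). \<not> (\<lambda>(\<omega>, y). y \<in> finite_tree a (gs \<omega>) n) x} x :: ennreal) \<in> borel_measurable (?G \<Otimes>\<^sub>M borel)"
      using m by measurable
    then show ?thesis
      by (rule measurable_cong[THEN iffD1, rotated]) (auto simp: indicator_def)
  qed
  have meas: "(\<lambda>\<omega>. indicator {y. y \<notin> finite_tree a (gs \<omega>) n} (g n \<omega>) :: ennreal) \<in> borel_measurable M"
  proof -
    have "(\<lambda>\<omega>. (\<omega>, g n \<omega>)) \<in> M \<rightarrow>\<^sub>M ?G \<Otimes>\<^sub>M borel"
      by (intro measurable_Pair glue_measurable measurable_from_subalg[OF subalgebra_hist measurable_ident_sets]) auto
    from measurable_compose[OF this h] show ?thesis by simp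
  qed
  have "(\<integral>\<^sup>+\<omega>. indicator {y. y \<notin> finite_tree a (gs \<omega>) n} (g n \<omega>) \<partial>M) =
      (\<integral>\<^sup>+\<omega>. \<integral>\<^sup>+y. indicator {y. y \<notin> finite_tree a (gs \<omega>) n} y \<partial>\<mu>n n \<omega> \<partial>M)"
    by (rule cond_law_nn_integral[OF prob_space_M gluing_cond_law h])
  also have "\<dots> = (\<integral>\<^sup>+\<omega>. 0 \<partial>M)"
  proof (rule nn_integral_cong)
    fix \<omega>
    have "AE y in \<mu>n n \<omega>. y \<in> finite_tree a (gs \<omega>) n" by (rule AE_tree_law_in_tree[OF length_pos])
    then have "AE y in \<mu>n n \<omega>. indicator {y. y \<notin> finite_tree a (gs \<omega>) n} y = (0::ennreal)"
      by eventually_elim simp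
    then show "(\<integral>\<^sup>+y. indicator {y. y \<notin> finite_tree a (gs \<omega>) n} y \<partial>\<mu>n n \<omega>) = 0"
      by (simp add: nn_integral_0_iff_AE[symmetric] nn_integral_cong_AE)
  qed
  finally have "AE \<omega> in M. indicator {y. y \<notin> finite_tree a (gs \<omega>) n} (g n \<omega>) = (0::ennreal)"
    by (subst nn_integral_0_iff_AE[symmetric]) (use meas in auto)
  then show "AE \<omega> in M. g n \<omega> \<in> finite_tree a (gs \<omega>) n"
    by eventually_elim (simp add: indicator_eq_0_iff)
qed

lemma X_measurable: "X n \<in> borel_measurable M"
  by (rule measurable_from_subalg[OF subalgebra_hist X_hist[of n n "{}"]]) auto

lemma glue_prob_mult_length: "p n * a (Suc n) = (a (Suc n))\<^sup>2 / total_length a (Suc n)"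
  by (simp add: glue_prob_def' power2_eq_square)

lemma a_pos: "0 < a (Suc n)" by (rule length_pos) simp

text \<open>
  The marked point moves with probability \<open>p n\<close> and by at most \<open>a (Suc n)\<close>; so its expected
  displacements are summable.
\<close>

lemma AE_marked_points_converge:
  assumes H: "summable (\<lambda>i. (a (Suc i))\<^sup>2 / total_length a (Suc i))"
  shows "AE \<omega> in M. convergent (\<lambda>n. X n \<omega>)"
proof -
  let ?d = "\<lambda>n \<omega>. norm (X (Suc n) \<omega> - X n \<omega>)"
  have [measurable]: "X n \<in> borel_measurable M" for n by (rule X_measurable)
  have le: "(\<integral>\<^sup>+\<omega>. ennreal (?d n \<omega>) \<partial>M) \<le> ennreal ((a (Suc n))\<^sup>2 / total_length a (Suc n))" for n
  proof -
    have "(\<integral>\<^sup>+\<omega>. ennreal (?d n \<omega>) \<partial>M) =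
       (\<integral>\<^sup>+\<omega>. (if mark_moves n (U (Suc n) \<omega>) then ennreal (\<bar>a (Suc n) * V (Suc n) \<omega>\<bar>) else 0) \<partial>M)"
      by (rule nn_integral_cong) (simp add: X_Suc)
    also have "\<dots> = (\<integral>\<^sup>+\<omega>. ennreal (p n) * (\<integral>\<^sup>+v. ennreal (\<bar>a (Suc n) * v\<bar>) \<partial>unit_law) + ennreal (1 - p n) * 0 \<partial>M)"
      by (rule nn_integral_fresh) (simp_all add: split_beta')
    also have "\<dots> = ennreal (p n) * (\<integral>\<^sup>+v. ennreal (\<bar>a (Suc n) * v\<bar>) \<partial>unit_law)"
      by (simp add: emeasure_space_1)
    also have "(\<integral>\<^sup>+v. ennreal (\<bar>a (Suc n) * v\<bar>) \<partial>unit_law) \<le> (\<integral>\<^sup>+v. ennreal (a (Suc n)) \<partial>unit_law)"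
    proof (rule nn_integral_mono_AE)
      have "AE v in unit_law. v \<in> {0<..<1}" by (rule AE_uniform_measureI) auto
      then show "AE v in unit_law. ennreal (\<bar>a (Suc n) * v\<bar>) \<le> ennreal (a (Suc n))"
        by eventually_elim (use a_pos[of n] in \<open>auto intro!: ennreal_leI simp: abs_mult\<close>)
    qed
    also have "\<dots> = ennreal (a (Suc n))"
      by (simp add: prob_space.emeasure_space_1[OF prob_space_unit_law, simplified])
    finally have "(\<integral>\<^sup>+\<omega>. ennreal (?d n \<omega>) \<partial>M) \<le> ennreal (p n) * ennreal (a (Suc n))"
      by (simp add: mult_left_mono)
    then show ?thesis
      using p_bounds(1)[of n] a_pos[of n] by (simp add: ennreal_mult[symmetric] glue_prob_mult_length)
  qed
  have "(\<integral>\<^sup>+\<omega>. (\<Sum>n. ennreal (?d n \<omega>)) \<partial>M) = (\<Sum>n. \<integral>\<^sup>+\<omega>. ennreal (?d n \<omega>) \<partial>M)"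
    by (rule nn_integral_suminf) measurable
  also have "\<dots> \<le> (\<Sum>n. ennreal ((a (Suc n))\<^sup>2 / total_length a (Suc n)))"
    by (rule suminf_le[OF le]) auto
  also have "\<dots> = ennreal (\<Sum>n. (a (Suc n))\<^sup>2 / total_length a (Suc n))"
    by (rule suminf_ennreal2[OF _ H]) (use total_length_nonneg[OF length_pos] in simp)
  finally have "(\<integral>\<^sup>+\<omega>. (\<Sum>n. ennreal (?d n \<omega>)) \<partial>M) \<noteq> \<infinity>" by (auto simp: top_unique)
  then have "AE \<omega> in M. (\<Sum>n. ennreal (?d n \<omega>)) \<noteq> \<infinity>"
    by (intro nn_integral_PInf_AE) measurable
  then show ?thesis
  proof eventually_elim
    case (elim \<omega>)
    then have "summable (\<lambda>n. ?d n \<omega>)" by (intro summable_suminf_not_top) auto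
    then have "summable (\<lambda>n. X (Suc n) \<omega> - X n \<omega>)" by (rule summable_norm_cancel)
    then have "convergent (\<lambda>n. \<Sum>i<n. X (Suc i) \<omega> - X i \<omega>)" by (simp add: summable_iff_convergent)
    moreover have "(\<Sum>i<n. X (Suc i) \<omega> - X i \<omega>) = X n \<omega>" for n
      by (induction n) simp_all
    ultimately show ?case by simp
  qed
qed

lemma integral_end_law_close:
  fixes f :: "ell1 \<Rightarrow> real"
  assumes L: "L-lipschitz_on UNIV f" and K: "\<And>x. \<bar>f x\<bar> \<le> K"
  shows "\<bar>(\<integral>x. f x \<partial>end_law a n y) - f y\<bar> \<le> L * a (Suc n)"
proof -
  let ?e = "\<lambda>v. y + (a (Suc n) * v) *\<^sub>R axis_vec n"
  interpret u: prob_space unit_law by (rule prob_space_unit_law)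
  have L0: "0 \<le> L" by (rule lipschitz_on_nonneg[OF L])
  have fm[measurable]: "f \<in> borel_measurable borel"
    by (intro borel_measurable_continuous_onI lipschitz_on_continuous_on[OF L])
  have em[measurable]: "?e \<in> borel_measurable borel" by (rule measurable_branch_map)
  have i: "integrable unit_law (\<lambda>v. f (?e v))"
    by (rule u.integrable_const_bound[where B = K]) (use K in auto)
  have "(\<integral>x. f x \<partial>end_law a n y) - f y = (\<integral>v. f (?e v) - f y \<partial>unit_law)"
    unfolding end_law_def using i by (subst integral_distr) (simp_all add: u.prob_space[simplified])
  also have "\<bar>\<dots>\<bar> \<le> (\<integral>v. \<bar>f (?e v) - f y\<bar> \<partial>unit_law)" by (rule integral_abs_bound)
  also have "\<dots> \<le> (\<integral>v. L * a (Suc n) \<partial>unit_law)"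
  proof (rule integral_mono_AE)
    have "AE v in unit_law. v \<in> {0<..<1}" by (rule AE_uniform_measureI) auto
    then show "AE v in unit_law. \<bar>f (?e v) - f y\<bar> \<le> L * a (Suc n)"
    proof eventually_elim
      case (elim v)
      have "\<bar>f (?e v) - f y\<bar> \<le> L * dist (?e v) y" using lipschitz_onD[OF L, of "?e v" y] by (simp add: dist_real_def)
      also have "dist (?e v) y = a (Suc n) * v" using elim a_pos[of n] by (simp add: dist_norm abs_mult)
      also have "L * \<dots> \<le> L * a (Suc n)" using elim a_pos[of n] L0 by (intro mult_left_mono) auto
      finally show ?case .
    qed
  qed (use i in auto)
  finally show ?thesis by (simp add: u.prob_space[simplified])
qed

text \<open>
  One step changes the integral by \<open>D n + E n\<close>.  Here \<open>D n\<close> replaces the new segment by a mass at its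
  gluing point and is a martingale difference by \<open>gluing_cond_law\<close>; \<open>E n\<close> corrects for this and is small
  because \<open>f\<close> is Lipschitz.
\<close>

lemma AE_integrals_converge:
  fixes f :: "ell1 \<Rightarrow> real"
  assumes H: "summable (\<lambda>i. (a (Suc i))\<^sup>2 / total_length a (Suc i))" and f: "bounded_lipschitz f"
  shows "AE \<omega> in M. convergent (\<lambda>n. \<integral>x. f x \<partial>\<mu>n n \<omega>)"
proof -
  obtain K L where K: "\<And>x. \<bar>f x\<bar> \<le> K" and L: "L-lipschitz_on UNIV f"
    using f by (auto simp: bounded_lipschitz_def bounded_iff)
  have K0: "0 \<le> K" using K[of 0] by linarith
  have fm[measurable]: "f \<in> borel_measurable borel"
    by (intro borel_measurable_continuous_onI lipschitz_on_continuous_on[OF L])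
  define m where "m n \<omega> = (\<integral>x. f x \<partial>\<mu>n n \<omega>)" for n \<omega>
  have m_bd: "\<bar>m n \<omega>\<bar> \<le> K" for n \<omega>
    unfolding m_def by (rule abs_integral_le_bound[OF prob_space_tree_law[OF length_pos] sets_\<mu>n fm K])
  have m_meas: "m n \<in> borel_measurable (hist {} {..<n'})" if "n \<le> n'" for n n'
    unfolding m_def
    by (rule measurable_compose[OF measurable_prob_algebraD[OF measurable_\<mu>n] integral_measurable_subprob_algebra[OF fm]])
      (use that in auto)
  define D where "D n \<omega> = p n * (f (g n \<omega>) - m n \<omega>)" for n \<omega>
  define E where "E n \<omega> = p n * ((\<integral>x. f x \<partial>end_law a n (g n \<omega>)) - f (g n \<omega>))" for n \<omega>
  have step: "m (Suc n) \<omega> = m n \<omega> + D n \<omega> + E n \<omega>" for n \<omega>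
    unfolding m_def D_def E_def by (simp add: integral_tree_law_Suc[OF length_pos fm K] algebra_simps)
  have "AE \<omega> in M. convergent (\<lambda>n. \<Sum>i<n. D i \<omega>)"
  proof (rule martingale_differences_converge[OF prob_space_M])
    show "subalgebra M (hist {} {..<n})" for n by (rule subalgebra_hist) simp
    show "sets (hist {} {..<n}) \<subseteq> sets (hist {} {..<Suc n})" for n by (rule hist_mono) auto
    have [measurable]: "m n \<in> borel_measurable (hist {} {..<Suc n})" "g n \<in> borel_measurable (hist {} {..<Suc n})" for n
      by (auto intro: m_meas g_hist)
    show "D n \<in> borel_measurable (hist {} {..<Suc n})" for n unfolding D_def by measurable
    show "\<bar>D n \<omega>\<bar> \<le> p n * (2 * K)" for n \<omega>
    proof -
      have "\<bar>f (g n \<omega>) - m n \<omega>\<bar> \<le> 2 * K" using K[of "g n \<omega>"] m_bd[of n \<omega>] by linarith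
      then show ?thesis using p_bounds(1)[of n] by (simp add: D_def abs_mult)
    qed
    show "summable (\<lambda>n. (p n * (2 * K))\<^sup>2)"
    proof (rule summable_comparison_test'[where N = 0])
      show "summable (\<lambda>n. (4 * K\<^sup>2 / a 1) * ((a (Suc n))\<^sup>2 / total_length a (Suc n)))" by (rule summable_mult[OF H])
      fix n
      have t: "0 < a 1" "a 1 \<le> total_length a (Suc n)"
      proof -
        show "0 < a 1" by (rule length_pos) simp
        have "a 1 = (\<Sum>i\<in>{1}. a i)" by simp
        also have "\<dots> \<le> total_length a (Suc n)" unfolding total_length_def
          by (rule sum_mono2) (auto intro: less_imp_le[OF length_pos])
        finally show "a 1 \<le> total_length a (Suc n)" .
      qed
      have "(p n)\<^sup>2 = (a (Suc n))\<^sup>2 / (total_length a (Suc n) * total_length a (Suc n))"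
        by (simp add: glue_prob_def' power_divide power2_eq_square)
      also have "\<dots> \<le> (a (Suc n))\<^sup>2 / (total_length a (Suc n) * a 1)"
        using t by (intro divide_left_mono mult_left_mono mult_pos_pos) auto
      finally have "(p n)\<^sup>2 \<le> (a (Suc n))\<^sup>2 / total_length a (Suc n) / a 1" by simp
      then have "(p n)\<^sup>2 * (4 * K\<^sup>2) \<le> (a (Suc n))\<^sup>2 / total_length a (Suc n) / a 1 * (4 * K\<^sup>2)"
        by (rule mult_right_mono) simp
      then show "norm ((p n * (2 * K))\<^sup>2) \<le> (4 * K\<^sup>2 / a 1) * ((a (Suc n))\<^sup>2 / total_length a (Suc n))"
        by (simp add: power_mult_distrib mult_ac)
    qed
    fix n and \<Psi> :: "'w \<Rightarrow> real" and C assume \<Psi>: "\<Psi> \<in> borel_measurable (hist {} {..<n})" and C: "\<And>\<omega>. \<bar>\<Psi> \<omega>\<bar> \<le> C"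
    let ?h = "\<lambda>\<omega> y. \<Psi> \<omega> * (p n * (f y - m n \<omega>))"
    have [measurable]: "\<Psi> \<in> borel_measurable (hist {} {..<n})" "m n \<in> borel_measurable (hist {} {..<n})"
      using \<Psi> by (auto intro: m_meas)
    have h: "(\<lambda>(\<omega>, y). ?h \<omega> y) \<in> borel_measurable (hist {} {..<n} \<Otimes>\<^sub>M borel)" by measurable
    have hb: "\<bar>?h \<omega> y\<bar> \<le> C * (p n * (2 * K))" for \<omega> y
    proof -
      have "\<bar>f y - m n \<omega>\<bar> \<le> 2 * K" using K[of y] m_bd[of n \<omega>] by linarith
      then have "\<bar>p n * (f y - m n \<omega>)\<bar> \<le> p n * (2 * K)" using p_bounds(1)[of n] by (simp add: abs_mult)
      then show ?thesis unfolding abs_mult[of "\<Psi> \<omega>"] by (intro mult_mono C) (use C[of \<omega>] in linarith)+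
    qed
    have "(\<integral>\<omega>. \<Psi> \<omega> * D n \<omega> \<partial>M) = (\<integral>\<omega>. \<integral>y. ?h \<omega> y \<partial>\<mu>n n \<omega> \<partial>M)"
      unfolding D_def by (rule cond_law_integral[OF prob_space_M gluing_cond_law h hb])
    also have "\<dots> = (\<integral>\<omega>. 0 \<partial>M)"
    proof (rule Bochner_Integration.integral_cong[OF refl])
      fix \<omega>
      interpret t: prob_space "\<mu>n n \<omega>" by (rule prob_space_tree_law[OF length_pos])
      have "integrable (\<mu>n n \<omega>) f"
        by (rule t.integrable_const_bound[where B = K]) (use K in \<open>auto cong: measurable_cong_sets\<close>)
      then show "(\<integral>y. ?h \<omega> y \<partial>\<mu>n n \<omega>) = 0"
        by (simp add: t.prob_space[simplified] m_def)
    qed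
    finally show "(\<integral>\<omega>. \<Psi> \<omega> * D n \<omega> \<partial>M) = 0" by simp
  qed
  then show ?thesis
  proof eventually_elim
    case (elim \<omega>)
    have "summable (\<lambda>n. E n \<omega>)"
    proof (rule summable_comparison_test'[where N = 0])
      show "summable (\<lambda>n. L * ((a (Suc n))\<^sup>2 / total_length a (Suc n)))" by (rule summable_mult[OF H])
      fix n
      have "norm (E n \<omega>) \<le> p n * (L * a (Suc n))"
        unfolding E_def real_norm_def abs_mult using p_bounds(1)[of n] integral_end_law_close[OF L K, of n "g n \<omega>"] by simp
      then show "norm (E n \<omega>) \<le> L * ((a (Suc n))\<^sup>2 / total_length a (Suc n))"
        unfolding glue_prob_mult_length[symmetric] by (simp add: mult_ac)
    qed
    then have "convergent (\<lambda>n. \<Sum>i<n. E i \<omega>)" by (simp add: summable_iff_convergent)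
    with elim have "convergent (\<lambda>n. m 0 \<omega> + ((\<Sum>i<n. D i \<omega>) + (\<Sum>i<n. E i \<omega>)))"
      by (intro convergent_add convergent_const)
    moreover have "m 0 \<omega> + ((\<Sum>i<n. D i \<omega>) + (\<Sum>i<n. E i \<omega>)) = m n \<omega>" for n
      by (induction n) (simp_all add: step)
    ultimately show ?case unfolding m_def by simp
  qed
qed

lemma hist_glue_UNIV_generator:
  defines "E \<equiv> (\<Union>n. sets (hist {} {..<n}))"
  shows "sets (hist {} UNIV) = sigma_sets (space M) E" "Int_stable E" "E \<subseteq> Pow (space M)" "space M \<in> E"
proof -
  have mono: "sets (hist {} {..<n}) \<subseteq> sets (hist {} {..<m})" if "n \<le> m" for n m
    by (rule hist_mono) (use that in auto)
  show "E \<subseteq> Pow (space M)" using sets.sets_into_space unfolding E_def by fastforce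
  show "space M \<in> E" unfolding E_def using sets.top[of "hist {} {..<0}"] by (intro UN_I[of 0]) simp_all
  show "Int_stable E"
  proof (rule Int_stableI)
    fix A B assume "A \<in> E" "B \<in> E"
    then obtain n m where "A \<in> sets (hist {} {..<n})" "B \<in> sets (hist {} {..<m})" unfolding E_def by blast
    then have "A \<in> sets (hist {} {..<max n m})" "B \<in> sets (hist {} {..<max n m})"
      using mono[of n "max n m"] mono[of m "max n m"] by auto
    then show "A \<inter> B \<in> E" unfolding E_def by blast
  qed
  show "sets (hist {} UNIV) = sigma_sets (space M) E"
  proof
    have "hist_gen {} UNIV \<subseteq> E"
    proof
      fix x assume "x \<in> hist_gen {} UNIV"
      then obtain k B where "x = g k -` B \<inter> space M" "B \<in> sets borel" by (auto simp: hist_gen_def)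
      then have "x \<in> sets (hist {} {..<Suc k})"
        using measurable_sets[OF g_hist[of k "{..<Suc k}" "{}"]] by simp
      then show "x \<in> E" unfolding E_def by blast
    qed
    then show "sets (hist {} UNIV) \<subseteq> sigma_sets (space M) E" unfolding sets_hist by (rule sigma_sets_mono')
    have "E \<subseteq> sets (hist {} UNIV)"
      unfolding E_def by (intro UN_least hist_mono) auto
    from sets.sigma_sets_subset[OF this] show "sigma_sets (space M) E \<subseteq> sets (hist {} UNIV)" by simp
  qed
qed

text \<open>
  Both the limit of the integrals and the integral against \<open>\<kappa>\<close> are functions of the gluing points.
  They have the same integral over each event \<open>A\<close> that depends on the first \<open>n\<close> gluing points only: for
  \<open>k \<ge> n\<close> the integrals over \<open>A\<close> of \<open>\<integral>f d\<mu>\<^sub>k\<close> and of \<open>f (X k)\<close> agree, and \<open>k\<close> may tend to infinity.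
\<close>

lemma AE_integrals_tendsto:
  fixes f :: "ell1 \<Rightarrow> real" and Y :: "'w \<Rightarrow> ell1"
  assumes conv: "AE \<omega> in M. convergent (\<lambda>n. \<integral>x. f x \<partial>\<mu>n n \<omega>)" and f: "bounded_lipschitz f"
    and Y: "AE \<omega> in M. (\<lambda>n. X n \<omega>) \<longlonglongrightarrow> Y \<omega>"
    and cl: "cond_law M (hist {} UNIV) Y borel \<kappa>"
  shows "AE \<omega> in M. (\<lambda>n. \<integral>x. f x \<partial>\<mu>n n \<omega>) \<longlonglongrightarrow> (\<integral>x. f x \<partial>\<kappa> \<omega>)"
proof -
  let ?F = "hist {} UNIV"
  obtain K L where K: "\<And>x. \<bar>f x\<bar> \<le> K" and L: "L-lipschitz_on UNIV f"
    using f by (auto simp: bounded_lipschitz_def bounded_iff)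
  have K0: "0 \<le> K" using K[of 0] by linarith
  have fc: "continuous_on UNIV f" by (rule lipschitz_on_continuous_on[OF L])
  have fm[measurable]: "f \<in> borel_measurable borel" by (rule borel_measurable_continuous_onI[OF fc])
  have sub: "subalgebra M ?F" by (rule subalgebra_hist) simp
  have \<kappa>: "\<kappa> \<in> ?F \<rightarrow>\<^sub>M prob_algebra borel" and Ym[measurable]: "Y \<in> borel_measurable M"
    using cl by (auto simp: cond_law_def)
  define m where "m n \<omega> = (\<integral>x. f x \<partial>\<mu>n n \<omega>)" for n \<omega>
  \<comment> \<open>truncated, because \<open>lim\<close> is an arbitrary value where the integrals do not converge\<close>
  define Z where "Z \<omega> = max (- K) (min K (lim (\<lambda>n. m n \<omega>)))" for \<omega>
  define W where "W \<omega> = max (- K) (min K (\<integral>x. f x \<partial>\<kappa> \<omega>))" for \<omega>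
  have m_bd: "\<bar>m n \<omega>\<bar> \<le> K" for n \<omega>
    unfolding m_def by (rule abs_integral_le_bound[OF prob_space_tree_law[OF length_pos] sets_\<mu>n fm K])
  have m_meas[measurable]: "m n \<in> borel_measurable ?F" for n
    unfolding m_def
    by (rule measurable_compose[OF measurable_prob_algebraD[OF measurable_\<mu>n] integral_measurable_subprob_algebra[OF fm]]) auto
  have mM[measurable]: "m n \<in> borel_measurable M" for n by (rule measurable_from_subalg[OF sub m_meas])
  have Z_meas: "Z \<in> borel_measurable ?F" unfolding Z_def by measurable
  have \<kappa>f: "(\<lambda>\<omega>. \<integral>x. f x \<partial>\<kappa> \<omega>) \<in> borel_measurable ?F"
    by (rule measurable_compose[OF measurable_prob_algebraD[OF \<kappa>] integral_measurable_subprob_algebra[OF fm]])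
  then have W_meas: "W \<in> borel_measurable ?F" unfolding W_def by measurable
  have W_eq: "W \<omega> = (\<integral>x. f x \<partial>\<kappa> \<omega>)" if "\<omega> \<in> space M" for \<omega>
  proof -
    have "\<kappa> \<omega> \<in> space (prob_algebra borel)" by (rule measurable_space[OF \<kappa>]) (simp add: that)
    then have "\<bar>\<integral>x. f x \<partial>\<kappa> \<omega>\<bar> \<le> K" by (intro abs_integral_le_bound fm K) (auto simp: space_prob_algebra)
    then show ?thesis unfolding W_def by (auto simp: min_def max_def)
  qed
  have Z_lim: "AE \<omega> in M. (\<lambda>n. m n \<omega>) \<longlonglongrightarrow> Z \<omega>"
    using conv
  proof eventually_elim
    case (elim \<omega>)
    then have l: "(\<lambda>n. m n \<omega>) \<longlonglongrightarrow> lim (\<lambda>n. m n \<omega>)" unfolding m_def by (simp add: convergent_LIMSEQ_iff)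
    have "lim (\<lambda>n. m n \<omega>) \<le> K" "- K \<le> lim (\<lambda>n. m n \<omega>)"
      by (rule LIMSEQ_le_const2[OF l] LIMSEQ_le_const[OF l]; use m_bd[of _ \<omega>] in \<open>auto simp: abs_le_iff minus_le_iff\<close>)+
    then have "Z \<omega> = lim (\<lambda>n. m n \<omega>)" unfolding Z_def by simp
    with l show ?case by simp
  qed
  have "AE \<omega> in M. Z \<omega> = W \<omega>"
  proof (rule AE_eq_if_integrals_agree_on_generator[OF sub hist_glue_UNIV_generator Z_meas _ W_meas])
    show "\<bar>Z \<omega>\<bar> \<le> K" "\<bar>W \<omega>\<bar> \<le> K" for \<omega> unfolding Z_def W_def using K0 by auto
    fix A assume "A \<in> (\<Union>n. sets (hist {} {..<n}))"
    then obtain n where A: "A \<in> sets (hist {} {..<n})" by blast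
    have AF: "A \<in> sets ?F" using A hist_mono[of "{}" "{}" "{..<n}" UNIV] by auto
    have AM[measurable]: "A \<in> sets M" using AF sub by (auto simp: subalgebra_def)
    have eq: "(\<integral>\<omega>. indicator A \<omega> * m k \<omega> \<partial>M) = (\<integral>\<omega>. indicator A \<omega> * f (X k \<omega>) \<partial>M)" if "k \<ge> n" for k
    proof -
      have Ak: "A \<in> sets (hist {} {..<k})" using A hist_mono[of "{}" "{}" "{..<n}" "{..<k}"] that by auto
      have h: "(\<lambda>(\<omega>, y). indicator A \<omega> * f y) \<in> borel_measurable (hist {} {..<k} \<Otimes>\<^sub>M borel)"
        using Ak by measurable
      have "(\<integral>\<omega>. indicator A \<omega> * f (X k \<omega>) \<partial>M) = (\<integral>\<omega>. \<integral>y. indicator A \<omega> * f y \<partial>\<mu>n k \<omega> \<partial>M)"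
        by (rule cond_law_integral[OF prob_space_M marked_cond_law h, of K]) (use K K0 in \<open>auto simp: indicator_def\<close>)
      then show ?thesis by (simp add: m_def)
    qed
    have lim1: "(\<lambda>k. \<integral>\<omega>. indicator A \<omega> * m k \<omega> \<partial>M) \<longlonglongrightarrow> (\<integral>\<omega>. indicator A \<omega> * Z \<omega> \<partial>M)"
    proof (rule integral_dominated_convergence[where w = "\<lambda>_. K"])
      show "AE \<omega> in M. (\<lambda>k. indicator A \<omega> * m k \<omega>) \<longlonglongrightarrow> indicator A \<omega> * Z \<omega>"
        using Z_lim by eventually_elim (intro tendsto_intros)
      show "AE \<omega> in M. norm (indicator A \<omega> * m k \<omega>) \<le> K" for k
        using m_bd K0 by (auto simp: indicator_def)
    qed (use measurable_from_subalg[OF sub Z_meas] in auto)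
    have Xm[measurable]: "X k \<in> borel_measurable M" for k by (rule X_measurable)
    have lim2: "(\<lambda>k. \<integral>\<omega>. indicator A \<omega> * f (X k \<omega>) \<partial>M) \<longlonglongrightarrow> (\<integral>\<omega>. indicator A \<omega> * f (Y \<omega>) \<partial>M)"
    proof (rule integral_dominated_convergence[where w = "\<lambda>_. K"])
      show "AE \<omega> in M. (\<lambda>k. indicator A \<omega> * f (X k \<omega>)) \<longlonglongrightarrow> indicator A \<omega> * f (Y \<omega>)"
        using Y
      proof eventually_elim
        case (elim \<omega>)
        have "isCont f (Y \<omega>)" using fc by (simp add: continuous_on_eq_continuous_at)
        from isCont_tendsto_compose[OF this elim] show ?case by (intro tendsto_intros)
      qed
      show "AE \<omega> in M. norm (indicator A \<omega> * f (X k \<omega>)) \<le> K" for k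
        using K K0 by (auto simp: indicator_def)
    qed auto
    have "(\<lambda>k. \<integral>\<omega>. indicator A \<omega> * m k \<omega> \<partial>M) \<longlonglongrightarrow> (\<integral>\<omega>. indicator A \<omega> * f (Y \<omega>) \<partial>M)"
      by (rule Lim_transform_eventually[OF lim2 eventually_sequentiallyI[of n]]) (rule eq[symmetric])
    from LIMSEQ_unique[OF lim1 this]
    have "(\<integral>\<omega>. indicator A \<omega> * Z \<omega> \<partial>M) = (\<integral>\<omega>. indicator A \<omega> * f (Y \<omega>) \<partial>M)" .
    also have "\<dots> = (\<integral>\<omega>. \<integral>y. indicator A \<omega> * f y \<partial>\<kappa> \<omega> \<partial>M)"
    proof (rule cond_law_integral[OF prob_space_M cl, of _ K])
      show "(\<lambda>(\<omega>, y). indicator A \<omega> * f y) \<in> borel_measurable (?F \<Otimes>\<^sub>M borel)" using AF by measurable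
    qed (use K K0 in \<open>auto simp: indicator_def\<close>)
    also have "\<dots> = (\<integral>\<omega>. indicator A \<omega> * W \<omega> \<partial>M)"
      by (rule Bochner_Integration.integral_cong) (simp_all add: W_eq)
    finally show "(\<integral>\<omega>. indicator A \<omega> * Z \<omega> \<partial>M) = (\<integral>\<omega>. indicator A \<omega> * W \<omega> \<partial>M)" .
  qed
  with Z_lim show ?thesis
    using AE_space by eventually_elim (simp add: m_def W_eq)
qed

text \<open>
  By independence, the probability of no jump at the steps \<open>n, \<dots>, n + k - 1\<close> is the product of the
  factors \<open>1 - p i = A i / A (i + 1)\<close>, which telescopes and tends to \<open>0\<close> when the total length is infinite.
\<close>

lemma AE_moves_infinitely_often:
  assumes div: "\<not> summable (\<lambda>i. a (Suc i))"
  shows "AE \<omega> in M. \<forall>n. \<exists>i\<ge>n. mark_moves i (U (Suc i) \<omega>)"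
proof (subst AE_all_countable, rule allI)
  fix n
  define B where "B k = {\<omega>\<in>space M. \<forall>i\<in>{n..<n + k}. \<not> mark_moves i (U (Suc i) \<omega>)}" for k
  have B_hist: "B k \<in> sets (hist {1..n + k} {..<n + k})" for k
  proof -
    have [measurable]: "U (Suc i) \<in> borel_measurable (hist {1..n + k} {..<n + k})" if "i \<in> {n..<n + k}" for i
      by (rule U_hist) (use that in auto)
    have "{\<omega>\<in>space (hist {1..n + k} {..<n + k}). \<forall>i\<in>{n..<n + k}. \<not> mark_moves i (U (Suc i) \<omega>)} \<in> sets (hist {1..n + k} {..<n + k})"
      by measurable
    then show ?thesis by (simp add: B_def)
  qed
  have BM: "B k \<in> sets M" for k
    using B_hist[of k] subalgebra_hist[of "{1..n + k}" "{..<n + k}"] by (auto simp: subalgebra_def)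
  have rec: "emeasure M (B (Suc k)) = ennreal (1 - p (n + k)) * emeasure M (B k)" for k
  proof -
    have "emeasure M (B (Suc k)) = (\<integral>\<^sup>+\<omega>. indicator (B (Suc k)) \<omega> \<partial>M)" using BM by simp
    also have "\<dots> = (\<integral>\<^sup>+\<omega>. (if mark_moves (n + k) (U (Suc (n + k)) \<omega>) then 0 else indicator (B k) \<omega>) \<partial>M)"
      by (rule nn_integral_cong) (auto simp: B_def indicator_def less_Suc_eq)
    also have "\<dots> = (\<integral>\<^sup>+\<omega>. ennreal (p (n + k)) * (\<integral>\<^sup>+v. 0 \<partial>unit_law) + ennreal (1 - p (n + k)) * indicator (B k) \<omega> \<partial>M)"
      by (rule nn_integral_fresh) (use B_hist[of k] in \<open>simp_all add: split_beta'\<close>)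
    also have "\<dots> = ennreal (1 - p (n + k)) * emeasure M (B k)"
      using BM by (simp add: nn_integral_cmult_indicator)
    finally show ?thesis .
  qed
  have tp: "0 < total_length a (Suc i)" for i by (rule total_length_pos[of a, OF length_pos]) simp_all
  have B_le: "measure M (B k) \<le> total_length a (Suc n) / total_length a (n + k)" if "k \<ge> 1" for k
    using that
  proof (induction k rule: nat_induct_at_least)
    case base
    have "measure M (B 1) \<le> 1" by simp
    then show ?case using tp[of n] by simp
  next
    case (Suc k)
    then obtain j where j: "n + k = Suc j" by (cases "n + k") auto
    have q: "1 - p (n + k) = total_length a (n + k) / total_length a (n + Suc k)"
      using one_minus_glue_prob[of a, OF length_pos, of "n + k"] by simp
    have "measure M (B (Suc k)) = (1 - p (n + k)) * measure M (B k)"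
      using rec[of k] p_bounds(2)[of "n + k"] by (simp add: emeasure_eq_measure ennreal_mult[symmetric])
    also have "\<dots> \<le> (1 - p (n + k)) * (total_length a (Suc n) / total_length a (n + k))"
      using Suc.IH p_bounds(2)[of "n + k"] by (intro mult_left_mono) auto
    also have "\<dots> = total_length a (Suc n) / total_length a (n + Suc k)"
      unfolding q using tp[of j] j by simp
    finally show ?case .
  qed
  have tl: "total_length a k = (\<Sum>i<k. a (Suc i))" for k by (induction k) (simp_all add: total_length_def)
  have "filterlim (\<lambda>k. \<Sum>i<k. a (Suc i)) at_top sequentially"
  proof (rule ccontr)
    assume *: "\<not> ?thesis"
    have "\<exists>C. \<forall>k. (\<Sum>i<k. a (Suc i)) \<le> C"
    proof (rule ccontr)
      assume "\<not> (\<exists>C. \<forall>k. (\<Sum>i<k. a (Suc i)) \<le> C)"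
      then have unb: "\<And>C. \<exists>k. C < (\<Sum>i<k. a (Suc i))" by (auto simp: not_le)
      have "filterlim (\<lambda>k. \<Sum>i<k. a (Suc i)) at_top sequentially"
        unfolding filterlim_at_top
      proof
        fix C obtain k where k: "C < (\<Sum>i<k. a (Suc i))" using unb by blast
        have "C \<le> (\<Sum>i<l. a (Suc i))" if "l \<ge> k" for l
        proof -
          have "(\<Sum>i<k. a (Suc i)) \<le> (\<Sum>i<l. a (Suc i))"
            by (rule sum_mono2) (use that in \<open>auto intro: less_imp_le[OF a_pos]\<close>)
          with k show ?thesis by linarith
        qed
        then show "\<forall>\<^sub>F l in sequentially. C \<le> (\<Sum>i<l. a (Suc i))" by (auto simp: eventually_sequentially)
      qed
      with * show False by simp
    qed
    then obtain C where "\<And>k. (\<Sum>i<k. a (Suc i)) \<le> C" by blast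
    then have "summable (\<lambda>i. a (Suc i))" by (intro summableI_nonneg_bounded[of _ C]) (auto intro: less_imp_le[OF a_pos])
    with div show False by simp
  qed
  then have "filterlim (\<lambda>k. total_length a (n + k)) at_top sequentially"
    unfolding tl
    by (rule filterlim_at_top_mono) (intro always_eventually allI sum_mono2, auto intro: less_imp_le[OF a_pos])
  then have lim: "(\<lambda>k. total_length a (Suc n) / total_length a (n + k)) \<longlonglongrightarrow> 0"
    by (intro tendsto_divide_0[OF tendsto_const] filterlim_at_top_imp_at_infinity)
  let ?N = "{\<omega>\<in>space M. \<forall>i\<ge>n. \<not> mark_moves i (U (Suc i) \<omega>)}"
  have N_eq: "?N = (\<Inter>k. B k)"
  proof (intro equalityI subsetI)
    fix \<omega> assume w: "\<omega> \<in> (\<Inter>k. B k)"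
    then have "\<not> mark_moves i (U (Suc i) \<omega>)" if "i \<ge> n" for i
      using that by (auto simp: B_def dest!: spec[of _ "Suc (i - n)"])
    then show "\<omega> \<in> ?N" using w by (auto simp: B_def)
  qed (auto simp: B_def)
  then have NM: "?N \<in> sets M" using BM by auto
  have "measure M ?N \<le> 0"
  proof (rule LIMSEQ_le_const[OF lim], intro exI[of _ 1] allI impI)
    fix k :: nat assume "1 \<le> k"
    have "measure M ?N \<le> measure M (B k)"
      unfolding N_eq by (rule finite_measure_mono) (use BM in auto)
    also have "\<dots> \<le> total_length a (Suc n) / total_length a (n + k)" by (rule B_le) fact
    finally show "measure M ?N \<le> total_length a (Suc n) / total_length a (n + k)" .
  qed
  then have "measure M ?N = 0" using measure_nonneg by (rule antisym)
  then have "emeasure M ?N = 0" by (simp only: emeasure_eq_measure ennreal_0)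
  then have "?N \<in> null_sets M" using NM by (rule null_setsI)
  then have "AE \<omega> in M. \<omega> \<notin> ?N" by (rule AE_not_in)
  then show "AE \<omega> in M. \<exists>i\<ge>n. mark_moves i (U (Suc i) \<omega>)"
    using AE_space
  proof eventually_elim
    case (elim \<omega>)
    then show ?case by blast
  qed
qed

lemma coord_X: "coord (X n \<omega>) i = (if i < n \<and> mark_moves i (U (Suc i) \<omega>) then a (Suc i) * V (Suc i) \<omega> else 0)"
  by (induction n) (auto simp: X_Suc less_Suc_eq)

text \<open>
  Each jump creates a positive coordinate which never changes afterwards.
\<close>

lemma AE_limit_point_infinite_support:
  assumes div: "\<not> summable (\<lambda>i. a (Suc i))" and Y: "AE \<omega> in M. (\<lambda>n. X n \<omega>) \<longlonglongrightarrow> Y \<omega>"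
  shows "AE \<omega> in M. \<forall>n. \<exists>i\<ge>n. coord (Y \<omega>) i \<noteq> 0"
proof -
  have "AE \<omega> in M. \<forall>i. V (Suc i) \<omega> \<in> {0<..<1}"
    using AE_V_in_unit_interval[of "Suc _"] by (subst AE_all_countable) simp
  with AE_moves_infinitely_often[OF div] Y show ?thesis
  proof eventually_elim
    case (elim \<omega>)
    show ?case
    proof
      fix n
      from elim obtain i where i: "i \<ge> n" "mark_moves i (U (Suc i) \<omega>)" by blast
      have "(\<lambda>k. coord (X k \<omega>) i) \<longlonglongrightarrow> coord (Y \<omega>) i"
        by (rule bounded_linear.tendsto[OF bounded_linear_coord]) (use elim in blast)
      moreover have "(\<lambda>k. coord (X k \<omega>) i) \<longlonglongrightarrow> a (Suc i) * V (Suc i) \<omega>"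
        by (rule tendsto_eventually) (use i in \<open>auto simp: coord_X eventually_sequentially intro!: exI[of _ "Suc i"]\<close>)
      ultimately have "coord (Y \<omega>) i = a (Suc i) * V (Suc i) \<omega>" by (rule LIMSEQ_unique)
      moreover have "0 < a (Suc i) * V (Suc i) \<omega>" using elim a_pos[of i] by simp
      ultimately have "coord (Y \<omega>) i \<noteq> 0" by linarith
      with i show "\<exists>i\<ge>n. coord (Y \<omega>) i \<noteq> 0" by blast
    qed
  qed
qed

lemma AE_tree_law_converges_weakly:
  fixes Y :: "'w \<Rightarrow> ell1"
  assumes H: "summable (\<lambda>i. (a (Suc i))\<^sup>2 / total_length a (Suc i))"
    and Y: "AE \<omega> in M. (\<lambda>n. X n \<omega>) \<longlonglongrightarrow> Y \<omega>"
    and cl: "cond_law M (hist {} UNIV) Y borel \<kappa>"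
  shows "AE \<omega> in M. converges_weakly (\<lambda>n. \<mu>n n \<omega>) (\<kappa> \<omega>)"
proof -
  have \<kappa>: "\<kappa> \<in> hist {} UNIV \<rightarrow>\<^sub>M prob_algebra borel" using cl by (simp add: cond_law_def)
  obtain T :: "(ell1 \<Rightarrow> real) set" where T: "countable T" "\<And>h. h \<in> T \<Longrightarrow> bounded_lipschitz h"
    and det: "\<And>N L. (\<And>n. prob_space (N n) \<and> sets (N n) = sets borel) \<Longrightarrow> prob_space L \<Longrightarrow> sets L = sets borel \<Longrightarrow>
       (\<And>h. h \<in> T \<Longrightarrow> (\<lambda>n. \<integral>x. h x \<partial>N n) \<longlonglongrightarrow> (\<integral>x. h x \<partial>L)) \<Longrightarrow> converges_weakly N L"
    by (rule countable_convergence_determining) blast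
  have "AE \<omega> in M. \<forall>h\<in>T. (\<lambda>n. \<integral>x. h x \<partial>\<mu>n n \<omega>) \<longlonglongrightarrow> (\<integral>x. h x \<partial>\<kappa> \<omega>)"
    unfolding AE_ball_countable[OF T(1)]
    using AE_integrals_tendsto[OF AE_integrals_converge[OF H T(2)] T(2) Y cl] by blast
  then show ?thesis
    using AE_space
  proof eventually_elim
    case (elim \<omega>)
    have "\<kappa> \<omega> \<in> space (prob_algebra borel)" by (rule measurable_space[OF \<kappa>]) (simp add: elim)
    then have "prob_space (\<kappa> \<omega>)" "sets (\<kappa> \<omega>) = sets borel" by (auto simp: space_prob_algebra)
    then show ?case
      by (intro det) (use elim prob_space_tree_law[OF length_pos] in auto)
  qed
qed

end

theorem theorem4:
  fixes M :: "'w measure"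
    and a :: "nat \<Rightarrow> real"
    and U V :: "nat \<Rightarrow> 'w \<Rightarrow> real"
    and g :: "nat \<Rightarrow> 'w \<Rightarrow> ell1"
  assumes "segment_gluing M a U V g"
    and "bounded (a ` {1..})"
    and "summable (\<lambda>i. (a (Suc i))\<^sup>2 / total_length a (Suc i))"
  shows "\<exists>\<mu> \<in> M \<rightarrow>\<^sub>M prob_algebra borel.
    (AE \<omega> in M. (AE x in \<mu> \<omega>. x \<in> limit_tree a (\<lambda>k. g k \<omega>)) \<and>
       converges_weakly (\<lambda>n. normalized_length a (\<lambda>k. g k \<omega>) {..<n}) (\<mu> \<omega>)) \<and>
    (AE \<omega> in M. convergent (\<lambda>n. marked_point a U V n \<omega>)) \<and>
    (\<forall>B \<in> sets borel. AE \<omega> in M.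
       real_cond_exp M (vimage_algebra (space M) \<mu> (prob_algebra borel))
         (\<lambda>\<omega>. indicator B (lim (\<lambda>n. marked_point a U V n \<omega>))) \<omega> = measure (\<mu> \<omega>) B) \<and>
    (\<not> summable (\<lambda>i. a (Suc i)) \<longrightarrow>
       (AE \<omega> in M. AE x in \<mu> \<omega>. x \<in> leaves (limit_tree a (\<lambda>k. g k \<omega>)))) \<and>
    (summable (\<lambda>i. a (Suc i)) \<longrightarrow>
       (AE \<omega> in M. (AE x in \<mu> \<omega>. x \<in> skeleton (limit_tree a (\<lambda>k. g k \<omega>))) \<and>
          \<mu> \<omega> = normalized_length a (\<lambda>k. g k \<omega>) UNIV))"
proof -
  interpret segment_gluing M a U V g by fact
  note H = assms(3)
  define Y where "Y \<omega> = lim (\<lambda>n. marked_point a U V n \<omega>)" for \<omega>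
  note [measurable] = X_measurable
  have Y_meas: "Y \<in> borel_measurable M" unfolding Y_def by measurable
  have conv: "AE \<omega> in M. convergent (\<lambda>n. marked_point a U V n \<omega>)"
    by (rule AE_marked_points_converge[OF H])
  then have Y: "AE \<omega> in M. (\<lambda>n. marked_point a U V n \<omega>) \<longlonglongrightarrow> Y \<omega>"
    by eventually_elim (simp add: Y_def convergent_LIMSEQ_iff)
  obtain \<mu> where cl: "cond_law M (hist {} UNIV) Y borel \<mu>"
    using cond_law_exists[OF prob_space_axioms subalgebra_hist Y_meas] by auto
  have \<mu>: "\<mu> \<in> M \<rightarrow>\<^sub>M prob_algebra borel"
    using cl measurable_from_subalg unfolding cond_law_def by blast
  have \<mu>_prob: "prob_space (\<mu> \<omega>)" "sets (\<mu> \<omega>) = sets borel" if "\<omega> \<in> space M" for \<omega>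
    using measurable_space[OF \<mu> that] by (auto simp: space_prob_algebra)
  have weak: "AE \<omega> in M. converges_weakly (\<lambda>n. tree_law a (\<lambda>k. g k \<omega>) n) (\<mu> \<omega>)"
    by (rule AE_tree_law_converges_weakly[OF H Y cl])
  then have weak': "AE \<omega> in M. converges_weakly (\<lambda>n. normalized_length a (\<lambda>k. g k \<omega>) {..<n}) (\<mu> \<omega>)"
  proof eventually_elim
    case (elim \<omega>)
    have "tree_law a (\<lambda>k. g k \<omega>) n = normalized_length a (\<lambda>k. g k \<omega>) {..<n}" if "n \<ge> 1" for n
      using that by (simp add: tree_law_def[OF length_pos])
    then show ?case
      by (intro converges_weakly_cong[OF _ elim] eventually_sequentiallyI[of 1])
  qed
  have support: "AE \<omega> in M. AE x in \<mu> \<omega>. x \<in> limit_tree a (\<lambda>k. g k \<omega>)"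
    using weak AE_space
  proof eventually_elim
    case (elim \<omega>)
    let ?T = "limit_tree a (\<lambda>k. g k \<omega>)"
    have "AE x in tree_law a (\<lambda>k. g k \<omega>) n. x \<in> ?T" for n
    proof -
      have "AE x in tree_law a (\<lambda>k. g k \<omega>) n. x \<in> finite_tree a (\<lambda>k. g k \<omega>) n"
        by (rule AE_tree_law_in_tree[OF length_pos])
      then show ?thesis by eventually_elim (rule subsetD[OF finite_tree_subset_limit_tree])
    qed
    moreover have "?T \<noteq> {}" using subsetD[OF finite_tree_subset_limit_tree zero_in_finite_tree] by blast
    ultimately show ?case
      by (intro weak_limit_supported_by_closed[OF elim(1) \<mu>_prob[OF elim(2)] closed_limit_tree])
        (auto simp: prob_space_tree_law[OF length_pos])
  qed
  have leaves: "AE \<omega> in M. AE x in \<mu> \<omega>. x \<in> leaves (limit_tree a (\<lambda>k. g k \<omega>))"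
    if div: "\<not> summable (\<lambda>i. a (Suc i))"
  proof -
    have "{y. \<forall>n. \<exists>i\<ge>n. coord y i \<noteq> 0} \<in> sets borel" by measurable
    from cond_law_AE_transfer[OF cl this AE_limit_point_infinite_support[OF div Y]] support AE_glued_in_tree
    show ?thesis
    proof eventually_elim
      case (elim \<omega>)
      from elim(1,2) show ?case
        by eventually_elim (rule infinite_support_imp_leaf, use elim(3) length_pos in auto)
    qed
  qed
  have skeleton: "AE \<omega> in M. (AE x in \<mu> \<omega>. x \<in> skeleton (limit_tree a (\<lambda>k. g k \<omega>))) \<and>
      \<mu> \<omega> = normalized_length a (\<lambda>k. g k \<omega>) UNIV"
    if summ: "summable (\<lambda>i. a (Suc i))"
    using weak AE_glued_in_tree AE_space
  proof eventually_elim
    case (elim \<omega>)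
    have eq: "\<mu> \<omega> = normalized_length a (\<lambda>k. g k \<omega>) UNIV"
      by (rule weak_limit_eq_normalized_length[OF length_pos summ \<mu>_prob[OF elim(3)] elim(1)])
    have "AE x in normalized_length a (\<lambda>k. g k \<omega>) UNIV. x \<in> skeleton (limit_tree a (\<lambda>k. g k \<omega>))"
      by (rule normalized_length_in_skeleton[OF length_pos]) (use elim(2) in auto)
    then show ?case unfolding eq by (intro conjI refl)
  qed
  have exch: "\<forall>B \<in> sets borel. AE \<omega> in M.
       real_cond_exp M (vimage_algebra (space M) \<mu> (prob_algebra borel))
         (\<lambda>\<omega>. indicator B (lim (\<lambda>n. marked_point a U V n \<omega>))) \<omega> = measure (\<mu> \<omega>) B"
    using cond_law_real_cond_exp[OF cl] unfolding Y_def by blast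
  show ?thesis
    using \<mu> support weak' conv exch leaves skeleton by (intro bexI[of _ \<mu>]) auto
qed

end
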